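(* Let $(\mathcal{X},d,\mu)$ be a space of homogeneous type with upper dimension $\omega$, with a fixed dyadic system and a fixed wavelet system $\{\phi_\alpha^k\}$, $\{\psi_\beta^{k+1}\}$ of smoothness index $\eta$ (all as in the context), and let $\theta\in(0,\eta/\omega)$. Then, for any $f\in L^2_{\mathcal{B}}(\mathcal{X})$, the following statements are equivalent: (i) $f\in\mathrm{lip}_\theta(\mathcal{X})$; (ii) $$f=\sum_{\alpha\in\mathcal{A}_0}\langle f,\phi_\alpha^0\rangle\phi_\alpha^0+\sum_{k=0}^\infty\sum_{\beta\in\mathcal{G}_k}\langle f,\psi_\beta^{k+1}\rangle\psi_\beta^{k+1}$$ in $L^2_{\mathcal{B}}(\mathcal{X})$ and $$\|f\|_\ast:=\sup_{Q\in\mathcal{D}_0}\left\{\frac{1}{[\mu(Q)]^{1+2\theta}}\left[\sum_{\{\alpha\in\mathcal{A}_0:\,Q_\alpha^0\subset Q\}}|\langle f,\phi_\alpha^0\rangle|^2+\sum_{k=0}^\infty\sum_{\{\beta\in\mathcal{G}_k:\,Q_\beta^{k+1}\subset Q\}}|\langle f,\psi_\beta^{k+1}\rangle|^2\right]\right\}^{1/2}<\infty.$$ Moreover, there exists a constant $C\in[1,\infty)$, independent of $f$, such that, for every $f$ satisfying these equivalent conditions, $$C^{-1}\|f\|_\ast\le\|f\|_{\mathrm{lip}_\theta(\mathcal{X})}\le C\|f\|_\ast.$$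
   Context: **Space of homogeneous type.** $\mathcal{X}$ is a non-empty set, $d:\mathcal{X}\times\mathcal{X}\to[0,\infty)$ satisfies $d(x,y)=0\iff x=y$, $d(x,y)=d(y,x)$, and $d(x,z)\le A_0[d(x,y)+d(y,z)]$ for a constant $A_0\in[1,\infty)$; $\mu$ is a measure on $\mathcal{X}$ such that $\mu(2B)\le C\mu(B)$ for all balls $B=B(x_B,r_B):=\{x:d(x_B,x)<r_B\}$, where $\tau B:=B(x_B,\tau r_B)$. Standing assumptions: $\mu(\mathcal{X})=\infty$; for each $x$ the balls $\{B(x,r)\}_{r>0}$ form a basis of open neighborhoods of $x$; $\mu$ is Borel regular (open sets are measurable and every set $A$ lies in a Borel set $E$ with $\mu(A)=\mu(E)$); $\mu(B(x,r))\in(0,\infty)$ and $\mu(\{x\})=0$ for all $x$ and $r>0$. Put $C_{(\mu)}:=\sup_B\mu(2B)/\mu(B)$; the upper dimension is $\omega:=\log_2C_{(\mu)}$, so $\mu(\lambda B)\le C_{(\mu)}\lambda^\omega\mu(B)$ for $\lambda\ge1$. Write $V_r(x):=\mu(B(x,r))$. **Function spaces.** $L^q_{\mathcal{B}}(\mathcal{X})$ ($q\in[1,\infty]$) is the set of measurable $f$ with $f\mathbf{1}_B\in L^q(\mathcal{X})$ for every ball $B$; $f_n\to f$ in $L^q_{\mathcal{B}}(\mathcal{X})$ means $\|f_n-f\|_{L^q(B)}\to0$ for every ball $B$. For $\theta>0$ and a ball $B$ of radius $r_B$, let $\mathcal{M}^B_\theta(f):=\sup_{x,y\in B}|f(x)-f(y)|/[\mu(B)]^\theta$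 if $r_B\in(0,1]$ and $\mathcal{M}^B_\theta(f):=\|f\|_{L^\infty(B)}/[\mu(B)]^\theta$ if $r_B\in(1,\infty)$. Then $\mathrm{lip}_\theta(\mathcal{X}):=\{f\in L^q_{\mathcal{B}}(\mathcal{X}):\|f\|_{\mathrm{lip}_\theta(\mathcal{X})}:=\sup_B\mathcal{M}^B_\theta(f)<\infty\}$ (the choice of $q$ is immaterial). An element of $L^2_{\mathcal{B}}(\mathcal{X})$ is said to be in $\mathrm{lip}_\theta(\mathcal{X})$ if it agrees a.e. with such a function. **Dyadic system.** Fix $0<c_0<C_0$ and a (sufficiently small) $\delta\in(0,1)$ with $12A_0^3C_0\delta\le c_0$, countable index sets $\mathcal{A}_k$ and points $\{x_\alpha^k\}_{\alpha\in\mathcal{A}_k}$ ($k\in\mathbb{Z}$) with $d(x_\alpha^k,x_\beta^k)\ge c_0\delta^k$ for $\alpha\ne\beta$, $\min_{\alpha\in\mathcal{A}_k}d(x,x_\alpha^k)<C_0\delta^k$ for all $x$, and $\mathcal{X}^k:=\{x_\alpha^k:\alpha\in\mathcal{A}_k\}\subset\mathcal{X}^{k+1}$; and dyadic (Hytönen–Kairema) cubes $\{Q_\alpha^k\}$ such that: for each $k$, $\{Q_\alpha^k\}_{\alpha\in\mathcal{A}_k}$ is a partition of $\mathcal{X}$; if $l\le k$ then either $Q_\beta^k\subset Q_\alpha^l$ or $Q_\beta^k\cap Q_\alpha^l=\emptyset$; $B(x_\alpha^k,c_\#\delta^k)\subset Q_\alpha^k\subset B(x_\alpha^k,C_\#\delta^k)$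 with $c_\#:=(3A_0^2)^{-1}c_0$, $C_\#:=\max\{2A_0C_0,1\}$. Let $\mathcal{G}_k:=\{\alpha\in\mathcal{A}_{k+1}:x_\alpha^{k+1}\in\mathcal{X}^{k+1}\setminus\mathcal{X}^k\}$ and $\mathcal{D}_0:=\bigcup_{k=0}^\infty\{Q_\alpha^k:\alpha\in\mathcal{A}_k\}$. **Wavelets.** Fix the Auscher–Hytönen wavelet system: real-valued functions $\phi_\alpha^k$ ($k\in\mathbb{Z},\alpha\in\mathcal{A}_k$) and $\psi_\beta^{k+1}$ ($k\in\mathbb{Z},\beta\in\mathcal{G}_k$), and constants $s\in(0,1]$, $\eta\in(0,1)$ (the smoothness index), $\nu,C\in(0,\infty)$ such that, with $E_k(x,y):=\exp(-\nu[d(x,y)/\delta^k]^s)$: $|\phi_\alpha^k(x)|\le C[V_{\delta^k}(x_\alpha^k)]^{-1/2}E_k(x,x_\alpha^k)$; for $d(x,x')\le\delta^k$, $|\phi_\alpha^k(x)-\phi_\alpha^k(x')|\le C[V_{\delta^k}(x_\alpha^k)]^{-1/2}[d(x,x')/\delta^k]^\eta E_k(x,x_\alpha^k)$; the same two bounds hold for $\psi_\beta^{k+1}$ with $x_\alpha^k$ replaced by $x_\beta^{k+1}$ (and $\delta^k$, $E_k$ unchanged); $\int_{\mathcal{X}}\psi_\beta^{k+1}\,d\mu=0$; and for every $k_0\in\mathbb{Z}$, $\{\phi_\alpha^{k_0}\}_{\alpha\in\mathcal{A}_{k_0}}\cup\{\psi_\beta^{k+1}:k\ge k_0,\beta\in\mathcal{G}_k\}$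 is an orthonormal basis of $L^2(\mathcal{X})$. **Pairing.** $\langle f,g\rangle:=\int_{\mathcal{X}}f(x)g(x)\,d\mu(x)$; statement (ii) includes the requirement that all the integrals $\langle f,\phi_\alpha^0\rangle$, $\langle f,\psi_\beta^{k+1}\rangle$ converge absolutely. Sums over the countable index sets are understood unconditionally. *)

theory Defs
  imports "HOL-Analysis.Analysis" "HOL-Probability.Essential_Supremum"
begin

section \<open>Spaces of homogeneous type\<close>

definition qball :: "('a \<Rightarrow> 'a \<Rightarrow> real) \<Rightarrow> 'a \<Rightarrow> real \<Rightarrow> 'a set" where
  "qball d x r = {y. d x y < r}"

text \<open>
  The only topology in which every point can have its balls as a neighbourhood basis.
  Balls of a quasi-metric need not belong to it; that they do is an assumption below.
\<close>
definition qopen :: "('a \<Rightarrow> 'a \<Rightarrow> real) \<Rightarrow> 'a set \<Rightarrow> bool" where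
  "qopen d U \<longleftrightarrow> (\<forall>x\<in>U. \<exists>r>0. qball d x r \<subseteq> U)"

text \<open>
  The underlying set is the whole type. In \<open>borel_regular\<close> the set \<open>A\<close> is arbitrary, so
  its measure is the outer measure (\<^const>\<open>emeasure\<close> is 0 off the sigma-algebra). The
  sigma-algebra may be larger than the Borel one and need not be complete.
\<close>
locale homogeneous_type =
  fixes M :: "'a measure" and d :: "'a \<Rightarrow> 'a \<Rightarrow> real" and A0 :: real
  assumes space_M: "space M = UNIV"
    and d_nonneg: "0 \<le> d x y"
    and d_eq_0_iff: "d x y = 0 \<longleftrightarrow> x = y"
    and d_sym: "d x y = d y x"
    and A0_ge_1: "1 \<le> A0"
    and quasi_triangle: "d x z \<le> A0 * (d x y + d y z)"
    and doubling: "\<exists>C. \<forall>x. \<forall>r>0.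
          emeasure M (qball d x (2 * r)) \<le> ennreal C * emeasure M (qball d x r)"
    and infinite_measure: "emeasure M UNIV = \<infinity>"
    and qball_open: "0 < r \<Longrightarrow> qopen d (qball d x r)"
    and open_measurable: "qopen d U \<Longrightarrow> U \<in> sets M"
    and borel_regular: "\<exists>E \<in> sigma_sets UNIV {U. qopen d U}.
          A \<subseteq> E \<and> outer_measure_of M A = emeasure M E"
    and qball_measure_pos: "0 < r \<Longrightarrow> 0 < emeasure M (qball d x r)"
    and qball_measure_finite: "0 < r \<Longrightarrow> emeasure M (qball d x r) < \<infinity>"
    and point_null: "emeasure M {x} = 0"

definition doubling_const :: "'a measure \<Rightarrow> ('a \<Rightarrow> 'a \<Rightarrow> real) \<Rightarrow> real" where
  "doubling_const M d =
     Sup {measure M (qball d x (2 * r)) / measure M (qball d x r) | x r. 0 < r}"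

definition upper_dim :: "'a measure \<Rightarrow> ('a \<Rightarrow> 'a \<Rightarrow> real) \<Rightarrow> real" where
  "upper_dim M d = log 2 (doubling_const M d)"

section \<open>Function spaces\<close>

definition L2 :: "'a measure \<Rightarrow> ('a \<Rightarrow> 'b::real_normed_vector) \<Rightarrow> bool" where
  "L2 M f \<longleftrightarrow> f \<in> borel_measurable M \<and> integrable M (\<lambda>x. (norm (f x))\<^sup>2)"

definition L2B :: "'a measure \<Rightarrow> ('a \<Rightarrow> 'a \<Rightarrow> real) \<Rightarrow> ('a \<Rightarrow> 'b::real_normed_vector) \<Rightarrow> bool" where
  "L2B M d f \<longleftrightarrow> f \<in> borel_measurable M \<and>
     (\<forall>x. \<forall>r>0. set_integrable M (qball d x r) (\<lambda>y. (norm (f y))\<^sup>2))"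

definition L2_norm_on :: "'a measure \<Rightarrow> 'a set \<Rightarrow> ('a \<Rightarrow> 'b::real_normed_vector) \<Rightarrow> real" where
  "L2_norm_on M B f = sqrt (LINT x:B|M. (norm (f x))\<^sup>2)"

text \<open>Unconditional summation: the limit is along the net of finite subsets of \<open>J\<close>.\<close>
definition has_sum_L2B ::
    "'a measure \<Rightarrow> ('a \<Rightarrow> 'a \<Rightarrow> real) \<Rightarrow> ('j \<Rightarrow> 'a \<Rightarrow> 'b::real_normed_vector) \<Rightarrow> 'j set
      \<Rightarrow> ('a \<Rightarrow> 'b) \<Rightarrow> bool" where
  "has_sum_L2B M d g J f \<longleftrightarrow> (\<forall>j\<in>J. L2B M d (g j)) \<and> L2B M d f \<and>
     (\<forall>x. \<forall>r>0. ((\<lambda>F. L2_norm_on M (qball d x r) (\<lambda>y. (\<Sum>j\<in>F. g j y) - f y)) \<longlongrightarrow> 0)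
        (finite_subsets_at_top J))"

definition lip_local ::
    "'a measure \<Rightarrow> ('a \<Rightarrow> 'a \<Rightarrow> real) \<Rightarrow> real \<Rightarrow> ('a \<Rightarrow> complex) \<Rightarrow> 'a \<Rightarrow> real \<Rightarrow> ennreal" where
  "lip_local M d \<theta> f x r =
     (if r \<le> 1
      then (SUP y\<in>qball d x r. SUP z\<in>qball d x r. ennreal (cmod (f y - f z)))
      else esssup M (\<lambda>y. indicator (qball d x r) y * ennreal (cmod (f y))))
     / ennreal (measure M (qball d x r) powr \<theta>)"

definition lip_norm ::
    "'a measure \<Rightarrow> ('a \<Rightarrow> 'a \<Rightarrow> real) \<Rightarrow> real \<Rightarrow> ('a \<Rightarrow> complex) \<Rightarrow> ennreal" where
  "lip_norm M d \<theta> f = (SUP x. SUP r\<in>{0<..}. lip_local M d \<theta> f x r)"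

definition lip :: "'a measure \<Rightarrow> ('a \<Rightarrow> 'a \<Rightarrow> real) \<Rightarrow> real \<Rightarrow> ('a \<Rightarrow> complex) set" where
  "lip M d \<theta> = {f. L2B M d f \<and> lip_norm M d \<theta> f < \<infinity>}"

section \<open>Dyadic systems\<close>

text \<open>
  Measurability of the cubes is part of the Hytonen--Kairema construction, and is what
  gives \<open>\<mu>(Q)\<close> a meaning.
\<close>
locale dyadic_system = homogeneous_type M d A0
  for M :: "'a measure" and d :: "'a \<Rightarrow> 'a \<Rightarrow> real" and A0 :: real +
  fixes c0 C0 \<delta> :: real
    and A :: "int \<Rightarrow> 'i set" and pt :: "int \<Rightarrow> 'i \<Rightarrow> 'a" and Q :: "int \<Rightarrow> 'i \<Rightarrow> 'a set"
  assumes c0_pos: "0 < c0" and c0_less_C0: "c0 < C0"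
    and \<delta>_pos: "0 < \<delta>" and \<delta>_less_1: "\<delta> < 1" and \<delta>_small: "12 * A0 ^ 3 * C0 * \<delta> \<le> c0"
    and countable_A: "countable (A k)"
    and separated: "\<alpha> \<in> A k \<Longrightarrow> \<beta> \<in> A k \<Longrightarrow> \<alpha> \<noteq> \<beta> \<Longrightarrow> c0 * \<delta> powi k \<le> d (pt k \<alpha>) (pt k \<beta>)"
    and net: "\<exists>\<alpha>\<in>A k. d x (pt k \<alpha>) < C0 * \<delta> powi k"
    and nested_points: "pt k ` A k \<subseteq> pt (k + 1) ` A (k + 1)"
    and cube_measurable: "\<alpha> \<in> A k \<Longrightarrow> Q k \<alpha> \<in> sets M"
    and cubes_disjoint: "disjoint_family_on (Q k) (A k)"
    and cubes_cover: "(\<Union>\<alpha>\<in>A k. Q k \<alpha>) = UNIV"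
    and cubes_nested: "l \<le> k \<Longrightarrow> \<alpha> \<in> A l \<Longrightarrow> \<beta> \<in> A k \<Longrightarrow> Q k \<beta> \<subseteq> Q l \<alpha> \<or> Q k \<beta> \<inter> Q l \<alpha> = {}"
    and inner_ball: "\<alpha> \<in> A k \<Longrightarrow> qball d (pt k \<alpha>) (c0 / (3 * A0\<^sup>2) * \<delta> powi k) \<subseteq> Q k \<alpha>"
    and outer_ball: "\<alpha> \<in> A k \<Longrightarrow> Q k \<alpha> \<subseteq> qball d (pt k \<alpha>) (max (2 * A0 * C0) 1 * \<delta> powi k)"

definition new_index :: "(int \<Rightarrow> 'i set) \<Rightarrow> (int \<Rightarrow> 'i \<Rightarrow> 'a) \<Rightarrow> int \<Rightarrow> 'i set" where
  "new_index A pt k = {\<alpha> \<in> A (k + 1). pt (k + 1) \<alpha> \<notin> pt k ` A k}"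

definition cubes0 :: "(int \<Rightarrow> 'i set) \<Rightarrow> (int \<Rightarrow> 'i \<Rightarrow> 'a set) \<Rightarrow> 'a set set" where
  "cubes0 A Q = (\<Union>k\<in>{0..}. Q k ` A k)"

section \<open>Wavelet systems\<close>

text \<open>
  The basis starting at level \<open>k0\<close> as one family: \<open>Inl (k0, \<alpha>)\<close> indexes \<open>\<phi>\<^sub>\<alpha>\<close> at level \<open>k0\<close>
  and \<open>Inr (k, \<beta>)\<close> indexes \<open>\<psi>\<^sub>\<beta>\<close> at level \<open>k + 1\<close>.
\<close>
definition wavelet_index ::
    "(int \<Rightarrow> 'i set) \<Rightarrow> (int \<Rightarrow> 'i \<Rightarrow> 'a) \<Rightarrow> int \<Rightarrow> (int \<times> 'i + int \<times> 'i) set" where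
  "wavelet_index A pt k0 = ({k0} \<times> A k0) <+> (SIGMA k:{k0..}. new_index A pt k)"

fun wavelet ::
    "(int \<Rightarrow> 'i \<Rightarrow> 'a \<Rightarrow> real) \<Rightarrow> (int \<Rightarrow> 'i \<Rightarrow> 'a \<Rightarrow> real) \<Rightarrow> int \<times> 'i + int \<times> 'i \<Rightarrow> 'a \<Rightarrow> real" where
  "wavelet \<phi> \<psi> (Inl (k, \<alpha>)) = \<phi> k \<alpha>"
| "wavelet \<phi> \<psi> (Inr (k, \<beta>)) = \<psi> (k + 1) \<beta>"

text \<open>A real-valued family as an orthonormal basis of the complex space \<open>L\<^sup>2\<close>: orthonormality and
  density of the linear span.\<close>
definition orthonormal_basis_L2 :: "'a measure \<Rightarrow> ('j \<Rightarrow> 'a \<Rightarrow> real) \<Rightarrow> 'j set \<Rightarrow> bool" where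
  "orthonormal_basis_L2 M w J \<longleftrightarrow>
     (\<forall>j\<in>J. L2 M (w j)) \<and>
     (\<forall>i\<in>J. \<forall>j\<in>J. (LINT x|M. w i x * w j x) = (if i = j then 1 else 0)) \<and>
     (\<forall>f :: 'a \<Rightarrow> complex. L2 M f \<longrightarrow> (\<forall>\<epsilon>>0. \<exists>F c. finite F \<and> F \<subseteq> J \<and>
        L2_norm_on M (space M) (\<lambda>x. f x - (\<Sum>j\<in>F. c j * complex_of_real (w j x))) < \<epsilon>))"

text \<open>
  Size and Hoelder bounds at scale \<open>\<rho> = \<delta>\<^sup>k\<close> around \<open>p\<close>. For \<open>\<psi>\<close> at level \<open>k + 1\<close> the centre
  is a point of level \<open>k + 1\<close> but the scale remains \<open>\<delta>\<^sup>k\<close>.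
\<close>
definition wavelet_bounds ::
    "'a measure \<Rightarrow> ('a \<Rightarrow> 'a \<Rightarrow> real) \<Rightarrow> real \<Rightarrow> real \<Rightarrow> real \<Rightarrow> real \<Rightarrow> 'a \<Rightarrow> real \<Rightarrow> ('a \<Rightarrow> real)
      \<Rightarrow> bool" where
  "wavelet_bounds M d s \<eta> \<nu> C p \<rho> w \<longleftrightarrow>
     (\<forall>x. \<bar>w x\<bar> \<le> C * measure M (qball d p \<rho>) powr (-1/2) * exp (- \<nu> * (d x p / \<rho>) powr s)) \<and>
     (\<forall>x x'. d x x' \<le> \<rho> \<longrightarrow>
        \<bar>w x - w x'\<bar> \<le> C * measure M (qball d p \<rho>) powr (-1/2) * (d x x' / \<rho>) powr \<eta>
          * exp (- \<nu> * (d x p / \<rho>) powr s))"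

locale wavelet_system = dyadic_system M d A0 c0 C0 \<delta> A pt Q
  for M :: "'a measure" and d :: "'a \<Rightarrow> 'a \<Rightarrow> real" and A0 c0 C0 \<delta> :: real
    and A :: "int \<Rightarrow> 'i set" and pt :: "int \<Rightarrow> 'i \<Rightarrow> 'a" and Q :: "int \<Rightarrow> 'i \<Rightarrow> 'a set" +
  fixes \<phi> \<psi> :: "int \<Rightarrow> 'i \<Rightarrow> 'a \<Rightarrow> real" and s \<eta> \<nu> C :: real
  assumes s_pos: "0 < s" and s_le_1: "s \<le> 1"
    and \<eta>_pos: "0 < \<eta>" and \<eta>_less_1: "\<eta> < 1"
    and \<nu>_pos: "0 < \<nu>" and C_pos: "0 < C"
    and \<phi>_bounds: "\<alpha> \<in> A k \<Longrightarrow> wavelet_bounds M d s \<eta> \<nu> C (pt k \<alpha>) (\<delta> powi k) (\<phi> k \<alpha>)"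
    and \<psi>_bounds: "\<beta> \<in> new_index A pt k \<Longrightarrow>
          wavelet_bounds M d s \<eta> \<nu> C (pt (k + 1) \<beta>) (\<delta> powi k) (\<psi> (k + 1) \<beta>)"
    and \<psi>_cancellation: "\<beta> \<in> new_index A pt k \<Longrightarrow> has_bochner_integral M (\<psi> (k + 1) \<beta>) 0"
    and orthonormal_basis: "orthonormal_basis_L2 M (wavelet \<phi> \<psi>) (wavelet_index A pt k0)"

definition pairing :: "'a measure \<Rightarrow> ('a \<Rightarrow> complex) \<Rightarrow> ('a \<Rightarrow> real) \<Rightarrow> complex" where
  "pairing M f g = (LINT x|M. f x * complex_of_real (g x))"

definition pairing_converges :: "'a measure \<Rightarrow> ('a \<Rightarrow> complex) \<Rightarrow> ('a \<Rightarrow> real) \<Rightarrow> bool" where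
  "pairing_converges M f g \<longleftrightarrow> integrable M (\<lambda>x. f x * complex_of_real (g x))"

definition ennreal_sqrt :: "ennreal \<Rightarrow> ennreal" where
  "ennreal_sqrt x = (if x = \<infinity> then \<infinity> else ennreal (sqrt (enn2real x)))"

definition star_norm ::
    "'a measure \<Rightarrow> (int \<Rightarrow> 'i set) \<Rightarrow> (int \<Rightarrow> 'i \<Rightarrow> 'a) \<Rightarrow> (int \<Rightarrow> 'i \<Rightarrow> 'a set)
      \<Rightarrow> (int \<Rightarrow> 'i \<Rightarrow> 'a \<Rightarrow> real) \<Rightarrow> (int \<Rightarrow> 'i \<Rightarrow> 'a \<Rightarrow> real) \<Rightarrow> real \<Rightarrow> ('a \<Rightarrow> complex) \<Rightarrow> ennreal" where
  "star_norm M A pt Q \<phi> \<psi> \<theta> f =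
     (SUP P\<in>cubes0 A Q. ennreal_sqrt (
        ((\<Sum>\<^sub>\<infinity>\<alpha>\<in>{\<alpha>\<in>A 0. Q 0 \<alpha> \<subseteq> P}. ennreal ((cmod (pairing M f (\<phi> 0 \<alpha>)))\<^sup>2)) +
         (\<Sum>k::nat. \<Sum>\<^sub>\<infinity>\<beta>\<in>{\<beta>\<in>new_index A pt (int k). Q (int k + 1) \<beta> \<subseteq> P}.
            ennreal ((cmod (pairing M f (\<psi> (int k + 1) \<beta>)))\<^sup>2)))
        / ennreal (measure M P powr (1 + 2 * \<theta>))))"

text \<open>The expansion of \<open>f\<close>, including absolute convergence of all coefficient integrals.\<close>
definition wavelet_expansion ::
    "'a measure \<Rightarrow> ('a \<Rightarrow> 'a \<Rightarrow> real) \<Rightarrow> (int \<Rightarrow> 'i set) \<Rightarrow> (int \<Rightarrow> 'i \<Rightarrow> 'a)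
      \<Rightarrow> (int \<Rightarrow> 'i \<Rightarrow> 'a \<Rightarrow> real) \<Rightarrow> (int \<Rightarrow> 'i \<Rightarrow> 'a \<Rightarrow> real) \<Rightarrow> ('a \<Rightarrow> complex) \<Rightarrow> bool" where
  "wavelet_expansion M d A pt \<phi> \<psi> f \<longleftrightarrow>
     (\<forall>j\<in>wavelet_index A pt 0. pairing_converges M f (wavelet \<phi> \<psi> j)) \<and>
     has_sum_L2B M d
       (\<lambda>j x. pairing M f (wavelet \<phi> \<psi> j) * complex_of_real (wavelet \<phi> \<psi> j x))
       (wavelet_index A pt 0) f"

end

theory Submission
  imports Defs
begin

text \<open>
  A Lipschitz function has wavelet coefficients of size \<open>N \<cdot> V\<^sup>1\<^sup>/\<^sup>2\<^sup>+\<^sup>\<theta>\<close>, where \<open>V\<close> is the volume of the ball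
  at the scale of the wavelet, and conversely such a size bound is all that is needed to sum the
  expansion to a Lipschitz function; a finite \<open>\<parallel>f\<parallel>\<^sub>*\<close> gives it by testing on a single cube.
  Volumes need not decay geometrically along the levels, so sums over levels of powers of volumes
  are controlled by a smoothed volume \<open>\<integral> (1 + d(x,y)/R)\<^sup>-\<^sup>m d\<mu>(y)\<close>: a new point near \<open>x\<close> makes it drop by
  a definite proportion from one scale to the next, and the drops telescope. The expansion
  converges because the part of \<open>f\<close> far from a ball has a uniformly small expansion on that ball,
  while the rest is in \<open>L\<^sup>2\<close>.
\<close>

section \<open>Volumes of balls\<close>

text \<open>Doubling bounds volumes from one side only: the volume of the ball of radius \<delta>^k
  about x may stall over arbitrarily many levels k, so its powers have no uniform sum over k. The
  way out is that near x such stalled levels carry no new points, hence no wavelets: a new point and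
  the old point next to it cannot both be close to x, so one of them brings mass at distance
  comparable to \<delta>^k. A sharp ball may or may not lose this mass when the radius shrinks; a
  smooth weight always decreases there by a fixed factor, which is why the volume is smoothed. All
  decay is measured by powers of \<open>rdist\<close>. Since \<open>rdist\<close> is
  submultiplicative up to a constant, moving a weight or a volume to another base point costs a
  fixed power, and wavelets, decaying faster than every power, can pay it. This is the reason for
  the many statements of the form "there are K and n". A Lipschitz function grows at most
  polynomially but need not be square integrable, so the basis property reaches it only after
  truncation.\<close>

lemma powr_le_power: "1 \<le> (t::real) \<Longrightarrow> a \<le> real n \<Longrightarrow> t powr a \<le> t ^ n"
  using powr_mono[of a "real n" t] by (simp add: powr_realpow)

lemma qball_iff: "y \<in> qball d x r \<longleftrightarrow> d x y < r"
  by (simp add: qball_def)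

context homogeneous_type
begin

definition vol :: "'a \<Rightarrow> real \<Rightarrow> real" where
  "vol x r = measure M (qball d x r)"

definition dconst :: real where
  "dconst = doubling_const M d"

text \<open>The summand 1 makes the quasi-triangle inequality multiplicative
  (\<open>rdist_triangle\<close>), so near and far points are treated alike.\<close>

definition rdist :: "real \<Rightarrow> 'a \<Rightarrow> 'a \<Rightarrow> real" where
  "rdist R x y = 1 + d x y / R"

text \<open>Rounded up so that weights can be natural powers. Estimates that compete with \<eta>
  keep the exact dimension.\<close>

definition hdim :: nat where
  "hdim = nat \<lceil>upper_dim M d\<rceil>"

lemma qball_meas [measurable]: "qball d x r \<in> sets M"
proof (cases "0 < r")
  case True
  then show ?thesis by (intro open_measurable qball_open)
next
  case False
  then have "qball d x r = {}"
    using d_nonneg[of x] by (auto simp: qball_def not_less intro: order_trans)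
  then show ?thesis by simp
qed

lemma qball_nonpos: "r \<le> 0 \<Longrightarrow> qball d x r = {}"
  using d_nonneg[of x] by (auto simp: qball_def not_less intro: order_trans)

lemma qball_mono: "r \<le> t \<Longrightarrow> qball d x r \<subseteq> qball d x t"
  by (auto simp: qball_def)

lemma d_refl [simp]: "d x x = 0"
  by (simp add: d_eq_0_iff)

lemma emeasure_qball: "emeasure M (qball d x r) = ennreal (vol x r)"
proof (cases "0 < r")
  case True
  then show ?thesis
    unfolding vol_def using qball_measure_finite[of r x]
    by (intro emeasure_eq_ennreal_measure) auto
next
  case False
  then show ?thesis by (simp add: qball_nonpos vol_def)
qed

lemma vol_pos: "0 < r \<Longrightarrow> 0 < vol x r"
  using qball_measure_pos[of r x] by (simp add: emeasure_qball)

lemma vol_nonneg [simp]: "0 \<le> vol x r"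
  by (simp add: vol_def)

lemma fmeasurable_qball: "qball d x r \<in> fmeasurable M"
  by (intro fmeasurableI) (auto simp: emeasure_qball)

lemma fmeasurable_subset_qball: "S \<in> sets M \<Longrightarrow> S \<subseteq> qball d p r \<Longrightarrow> S \<in> fmeasurable M"
  by (rule fmeasurableI2[OF fmeasurable_qball])

lemma measure_le_vol: "S \<in> sets M \<Longrightarrow> S \<subseteq> qball d y s \<Longrightarrow> measure M S \<le> vol y s"
  unfolding vol_def by (intro measure_mono_fmeasurable fmeasurable_qball)

lemma vol_le_measure: "qball d y s \<subseteq> S \<Longrightarrow> S \<in> fmeasurable M \<Longrightarrow> vol y s \<le> measure M S"
  unfolding vol_def by (intro measure_mono_fmeasurable qball_meas)

lemma vol_subset: "qball d x r \<subseteq> qball d y s \<Longrightarrow> vol x r \<le> vol y s"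
  unfolding vol_def[of x] by (intro measure_le_vol qball_meas)

lemma vol_mono: "r \<le> s \<Longrightarrow> vol x r \<le> vol x s"
  by (intro vol_subset qball_mono)

text \<open>A real \<open>Sup\<close> is informative only for a set that is bounded above. The
  constant in \<open>doubling\<close> may be negative, where \<open>ennreal\<close> returns 0; hence
  the bound \<open>max C 0\<close>.\<close>

lemma bdd_above_doubling:
  "bdd_above {measure M (qball d x (2 * r)) / measure M (qball d x r) | x r. 0 < r}"
proof -
  obtain C where C: "\<And>x r. 0 < r \<Longrightarrow>
      emeasure M (qball d x (2 * r)) \<le> ennreal C * emeasure M (qball d x r)"
    using doubling by blast
  have "vol x (2 * r) / vol x r \<le> max C 0" if "0 < r" for x r
  proof -
    have "ennreal (vol x (2 * r)) \<le> ennreal (max C 0) * ennreal (vol x r)"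
      using C[OF that, of x] mult_right_mono[of "ennreal C" "ennreal (max C 0)" "ennreal (vol x r)"]
      by (auto simp: emeasure_qball intro: order_trans ennreal_leI)
    also have "\<dots> = ennreal (max C 0 * vol x r)"
      by (simp add: ennreal_mult)
    finally have "vol x (2 * r) \<le> max C 0 * vol x r"
      by (subst (asm) ennreal_le_iff) auto
    then show ?thesis using vol_pos[OF that, of x] by (simp add: divide_simps)
  qed
  then show ?thesis
    by (auto simp: vol_def intro!: bdd_aboveI[of _ "max C 0"])
qed

lemma vol_double: "0 < r \<Longrightarrow> vol x (2 * r) \<le> dconst * vol x r"
proof -
  assume r: "0 < r"
  have "vol x (2 * r) / vol x r \<le> dconst"
    unfolding dconst_def doubling_const_def vol_def
    by (rule cSup_upper[OF _ bdd_above_doubling]) (use r in auto)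
  then show ?thesis using vol_pos[OF r, of x] by (simp add: divide_simps)
qed

lemma dconst_ge_1: "1 \<le> dconst"
proof -
  have "vol undefined 1 \<le> vol undefined (2 * 1)" by (intro vol_mono) auto
  also have "\<dots> \<le> dconst * vol undefined 1" by (intro vol_double) auto
  finally show ?thesis using vol_pos[of 1 undefined] by simp
qed

lemma two_powr_upper_dim: "2 powr upper_dim M d = dconst"
  using dconst_ge_1 by (simp add: upper_dim_def dconst_def)

lemma upper_dim_nonneg: "0 \<le> upper_dim M d"
  using dconst_ge_1 by (simp add: upper_dim_def dconst_def)

lemma upper_dim_le_hdim: "upper_dim M d \<le> real hdim"
  unfolding hdim_def by linarith

lemma dconst_le: "dconst \<le> 2 ^ hdim"
proof -
  have "dconst \<le> 2 powr real hdim"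
    unfolding two_powr_upper_dim[symmetric]
    using upper_dim_le_hdim by (intro powr_mono) auto
  then show ?thesis by (simp add: powr_realpow)
qed

lemma vol_two_power: "0 < r \<Longrightarrow> vol x (2 ^ n * r) \<le> dconst ^ n * vol x r"
proof (induction n)
  case (Suc n)
  have "vol x (2 * (2 ^ n * r)) \<le> dconst * vol x (2 ^ n * r)"
    using Suc.prems by (intro vol_double) auto
  also have "\<dots> \<le> dconst * (dconst ^ n * vol x r)"
    using Suc dconst_ge_1 by (intro mult_left_mono) auto
  finally show ?case by (simp add: mult_ac)
qed simp

text \<open>Rounding \<open>log 2 t\<close> up to a whole number of doublings costs at most one
  doubling too many; this is the factor \<open>dconst\<close>.\<close>

lemma vol_scale:
  assumes "1 \<le> t" "0 < r"
  shows "vol x (t * r) \<le> dconst * t powr upper_dim M d * vol x r"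
proof -
  define n where "n = nat \<lceil>log 2 t\<rceil>"
  have l0: "0 \<le> log 2 t" using assms by simp
  have n1: "log 2 t \<le> real n" and n2: "real n \<le> log 2 t + 1"
    unfolding n_def using l0 by linarith+
  have "t = 2 powr log 2 t" using assms by simp
  also have "\<dots> \<le> 2 powr real n" using n1 by (intro powr_mono) auto
  finally have t1: "t \<le> 2 ^ n" by (simp add: powr_realpow)
  have "2 powr real n \<le> 2 powr (log 2 t + 1)" using n2 by (intro powr_mono) auto
  also have "\<dots> = 2 * t" using assms by (simp add: powr_add)
  finally have t2: "2 powr real n \<le> 2 * t" .
  have "vol x (t * r) \<le> vol x (2 ^ n * r)"
    using t1 assms by (intro vol_mono mult_right_mono) auto
  also have "\<dots> \<le> dconst ^ n * vol x r" using assms by (intro vol_two_power) auto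
  also have "dconst ^ n = (2 powr real n) powr upper_dim M d"
    using dconst_ge_1 by (simp add: two_powr_upper_dim[symmetric] powr_power powr_powr mult.commute)
  also have "\<dots> \<le> (2 * t) powr upper_dim M d"
    using t2 upper_dim_nonneg by (intro powr_mono2) auto
  also have "\<dots> = dconst * t powr upper_dim M d"
    using assms by (simp add: powr_mult two_powr_upper_dim)
  finally show ?thesis by (simp add: mult_right_mono)
qed

lemma vol_compare_scale:
  assumes "0 < a" "0 < r" "A0 * (d x y + R) \<le> a * r" "1 \<le> a"
  shows "vol y R \<le> dconst * a powr upper_dim M d * vol x r"
proof -
  have "qball d y R \<subseteq> qball d x (a * r)"
  proof
    fix z assume "z \<in> qball d y R"
    then have z: "d y z < R" by (simp add: qball_iff)
    have "d x z \<le> A0 * (d x y + d y z)" by (rule quasi_triangle)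
    also have "\<dots> < A0 * (d x y + R)" using z A0_ge_1 by (intro mult_strict_left_mono) auto
    finally show "z \<in> qball d x (a * r)" using assms by (simp add: qball_iff)
  qed
  then have "vol y R \<le> vol x (a * r)" by (rule vol_subset)
  also have "\<dots> \<le> dconst * a powr upper_dim M d * vol x r" using assms by (intro vol_scale) auto
  finally show ?thesis .
qed

lemma vol_dilate: 
  assumes "0 < a"
  shows "\<exists>K\<ge>1. \<forall>x. \<forall>r>0. vol x (a * r) \<le> K * vol x r"
proof -
  define K where "K = dconst * (max 1 a) powr upper_dim M d"
  have p: "1 \<le> (max 1 a) powr upper_dim M d"
    using upper_dim_nonneg by (intro ge_one_powr_ge_zero) auto
  have "1 * 1 \<le> K"
    unfolding K_def using dconst_ge_1 p by (intro mult_mono) auto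
  moreover have "vol x (a * r) \<le> K * vol x r" if "0 < r" for x r
  proof -
    have "vol x (a * r) \<le> vol x (max 1 a * r)"
      using that by (intro vol_mono mult_right_mono) auto
    also have "\<dots> \<le> K * vol x r" unfolding K_def using that by (intro vol_scale) auto
    finally show ?thesis .
  qed
  ultimately show ?thesis by auto
qed

lemma rdist_ge_1: "0 < R \<Longrightarrow> 1 \<le> rdist R x y"
  by (simp add: rdist_def d_nonneg)

lemma rdist_pos: "0 < R \<Longrightarrow> 0 < rdist R x y"
  using rdist_ge_1[of R x y] by linarith

lemma rdist_sym: "rdist R x y = rdist R y x"
  by (simp add: rdist_def d_sym)

lemma rdist_triangle:
  assumes "0 < R"
  shows "rdist R x z \<le> A0 * rdist R x y * rdist R y z"
proof -
  have "d x z / R \<le> A0 * (d x y / R + d y z / R)"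
    using divide_right_mono[OF quasi_triangle[of x z y], of R] assms
    by (simp add: add_divide_distrib distrib_left)
  moreover have "0 \<le> A0 * (d x y / R * (d y z / R))"
    using assms A0_ge_1 d_nonneg by (intro mult_nonneg_nonneg divide_nonneg_pos) auto
  moreover have "A0 * rdist R x y * rdist R y z =
      A0 + A0 * (d x y / R + d y z / R) + A0 * (d x y / R * (d y z / R))"
    unfolding rdist_def by algebra
  ultimately show ?thesis
    using A0_ge_1 unfolding rdist_def[of R x z] by linarith
qed

lemma rdist_le_of_less: "0 < R \<Longrightarrow> d x y < a * R \<Longrightarrow> rdist R x y \<le> 1 + a"
  by (simp add: rdist_def pos_divide_le_eq)

lemma vol_rdist:
  "\<exists>K\<ge>1. \<forall>x y. \<forall>R>0. vol y R \<le> K * rdist R x y ^ hdim * vol x R"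
proof (intro exI[of _ "dconst * A0 ^ hdim"] conjI allI impI)
  show "1 \<le> dconst * A0 ^ hdim"
    using mult_mono[of 1 dconst 1 "A0 ^ hdim"] dconst_ge_1 A0_ge_1 by auto
  fix x y and R :: real assume R: "0 < R"
  have a: "1 \<le> A0 * rdist R x y"
    using mult_mono[OF A0_ge_1 rdist_ge_1[OF R, of x y]] A0_ge_1 by simp
  have "vol y R \<le> dconst * (A0 * rdist R x y) powr upper_dim M d * vol x R"
    using R a by (intro vol_compare_scale) (auto simp: rdist_def field_simps)
  also have "\<dots> \<le> dconst * (A0 * rdist R x y) ^ hdim * vol x R"
    using dconst_ge_1 a upper_dim_le_hdim
    by (intro mult_right_mono mult_left_mono powr_le_power) auto
  finally show "vol y R \<le> dconst * A0 ^ hdim * rdist R x y ^ hdim * vol x R"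
    by (simp add: power_mult_distrib mult_ac)
qed

text \<open>\<open>vol_rdist\<close> may be read with the two points exchanged, so negative
  exponents are covered as well; the kernel estimate uses the exponent -1.\<close>

lemma vol_rdist_powr:
  "\<exists>K\<ge>1. \<exists>n. \<forall>x y. \<forall>R>0. vol y R powr \<tau> \<le> K * rdist R x y ^ n * vol x R powr \<tau>"
proof -
  obtain K where K: "1 \<le> K" "\<And>x y R. 0 < R \<Longrightarrow> vol y R \<le> K * rdist R x y ^ hdim * vol x R"
    using vol_rdist by blast
  define n where "n = nat \<lceil>real hdim * \<bar>\<tau>\<bar>\<rceil>"
  have n: "real hdim * \<bar>\<tau>\<bar> \<le> real n" unfolding n_def by linarith
  have "vol y R powr \<tau> \<le> K powr \<bar>\<tau>\<bar> * rdist R x y ^ n * vol x R powr \<tau>"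
    if R: "0 < R" for x y R
  proof -
    let ?r = "rdist R x y"
    have r: "1 \<le> ?r" using rdist_ge_1[OF R] .
    have pos: "0 < vol x R" "0 < vol y R" using vol_pos[OF R] by auto
    have b: "(?r ^ hdim) powr \<bar>\<tau>\<bar> \<le> ?r ^ n"
    proof -
      have "(?r ^ hdim) powr \<bar>\<tau>\<bar> = ?r powr (real hdim * \<bar>\<tau>\<bar>)"
        using r by (subst powr_realpow[symmetric]) (auto simp: powr_powr)
      also have "\<dots> \<le> ?r ^ n" using r n by (intro powr_le_power) auto
      finally show ?thesis .
    qed
    have "vol y R powr \<tau> \<le> (K * ?r ^ hdim) powr \<bar>\<tau>\<bar> * vol x R powr \<tau>"
    proof (cases "0 \<le> \<tau>")
      case True
      have "vol y R powr \<tau> \<le> (K * ?r ^ hdim * vol x R) powr \<tau>"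
        using K(2)[OF R, of y x] True by (intro powr_mono2) auto
      then show ?thesis using True K(1) r by (simp add: powr_mult)
    next
      case False
      have "vol x R / (K * ?r ^ hdim) \<le> vol y R"
        using K(2)[OF R, of x y] K(1) r by (simp add: divide_simps rdist_sym[of _ y] mult_ac)
      then have "vol y R powr \<tau> \<le> (vol x R / (K * ?r ^ hdim)) powr \<tau>"
        using False pos K(1) r by (intro powr_mono2') auto
      also have "\<dots> = vol x R powr \<tau> * (K * ?r ^ hdim) powr - \<tau>"
        using pos K(1) r by (simp add: powr_divide powr_minus_divide)
      finally show ?thesis using False by (simp add: mult.commute)
    qed
    also have "\<dots> = K powr \<bar>\<tau>\<bar> * (?r ^ hdim) powr \<bar>\<tau>\<bar> * vol x R powr \<tau>"
      using K(1) r by (simp add: powr_mult)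
    also have "\<dots> \<le> K powr \<bar>\<tau>\<bar> * ?r ^ n * vol x R powr \<tau>"
      using b by (intro mult_right_mono mult_left_mono) auto
    finally show ?thesis .
  qed
  moreover have "1 \<le> K powr \<bar>\<tau>\<bar>" using K(1) by (intro ge_one_powr_ge_zero) auto
  ultimately show ?thesis by blast
qed

section \<open>The smoothed volume\<close>

lemma d_measurable [measurable]: "d x \<in> borel_measurable M"
proof (subst borel_measurable_iff_less, intro allI)
  fix a
  have "{w \<in> space M. d x w < a} = qball d x a" by (auto simp: space_M qball_def)
  then show "{w \<in> space M. d x w < a} \<in> sets M" by simp
qed

lemma rdist_measurable [measurable]: "rdist R x \<in> borel_measurable M"
  unfolding rdist_def by measurable

definition smooth_vol :: "nat \<Rightarrow> 'a \<Rightarrow> real \<Rightarrow> real" where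
  "smooth_vol m x R = (LINT y|M. 1 / rdist R x y ^ m)"

text \<open>For the least i whose ball of radius \<open>2 ^ i * R\<close> contains y, minimality
  gives \<open>2 ^ i \<le> 2 * rdist R x y\<close>; that single summand already dominates the
  left-hand side.\<close>

lemma rdist_power_le_indicators:
  assumes "0 < R"
  shows "ennreal (1 / rdist R x y ^ m) \<le>
    (\<Sum>i. ennreal (2 ^ m * (1 / 2 ^ m) ^ i) * indicator (qball d x (2 ^ i * R)) y)"
proof -
  let ?t = "d x y / R"
  have t0: "0 \<le> ?t" using assms d_nonneg by simp
  obtain i0 where "?t < 2 ^ i0" using real_arch_pow[of 2 ?t] by auto
  then have ex: "\<exists>i. ?t < 2 ^ i" by blast
  define i where "i = (LEAST i. ?t < 2 ^ i)"
  have i1: "?t < 2 ^ i" unfolding i_def using ex by (rule LeastI_ex)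
  have i2: "2 ^ i \<le> 2 * rdist R x y"
  proof (cases i)
    case 0
    then show ?thesis using rdist_ge_1[OF assms, of x y] by simp
  next
    case (Suc j)
    then have "\<not> ?t < 2 ^ j" unfolding i_def using not_less_Least[of j] by (metis i_def lessI not_less_Least)
    then show ?thesis using Suc by (simp add: rdist_def)
  qed
  have "1 / rdist R x y ^ m \<le> 2 ^ m * (1 / 2 ^ m) ^ i"
  proof -
    have "(2 ^ i) ^ m \<le> (2 * rdist R x y) ^ m" using i2 by (intro power_mono) auto
    then have "(2 ^ m) ^ i \<le> 2 ^ m * rdist R x y ^ m"
      by (simp add: power_mult_distrib power_mult[symmetric] mult.commute)
    then show ?thesis using rdist_pos[OF assms, of x y] by (simp add: power_divide divide_simps mult.commute)
  qed
  then have "ennreal (1 / rdist R x y ^ m) \<le>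
      ennreal (2 ^ m * (1 / 2 ^ m) ^ i) * indicator (qball d x (2 ^ i * R)) y"
    using i1 assms by (simp add: indicator_def qball_iff divide_simps ennreal_leI)
  also have "\<dots> \<le> (\<Sum>i. ennreal (2 ^ m * (1 / 2 ^ m) ^ i) * indicator (qball d x (2 ^ i * R)) y)"
    (is "?h i \<le> _")
    using sum_le_suminf[OF summableI, of "{i}" ?h] by (simp only: sum.insert sum.empty finite.intros add_0_right empty_iff not_False_eq_True zero_le simp_thms)
  finally show ?thesis .
qed

text \<open>Doubling the radius multiplies the volume by at most
  \<open>dconst \<le> 2 ^ hdim\<close> and the weight by \<open>1 / 2 ^ m\<close>. Since
  \<open>hdim < m\<close>, the series over the dyadic balls has ratio at most 1/2.\<close>

lemma nn_integral_rdist: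
  assumes "0 < R" "hdim < m"
  shows "(\<integral>\<^sup>+y. ennreal (1 / rdist R x y ^ m) \<partial>M) \<le> ennreal (2 ^ Suc m * vol x R)"
proof -
  have q: "dconst / 2 ^ m \<le> 1 / 2"
  proof -
    have "2 * dconst \<le> 2 ^ Suc hdim" using dconst_le by simp
    also have "\<dots> \<le> 2 ^ m" using assms by (intro power_increasing) auto
    finally show ?thesis by (simp add: divide_simps)
  qed
  have "(\<integral>\<^sup>+y. ennreal (1 / rdist R x y ^ m) \<partial>M) \<le>
      (\<integral>\<^sup>+y. (\<Sum>i. ennreal (2 ^ m * (1 / 2 ^ m) ^ i) * indicator (qball d x (2 ^ i * R)) y) \<partial>M)"
    using rdist_power_le_indicators[OF assms(1)] by (intro nn_integral_mono) auto
  also have "\<dots> = (\<Sum>i. \<integral>\<^sup>+y. ennreal (2 ^ m * (1 / 2 ^ m) ^ i) * indicator (qball d x (2 ^ i * R)) y \<partial>M)"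
    by (intro nn_integral_suminf) measurable
  also have "\<dots> = (\<Sum>i. ennreal (2 ^ m * (1 / 2 ^ m) ^ i * vol x (2 ^ i * R)))"
    by (simp add: nn_integral_cmult_indicator emeasure_qball ennreal_mult)
  also have "\<dots> \<le> (\<Sum>i. ennreal (2 ^ m * vol x R * (1 / 2) ^ i))"
  proof (intro suminf_le ennreal_leI)
    fix i
    have "2 ^ m * (1 / 2 ^ m) ^ i * vol x (2 ^ i * R) \<le> 2 ^ m * (1 / 2 ^ m) ^ i * (dconst ^ i * vol x R)"
      using assms by (intro mult_left_mono vol_two_power) auto
    also have "\<dots> = 2 ^ m * vol x R * (dconst / 2 ^ m) ^ i"
      by (simp add: power_divide)
    also have "\<dots> \<le> 2 ^ m * vol x R * (1 / 2) ^ i"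
      using q dconst_ge_1 by (intro mult_left_mono power_mono) auto
    finally show "2 ^ m * (1 / 2 ^ m) ^ i * vol x (2 ^ i * R) \<le> 2 ^ m * vol x R * (1 / 2) ^ i" .
  qed auto
  also have "\<dots> = ennreal (\<Sum>i. 2 ^ m * vol x R * (1 / 2) ^ i)"
    by (intro suminf_ennreal2 summable_mult summable_geometric) auto
  also have "(\<Sum>i. 2 ^ m * vol x R * (1 / 2) ^ i) = 2 ^ Suc m * vol x R"
    by (subst suminf_mult) (auto simp: suminf_geometric summable_geometric)
  finally show ?thesis .
qed

lemma integrable_rdist:
  assumes "0 < R" "hdim < m"
  shows "integrable M (\<lambda>y. 1 / rdist R x y ^ m)"
proof (rule integrableI_nonneg)
  show "(\<integral>\<^sup>+y. ennreal (1 / rdist R x y ^ m) \<partial>M) < \<infinity>"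
    using nn_integral_rdist[OF assms, of x] by (auto intro: le_less_trans)
  show "AE y in M. 0 \<le> 1 / rdist R x y ^ m"
    using rdist_pos[OF assms(1)] by (auto simp: less_imp_le)
qed measurable

text \<open>With \<open>smooth_vol_ge\<close>: smoothing changes volumes by bounded factors only, so
  one may pass to smoothed volumes to telescope and back afterwards.\<close>

lemma smooth_vol_le:
  assumes "0 < R" "hdim < m"
  shows "smooth_vol m x R \<le> 2 ^ Suc m * vol x R"
proof -
  have "ennreal (smooth_vol m x R) = (\<integral>\<^sup>+y. ennreal (1 / rdist R x y ^ m) \<partial>M)"
    unfolding smooth_vol_def using rdist_pos[OF assms(1)]
    by (intro nn_integral_eq_integral[symmetric] integrable_rdist assms) (auto simp: less_imp_le)
  also have "\<dots> \<le> ennreal (2 ^ Suc m * vol x R)" by (rule nn_integral_rdist[OF assms])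
  finally show ?thesis by (subst (asm) ennreal_le_iff) auto
qed

lemma smooth_vol_ge:
  assumes "0 < R" "hdim < m"
  shows "vol x R \<le> 2 ^ m * smooth_vol m x R"
proof -
  have "vol x R / 2 ^ m = (LINT y|M. indicator (qball d x R) y * (1 / 2 ^ m))"
    by (simp add: vol_def space_M)
  also have "\<dots> \<le> smooth_vol m x R"
    unfolding smooth_vol_def
  proof (rule integral_mono)
    show "integrable M (\<lambda>y. indicator (qball d x R) y * (1 / 2 ^ m) :: real)"
      using fmeasurable_qball[of x R] by (auto simp: fmeasurable_def)
    fix y
    have "(1::real) / 2 ^ m \<le> 1 / rdist R x y ^ m" if "d x y < R"
    proof (intro divide_left_mono power_mono)
      show "rdist R x y \<le> 2" using that assms by (simp add: rdist_def)
    qed (use rdist_pos[OF assms(1), of x y] in auto)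
    then show "indicator (qball d x R) y * (1 / 2 ^ m) \<le> 1 / rdist R x y ^ m"
      using rdist_pos[OF assms(1), of x y] by (auto simp: indicator_def qball_iff)
  qed (rule integrable_rdist[OF assms])
  finally show ?thesis by (simp add: divide_simps mult.commute)
qed

lemma smooth_vol_pos: "0 < R \<Longrightarrow> hdim < m \<Longrightarrow> 0 < smooth_vol m x R"
  using smooth_vol_ge[of R m x] vol_pos[of R x] by (smt (verit) zero_less_mult_iff zero_less_power)

end

text \<open>Turns a proportional drop of a quantity into one of its \<tau>-th power. For \<tau> < 1
  it is concavity, taken from Young's inequality with weights \<tau> and 1 - \<tau>; for \<tau>
  \<ge> 1 the power is at most the first power.\<close>

lemma one_minus_powr_le:
  fixes u \<tau> :: real
  assumes "0 \<le> u" "u \<le> 1" "0 < \<tau>"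
  shows "(1 - u) powr \<tau> \<le> 1 - min 1 \<tau> * u"
proof (cases "1 \<le> \<tau> \<or> u = 1")
  case True
  then have "(1 - u) powr \<tau> \<le> (1 - u) powr 1"
    using assms powr_mono'[of 1 \<tau> "1 - u"] by auto
  moreover have "min 1 \<tau> * u \<le> 1 * u" using assms by (intro mult_right_mono) auto
  ultimately show ?thesis using assms by (simp add: powr_one)
next
  case False
  have "(1 - u) powr \<tau> * 1 powr (1 - \<tau>) \<le> \<tau> * (1 - u) + (1 - \<tau>) * 1"
    using assms False by (intro Youngs_inequality_0) auto
  then show ?thesis using False by (simp add: algebra_simps)
qed

section \<open>Packing of disjoint balls and the drop of the smoothed volume\<close>

context homogeneous_type
begin

lemma integrable_indicator_rdist:
  assumes "0 < R" "hdim < m"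
  shows "integrable M (\<lambda>y. indicator (qball d p r) y * (1 / rdist R x y ^ m))"
    and "integrable M (\<lambda>y. indicator (qball d p r) y / rdist R x y ^ m)"
  using integrable_real_mult_indicator[OF qball_meas integrable_rdist[OF assms]]
  by (simp_all add: mult.commute)

text \<open>A ball at scale R holds a share of the smoothed volume at x that is only polynomially
  small in the distance of its centre. In the exponent, \<open>hdim\<close> pays for comparing the
  volumes at x and p, and m for comparing the weights at y and p.\<close>

lemma integral_ball_rdist_ge:
  assumes "0 < a" "hdim < m"
  shows "\<exists>K\<ge>1. \<forall>x p. \<forall>R>0. vol x R / rdist R x p ^ (hdim + m)
    \<le> K * (LINT y|M. indicator (qball d p (a * R)) y * (1 / rdist R x y ^ m))"
proof -
  obtain Kv where Kv: "1 \<le> Kv" "\<And>x y R. 0 < R \<Longrightarrow> vol y R \<le> Kv * rdist R x y ^ hdim * vol x R"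
    using vol_rdist by blast
  obtain Ka where Ka: "1 \<le> Ka" "\<And>x r. 0 < r \<Longrightarrow> vol x (1 / a * r) \<le> Ka * vol x r"
    using vol_dilate[of "1 / a"] assms by auto
  define b where "b = (A0 * (1 + a)) ^ m"
  have b1: "1 \<le> A0 * (1 + a)" using mult_mono[of 1 A0 1 "1 + a"] A0_ge_1 assms by auto
  then have b: "1 \<le> b" unfolding b_def by (rule one_le_power)
  define K where "K = Kv * Ka * b"
  have KvKa: "1 \<le> Kv * Ka" using mult_mono[of 1 Kv 1 Ka] Kv Ka by auto
  then have "1 \<le> K" unfolding K_def using mult_mono[of 1 "Kv * Ka" 1 b] b by auto
  moreover have "vol x R / rdist R x p ^ (hdim + m)
    \<le> K * (LINT y|M. indicator (qball d p (a * R)) y * (1 / rdist R x y ^ m))" if R: "0 < R" for x p R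
  proof -
    let ?B = "qball d p (a * R)" and ?e = "rdist R x p"
    have e: "1 \<le> ?e" using R by (rule rdist_ge_1)
    have "vol p (1 / a * (a * R)) \<le> Ka * vol p (a * R)" using R assms by (intro Ka(2)) simp
    then have "vol p R \<le> Ka * vol p (a * R)" using assms by simp
    then have "Kv * ?e ^ hdim * vol p R \<le> Kv * ?e ^ hdim * (Ka * vol p (a * R))"
      using Kv(1) e by (intro mult_left_mono) auto
    then have "vol x R \<le> Kv * ?e ^ hdim * (Ka * vol p (a * R))"
      using Kv(2)[OF R, of x p] by (simp add: rdist_sym[of _ p])
    then have "vol x R / ?e ^ (hdim + m) \<le> Kv * ?e ^ hdim * (Ka * vol p (a * R)) / ?e ^ (hdim + m)"
      using e by (intro divide_right_mono) auto
    also have "\<dots> = Kv * Ka * (vol p (a * R) / ?e ^ m)"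
      using e by (simp add: power_add)
    finally have 1: "vol x R / ?e ^ (hdim + m) \<le> Kv * Ka * (vol p (a * R) / ?e ^ m)" .
    have "vol p (a * R) / ?e ^ m = (LINT y|M. indicator ?B y * (1 / ?e ^ m))"
      by (simp add: vol_def space_M)
    also have "\<dots> \<le> (LINT y|M. b * (indicator ?B y * (1 / rdist R x y ^ m)))"
    proof (rule integral_mono)
      show "integrable M (\<lambda>y. indicator ?B y * (1 / ?e ^ m) :: real)"
        using fmeasurable_qball[of p "a * R"] by (auto simp: fmeasurable_def)
      show "integrable M (\<lambda>y. b * (indicator ?B y * (1 / rdist R x y ^ m)))"
        using integrable_indicator_rdist[OF R assms(2)] by (intro integrable_mult_right)
      fix y
      show "indicator ?B y * (1 / ?e ^ m) \<le> b * (indicator ?B y * (1 / rdist R x y ^ m))"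
      proof (cases "y \<in> ?B")
        case True
        have "rdist R x y \<le> A0 * ?e * rdist R p y" by (rule rdist_triangle[OF R])
        also have "\<dots> \<le> A0 * ?e * (1 + a)"
          using True R A0_ge_1 e by (intro mult_left_mono rdist_le_of_less) (auto simp: qball_iff)
        finally have "rdist R x y ^ m \<le> (A0 * ?e * (1 + a)) ^ m"
          using rdist_pos[OF R, of x y] by (intro power_mono) auto
        also have "\<dots> = b * ?e ^ m" by (simp add: b_def power_mult_distrib mult_ac)
        finally show ?thesis
          using True e rdist_pos[OF R, of x y] by (simp add: divide_simps mult_ac)
      qed simp
    qed
    also have "\<dots> = b * (LINT y|M. indicator ?B y * (1 / rdist R x y ^ m))"
      by (rule integral_mult_right_zero)
    finally have "Kv * Ka * (vol p (a * R) / ?e ^ m)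
        \<le> Kv * Ka * (b * (LINT y|M. indicator ?B y * (1 / rdist R x y ^ m)))"
      using KvKa by (intro mult_left_mono) auto
    with 1 show ?thesis unfolding K_def by (simp only: mult.assoc)
  qed
  ultimately show ?thesis by blast
qed

lemma rdist_power_mono: "0 < R \<Longrightarrow> n \<le> m \<Longrightarrow> c \<ge> 0 \<Longrightarrow> c / rdist R x y ^ m \<le> c / rdist R x y ^ n"
  using rdist_ge_1[of R x y] by (intro divide_left_mono power_increasing mult_pos_pos) auto

text \<open>Disjoint balls hold disjoint shares of the smoothed volume at x, whose total is at most
  a constant times \<open>vol x R\<close>. Dividing by \<open>vol x R\<close> bounds the weighted
  number of balls.\<close>

lemma packing:
  assumes "0 < a"
  shows "\<exists>K\<ge>1. \<exists>n. \<forall>x p F. \<forall>R>0. finite F \<longrightarrow> disjoint_family_on (\<lambda>\<beta>. qball d (p \<beta>) (a * R)) F \<longrightarrow>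
    (\<Sum>\<beta>\<in>F. 1 / rdist R x (p \<beta>) ^ n) \<le> K"
proof -
  define m where "m = Suc hdim"
  have m: "hdim < m" by (simp add: m_def)
  obtain K where K: "1 \<le> K" "\<And>x p R. 0 < R \<Longrightarrow> vol x R / rdist R x p ^ (hdim + m)
    \<le> K * (LINT y|M. indicator (qball d p (a * R)) y * (1 / rdist R x y ^ m))"
    using integral_ball_rdist_ge[OF assms, of m] by (auto simp: m_def)
  have "(\<Sum>\<beta>\<in>F. 1 / rdist R x (p \<beta>) ^ (hdim + m)) \<le> K * 2 ^ Suc m"
    if R: "0 < R" and F: "finite F" and disj: "disjoint_family_on (\<lambda>\<beta>. qball d (p \<beta>) (a * R)) F" for x p F R
  proof -
    let ?B = "\<lambda>\<beta>. qball d (p \<beta>) (a * R)"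
    have int: "integrable M (\<lambda>y. 1 / rdist R x y ^ m)"
      using R by (intro integrable_rdist) (auto simp: m_def)
    have "(\<Sum>\<beta>\<in>F. vol x R / rdist R x (p \<beta>) ^ (hdim + m))
        \<le> (\<Sum>\<beta>\<in>F. K * (LINT y|M. indicator (?B \<beta>) y * (1 / rdist R x y ^ m)))"
      using K(2)[OF R] by (intro sum_mono) auto
    also have "\<dots> = K * (LINT y|M. (\<Sum>\<beta>\<in>F. indicator (?B \<beta>) y * (1 / rdist R x y ^ m)))"
      by (subst Bochner_Integration.integral_sum)
        (use integrable_indicator_rdist[OF R] m in \<open>auto simp: sum_distrib_left\<close>)
    also have "(LINT y|M. (\<Sum>\<beta>\<in>F. indicator (?B \<beta>) y * (1 / rdist R x y ^ m)))
        \<le> (LINT y|M. 1 / rdist R x y ^ m)"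
    proof (rule integral_mono)
      fix y
      have "(\<Sum>\<beta>\<in>F. indicator (?B \<beta>) y * (1 / rdist R x y ^ m))
          = (indicator (\<Union>(?B ` F)) y :: real) * (1 / rdist R x y ^ m)"
        by (simp only: sum_distrib_right[symmetric] indicator_UN_disjoint[OF F disj])
      also have "\<dots> \<le> 1 * (1 / rdist R x y ^ m)"
        using rdist_pos[OF R, of x y] by (intro mult_right_mono) (auto simp: indicator_def)
      finally show "(\<Sum>\<beta>\<in>F. indicator (?B \<beta>) y * (1 / rdist R x y ^ m)) \<le> 1 / rdist R x y ^ m" by simp
    qed (intro int Bochner_Integration.integrable_sum integrable_indicator_rdist R, simp add: m_def, rule int)
    also have "\<dots> \<le> 2 ^ Suc m * vol x R"
      using smooth_vol_le[OF R, of m x] by (simp add: smooth_vol_def m_def)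
    finally have "vol x R * (\<Sum>\<beta>\<in>F. 1 / rdist R x (p \<beta>) ^ (hdim + m)) \<le> vol x R * (K * 2 ^ Suc m)"
      using K(1) by (simp add: sum_distrib_left mult_ac)
    then show ?thesis using vol_pos[OF R, of x] by simp
  qed
  moreover have "1 \<le> K * 2 ^ Suc m"
    using mult_mono[of 1 K 1 "2 ^ Suc m"] K(1) one_le_power[of "2::real" "Suc m"] by auto
  ultimately show ?thesis by blast
qed

text \<open>Shrinking R to \<open>t * R\<close> lowers the weight everywhere, and by the fixed
  factor q at points at distance at least \<open>a * R\<close>. By
  \<open>integral_ball_rdist_ge\<close> a ball of such points carries a definite share of the
  total.\<close>

lemma smooth_vol_drop:
  assumes t: "0 < t" "t < 1" and a: "0 < a" and m: "hdim < m"
  shows "\<exists>K\<ge>1. \<forall>x p. \<forall>R>0. (\<forall>y\<in>qball d p (a * R). a * R \<le> d x y) \<longrightarrow>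
    smooth_vol m x (t * R) \<le> smooth_vol m x R * (1 - 1 / (K * rdist R x p ^ (hdim + m)))"
proof -
  obtain K where K: "1 \<le> K" "\<And>x p R. 0 < R \<Longrightarrow> vol x R / rdist R x p ^ (hdim + m)
    \<le> K * (LINT y|M. indicator (qball d p (a * R)) y * (1 / rdist R x y ^ m))"
    using integral_ball_rdist_ge[OF a m] by auto
  \<comment> \<open>With u = d x y / R, the quotient (1 + u) / (1 + u / t) of the two weights' bases
    decreases in u, so its value at u = a is the worst case.\<close>
  define q where "q = (1 + a) / (1 + a / t)"
  have "a < a / t" using t a by (simp add: less_divide_eq)
  then have q: "0 < q" "q < 1" using a t by (auto simp: q_def add_pos_pos)
  define K' where "K' = K * 2 ^ Suc m / (1 - q)"
  have "1 \<le> K * 2 ^ Suc m"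
    using mult_mono[of 1 K 1 "2 ^ Suc m"] K(1) one_le_power[of "2::real" "Suc m"] by auto
  then have K'1: "1 \<le> K'" using q by (simp add: K'_def le_divide_eq)
  have "smooth_vol m x (t * R) \<le> smooth_vol m x R * (1 - 1 / (K' * rdist R x p ^ (hdim + m)))"
    if R: "0 < R" and far: "\<forall>y\<in>qball d p (a * R). a * R \<le> d x y" for x p R
  proof -
    let ?B = "qball d p (a * R)" and ?e = "rdist R x p ^ (hdim + m)"
    have e: "0 < ?e" using rdist_pos[OF R] by simp
    have tR: "0 < t * R" using t R by simp
    note int = integrable_rdist[OF R m, of x]
    have "smooth_vol m x (t * R) \<le>
        (LINT y|M. 1 / rdist R x y ^ m - (1 - q) * (indicator ?B y * (1 / rdist R x y ^ m)))"
      unfolding smooth_vol_def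
    proof (rule integral_mono)
      show "integrable M (\<lambda>y. 1 / rdist R x y ^ m - (1 - q) * (indicator ?B y * (1 / rdist R x y ^ m)))"
        by (intro Bochner_Integration.integrable_diff int integrable_mult_right integrable_indicator_rdist R m)
      fix y
      have le: "rdist R x y \<le> rdist (t * R) x y"
        using t R d_nonneg[of x y] mult_right_mono[of t 1 R]
        by (auto simp: rdist_def intro!: divide_left_mono)
      have r: "1 \<le> rdist R x y" "1 \<le> rdist (t * R) x y" using R tR rdist_ge_1 by auto
      show "1 / rdist (t * R) x y ^ m \<le>
          1 / rdist R x y ^ m - (1 - q) * (indicator ?B y * (1 / rdist R x y ^ m))"
      proof (cases "y \<in> ?B")
        case False
        then show ?thesis
          using le r by (auto intro!: divide_left_mono power_mono)
      next
        case True
        define u where "u = d x y / R"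
        have u: "a \<le> u" using far True R by (simp add: u_def le_divide_eq)
        have "0 \<le> (1 / t - 1) * (u - a)" using t u by (intro mult_nonneg_nonneg) auto
        then have "(1 + u) * (1 + a / t) \<le> (1 + a) * (1 + u / t)"
          by (simp add: algebra_simps divide_inverse)
        then have "rdist R x y \<le> q * rdist (t * R) x y"
          using a t by (simp add: q_def rdist_def u_def add_pos_pos divide_simps mult_ac)
        then have "rdist R x y ^ m \<le> (q * rdist (t * R) x y) ^ m"
          using r by (intro power_mono) auto
        also have "\<dots> \<le> q * rdist (t * R) x y ^ m"
        proof -
          \<comment> \<open>One factor q is enough; m is at least 1 because it exceeds
            \<open>hdim\<close>.\<close>
          have "q ^ m \<le> q ^ 1" using q m by (intro power_decreasing) auto
          then show ?thesis using r by (simp add: power_mult_distrib mult_right_mono)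
        qed
        finally have "1 / rdist (t * R) x y ^ m \<le> q * (1 / rdist R x y ^ m)"
          using r by (simp add: divide_simps mult_ac)
        moreover have "(1 - q) * (indicator ?B y * (1 / rdist R x y ^ m))
            = 1 / rdist R x y ^ m - q * (1 / rdist R x y ^ m)"
          using True by (simp add: left_diff_distrib diff_divide_distrib)
        ultimately show ?thesis by linarith
      qed
    qed (rule integrable_rdist[OF tR m])
    also have "\<dots> = smooth_vol m x R - (1 - q) * (LINT y|M. indicator ?B y * (1 / rdist R x y ^ m))"
      unfolding smooth_vol_def
      by (subst Bochner_Integration.integral_diff)
        (auto intro!: int integrable_mult_right integrable_indicator_rdist R m simp del: times_divide_eq_right)
    also have "\<dots> \<le> smooth_vol m x R - smooth_vol m x R / (K' * ?e)"
    proof -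
      have "smooth_vol m x R / ?e \<le> 2 ^ Suc m * vol x R / ?e"
        using smooth_vol_le[OF R m] e by (intro divide_right_mono) auto
      also have "\<dots> \<le> 2 ^ Suc m * (K * (LINT y|M. indicator ?B y * (1 / rdist R x y ^ m)))"
        using K(2)[OF R, of x p] by (simp add: mult_left_mono times_divide_eq_right[symmetric] del: times_divide_eq_right)
      finally have "smooth_vol m x R / ?e * ((1 - q) / (K * 2 ^ Suc m)) \<le>
          2 ^ Suc m * (K * (LINT y|M. indicator ?B y * (1 / rdist R x y ^ m))) * ((1 - q) / (K * 2 ^ Suc m))"
        using q K(1) by (intro mult_right_mono) auto
      then have "smooth_vol m x R / ?e * ((1 - q) / (K * 2 ^ Suc m))
          \<le> (1 - q) * (LINT y|M. indicator ?B y * (1 / rdist R x y ^ m))"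
        using K(1) by (simp add: mult.commute)
      moreover have "smooth_vol m x R / (K' * ?e) = smooth_vol m x R / ?e * ((1 - q) / (K * 2 ^ Suc m))"
        by (simp add: K'_def)
      ultimately show ?thesis by linarith
    qed
    finally show ?thesis by (simp add: algebra_simps)
  qed
  then show ?thesis using K'1 by blast
qed

text \<open>The drop in the form that telescopes: a volume power, weighted by the distance to the
  far ball, is at most a difference of consecutive smoothed volume powers.\<close>

lemma vol_powr_le_drop:
  assumes t: "0 < t" "t < 1" and a: "0 < a" and m: "hdim < m" and \<tau>: "0 < \<tau>"
  shows "\<exists>K\<ge>1. \<exists>n. \<forall>x p. \<forall>R>0. (\<forall>y\<in>qball d p (a * R). a * R \<le> d x y) \<longrightarrow>
    vol x R powr \<tau> / rdist R x p ^ n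
      \<le> K * (smooth_vol m x R powr \<tau> - smooth_vol m x (t * R) powr \<tau>)"
proof -
  obtain K where K: "1 \<le> K" "\<And>x p R. 0 < R \<Longrightarrow> \<forall>y\<in>qball d p (a * R). a * R \<le> d x y \<Longrightarrow>
    smooth_vol m x (t * R) \<le> smooth_vol m x R * (1 - 1 / (K * rdist R x p ^ (hdim + m)))"
    using smooth_vol_drop[OF t a m] by blast
  define c where "c = min 1 \<tau>"
  have c: "0 < c" "c \<le> 1" using \<tau> by (auto simp: c_def)
  define K' where "K' = (2 ^ m) powr \<tau> * K / c"
  have p2: "1 \<le> (2 ^ m :: real) powr \<tau>" using \<tau> by (intro ge_one_powr_ge_zero) auto
  have K': "1 \<le> K'"
    using mult_mono[of 1 "(2 ^ m) powr \<tau>" 1 K] K(1) p2 c by (simp add: K'_def le_divide_eq)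
  have "vol x R powr \<tau> / rdist R x p ^ (hdim + m)
      \<le> K' * (smooth_vol m x R powr \<tau> - smooth_vol m x (t * R) powr \<tau>)"
    if R: "0 < R" and far: "\<forall>y\<in>qball d p (a * R). a * R \<le> d x y" for x p R
  proof -
    let ?e = "rdist R x p ^ (hdim + m)" and ?P = "smooth_vol m x R"
    have e: "1 \<le> ?e" using rdist_ge_1[OF R] by (intro one_le_power)
    define u where "u = 1 / (K * ?e)"
    have "1 \<le> K * ?e" using mult_mono[of 1 K 1 ?e] K(1) e by auto
    then have u: "0 < u" "u \<le> 1" by (auto simp: u_def)
    have P: "0 < ?P" using smooth_vol_pos[OF R m] .
    have "smooth_vol m x (t * R) powr \<tau> \<le> (?P * (1 - u)) powr \<tau>"
      using K(2)[OF R far] \<tau> smooth_vol_pos[of "t * R" m x] t R m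
      by (intro powr_mono2) (auto simp: u_def)
    also have "\<dots> = ?P powr \<tau> * (1 - u) powr \<tau>" using P u by (simp add: powr_mult)
    also have "\<dots> \<le> ?P powr \<tau> * (1 - c * u)"
      unfolding c_def using u \<tau> by (intro mult_left_mono one_minus_powr_le) auto
    finally have *: "?P powr \<tau> * (c * u) \<le> ?P powr \<tau> - smooth_vol m x (t * R) powr \<tau>"
      by (simp add: algebra_simps)
    have "vol x R powr \<tau> \<le> (2 ^ m * ?P) powr \<tau>"
      using smooth_vol_ge[OF R m] \<tau> by (intro powr_mono2) auto
    then have "vol x R powr \<tau> / ?e \<le> (2 ^ m) powr \<tau> * ?P powr \<tau> / ?e"
      using P e by (simp add: powr_mult divide_right_mono)
    also have "\<dots> = K' * (?P powr \<tau> * (c * u))" using K(1) c by (simp add: K'_def u_def)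
    also have "\<dots> \<le> K' * (?P powr \<tau> - smooth_vol m x (t * R) powr \<tau>)"
      using * K' by (intro mult_left_mono) auto
    finally show ?thesis .
  qed
  then show ?thesis using K' by blast
qed

lemma smooth_vol_mono:
  assumes "0 < r" "r \<le> R" "hdim < m"
  shows "smooth_vol m x r \<le> smooth_vol m x R"
  unfolding smooth_vol_def
proof (rule integral_mono)
  fix y
  have "rdist R x y \<le> rdist r x y"
    using assms d_nonneg[of x y] by (auto simp: rdist_def intro!: divide_left_mono)
  then show "1 / rdist r x y ^ m \<le> 1 / rdist R x y ^ m"
    using rdist_pos[of R x y] rdist_pos[of r x y] assms
    by (auto intro!: divide_left_mono power_mono)
qed (use assms in \<open>auto intro!: integrable_rdist\<close>)

end

section \<open>Sums over the wavelet index\<close>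

text \<open>The level names the scale of the wavelet bounds. For \<open>Inr (k, \<beta>)\<close> it
  is k, although centre and cube belong to level k + 1.\<close>

fun level :: "int \<times> 'i + int \<times> 'i \<Rightarrow> int" where
  "level (Inl (k, \<alpha>)) = k"
| "level (Inr (k, \<beta>)) = k"

fun center :: "(int \<Rightarrow> 'i \<Rightarrow> 'a) \<Rightarrow> int \<times> 'i + int \<times> 'i \<Rightarrow> 'a" where
  "center pt (Inl (k, \<alpha>)) = pt k \<alpha>"
| "center pt (Inr (k, \<beta>)) = pt (k + 1) \<beta>"

fun cube :: "(int \<Rightarrow> 'i \<Rightarrow> 'a set) \<Rightarrow> int \<times> 'i + int \<times> 'i \<Rightarrow> 'a set" where
  "cube Q (Inl (k, \<alpha>)) = Q k \<alpha>"
| "cube Q (Inr (k, \<beta>)) = Q (k + 1) \<beta>"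

context dyadic_system
begin

abbreviation J0 :: "(int \<times> 'i + int \<times> 'i) set" where
  "J0 \<equiv> wavelet_index A pt 0"

abbreviation cen :: "int \<times> 'i + int \<times> 'i \<Rightarrow> 'a" where
  "cen \<equiv> center pt"

definition scale :: "int \<Rightarrow> real" where
  "scale k = \<delta> powi k"

abbreviation ldist :: "int \<Rightarrow> 'a \<Rightarrow> int \<times> 'i + int \<times> 'i \<Rightarrow> real" where
  "ldist k x j \<equiv> rdist (scale k) x (cen j)"

lemma J0_cases [consumes 1, case_names Inl Inr]:
  assumes "j \<in> J0"
  obtains \<alpha> where "j = Inl (0, \<alpha>)" "\<alpha> \<in> A 0"
  | k \<beta> where "j = Inr (k, \<beta>)" "0 \<le> k" "\<beta> \<in> new_index A pt k"
  using assms by (auto simp: wavelet_index_def)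

lemma level_nonneg: "j \<in> J0 \<Longrightarrow> 0 \<le> level j"
  by (auto elim: J0_cases)

lemma scale_pos: "0 < scale k"
  using \<delta>_pos by (simp add: scale_def zero_less_power_int)

lemma scale_Suc: "scale (k + 1) = \<delta> * scale k"
  using \<delta>_pos by (simp add: scale_def power_int_add)

lemma scale_0 [simp]: "scale 0 = 1"
  by (simp add: scale_def)

lemma scale_add_nat: "scale (k + int n) = scale k * \<delta> ^ n"
  using \<delta>_pos by (simp add: scale_def power_int_add)

lemma scale_antimono: "k \<le> l \<Longrightarrow> scale l \<le> scale k"
proof -
  assume "k \<le> l"
  then have "l = k + int (nat (l - k))" by simp
  then have "scale l = scale k * \<delta> ^ nat (l - k)" by (metis scale_add_nat)
  also have "\<dots> \<le> scale k * 1"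
    using \<delta>_pos \<delta>_less_1 scale_pos[of k] by (intro mult_left_mono power_le_one) auto
  finally show ?thesis by simp
qed

lemma scale_le_1: "0 \<le> k \<Longrightarrow> scale k \<le> 1"
  using scale_antimono[of 0 k] by simp

lemma new_index_subset: "\<beta> \<in> new_index A pt k \<Longrightarrow> \<beta> \<in> A (k + 1)"
  by (simp add: new_index_def)

text \<open>The factor \<delta> compensates for that shift: with it, the ball of radius
  \<open>rin * scale (level j)\<close> fits into the cube of either kind of index.\<close>

definition rin :: real where "rin = c0 * \<delta> / (3 * A0\<^sup>2)"

definition rout :: real where "rout = max (2 * A0 * C0) 1"

lemma rin_pos: "0 < rin"
  using c0_pos \<delta>_pos A0_ge_1 by (simp add: rin_def)

lemma rout_ge_1: "1 \<le> rout"
  by (simp add: rout_def)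

lemma inner_ball_cube: "j \<in> J0 \<Longrightarrow> qball d (cen j) (rin * scale (level j)) \<subseteq> cube Q j"
proof (erule J0_cases)
  fix \<alpha> assume j: "j = Inl (0, \<alpha>)" "\<alpha> \<in> A 0"
  have "rin * scale 0 \<le> c0 / (3 * A0\<^sup>2) * \<delta> powi 0"
    using c0_pos \<delta>_less_1 A0_ge_1 by (auto simp: rin_def intro!: divide_right_mono)
  from qball_mono[OF this] show ?thesis using inner_ball[OF j(2)] j by fastforce
next
  fix k \<beta> assume j: "j = Inr (k, \<beta>)" "0 \<le> k" "\<beta> \<in> new_index A pt k"
  have "rin * scale k = c0 / (3 * A0\<^sup>2) * \<delta> powi (k + 1)"
    using scale_Suc[of k] by (simp add: rin_def scale_def)
  then show ?thesis using inner_ball[OF new_index_subset[OF j(3)]] j by simp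
qed

lemma outer_ball_cube: "j \<in> J0 \<Longrightarrow> cube Q j \<subseteq> qball d (cen j) (rout * scale (level j))"
proof (erule J0_cases)
  fix \<alpha> assume j: "j = Inl (0, \<alpha>)" "\<alpha> \<in> A 0"
  then show ?thesis using outer_ball[OF j(2)] by (simp add: rout_def scale_def)
next
  fix k \<beta> assume j: "j = Inr (k, \<beta>)" "0 \<le> k" "\<beta> \<in> new_index A pt k"
  have "max (2 * A0 * C0) 1 * \<delta> powi (k + 1) \<le> rout * scale k"
    using scale_antimono[of k "k + 1"] rout_ge_1
    by (simp add: rout_def scale_def mult_left_mono)
  from qball_mono[OF this] show ?thesis using outer_ball[OF new_index_subset[OF j(3)]] j by fastforce
qed

lemma cube_meas [measurable]: "j \<in> J0 \<Longrightarrow> cube Q j \<in> sets M"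
  by (erule J0_cases) (auto intro: cube_measurable new_index_subset)

lemma packing_level_aux:
  assumes F: "finite F" "F \<subseteq> J0" "\<And>j. j \<in> F \<Longrightarrow> level j = k"
    and disj: "disjoint_family_on (cube Q) F"
  shows "disjoint_family_on (\<lambda>j. qball d (cen j) (rin * scale k)) F"
proof -
  have "qball d (cen j) (rin * scale k) \<subseteq> cube Q j" if "j \<in> F" for j
    using inner_ball_cube[of j] F that by blast
  then show ?thesis using disj unfolding disjoint_family_on_def by blast
qed

text \<open>Level 0 holds both the functions \<phi> on cubes of level 0 and the first \<psi> on
  cubes of level 1, and these cubes overlap. Each kind separately has disjoint cubes, so
  \<open>packing\<close> is applied twice; hence the factor 2.\<close>

lemma packing_level:
  "\<exists>K\<ge>1. \<exists>n. \<forall>k x F. finite F \<longrightarrow> F \<subseteq> J0 \<longrightarrow> (\<forall>j\<in>F. level j = k) \<longrightarrow>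
    (\<Sum>j\<in>F. 1 / ldist k x j ^ n) \<le> K"
proof -
  obtain K n where K: "1 \<le> K" "\<And>x p (F :: (int \<times> 'i + int \<times> 'i) set) R. 0 < R \<Longrightarrow> finite F \<Longrightarrow>
    disjoint_family_on (\<lambda>\<beta>. qball d (p \<beta>) (rin * R)) F \<Longrightarrow>
    (\<Sum>\<beta>\<in>F. 1 / rdist R x (p \<beta>) ^ n) \<le> K"
    using packing[OF rin_pos] by blast
  have "(\<Sum>j\<in>F. 1 / ldist k x j ^ n) \<le> 2 * K"
    if F: "finite F" "F \<subseteq> J0" "\<forall>j\<in>F. level j = k" for k x F
  proof -
    have l: "disjoint_family_on (cube Q) (F \<inter> range Inl)"
    proof (unfold disjoint_family_on_def, intro ballI impI)
      fix i j assume *: "i \<in> F \<inter> range Inl" "j \<in> F \<inter> range Inl" "i \<noteq> j"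
      then obtain k1 k2 \<alpha> \<beta> where ij: "i = Inl (k1, \<alpha>)" "j = Inl (k2, \<beta>)" by fastforce
      moreover have "k1 = 0" "\<alpha> \<in> A 0" "k2 = 0" "\<beta> \<in> A 0"
        using F(2) * ij by (auto simp: wavelet_index_def)
      ultimately show "cube Q i \<inter> cube Q j = {}"
        using cubes_disjoint[of 0] *(3) by (auto simp: disjoint_family_on_def)
    qed
    have r: "disjoint_family_on (cube Q) (F \<inter> range Inr)"
    proof (unfold disjoint_family_on_def, intro ballI impI)
      fix i j assume *: "i \<in> F \<inter> range Inr" "j \<in> F \<inter> range Inr" "i \<noteq> j"
      then obtain l1 l2 \<alpha> \<beta> where ij: "i = Inr (l1, \<alpha>)" "j = Inr (l2, \<beta>)" by fastforce
      moreover have "\<alpha> \<in> new_index A pt l1" "\<beta> \<in> new_index A pt l2"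
        using F(2) * ij by (auto simp: wavelet_index_def)
      moreover have "l1 = k" "l2 = k" using F(3) * ij by auto
      ultimately show "cube Q i \<inter> cube Q j = {}"
        using cubes_disjoint[of "k + 1"] new_index_subset *(3) by (auto simp: disjoint_family_on_def)
    qed
    have eq: "F = (F \<inter> range Inl) \<union> (F \<inter> range Inr)"
      using F(2) by (auto simp: wavelet_index_def)
    have "(\<Sum>j\<in>F. 1 / ldist k x j ^ n) =
        (\<Sum>j\<in>F \<inter> range Inl. 1 / ldist k x j ^ n) +
        (\<Sum>j\<in>F \<inter> range Inr. 1 / ldist k x j ^ n)"
      using F(1) by (subst eq, subst sum.union_disjoint) auto
    also have "\<dots> \<le> K + K"
      using F l r scale_pos
      by (intro add_mono K packing_level_aux) auto
    finally show ?thesis by simp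
  qed
  moreover have "1 \<le> 2 * K" using K by simp
  ultimately show ?thesis by blast
qed

text \<open>Of the weight exponent, one part moves the volume from the centre of j to x, and the
  other makes the number of indices summable.\<close>

lemma level_sum:
  "\<exists>K\<ge>1. \<exists>n. \<forall>k x F. finite F \<longrightarrow> F \<subseteq> J0 \<longrightarrow> (\<forall>j\<in>F. level j = k) \<longrightarrow>
    (\<Sum>j\<in>F. vol (cen j) (scale k) powr \<tau> / ldist k x j ^ n) \<le> K * vol x (scale k) powr \<tau>"
proof -
  obtain K n where K: "1 \<le> K" "\<And>k x F. finite F \<Longrightarrow> F \<subseteq> J0 \<Longrightarrow> \<forall>j\<in>F. level j = k \<Longrightarrow>
    (\<Sum>j\<in>F. 1 / ldist k x j ^ n) \<le> K"
    using packing_level by blast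
  obtain Kv nv where Kv: "1 \<le> Kv"
    "\<And>x y R. 0 < R \<Longrightarrow> vol y R powr \<tau> \<le> Kv * rdist R x y ^ nv * vol x R powr \<tau>"
    using vol_rdist_powr by blast
  have "(\<Sum>j\<in>F. vol (cen j) (scale k) powr \<tau> / ldist k x j ^ (nv + n))
      \<le> Kv * K * vol x (scale k) powr \<tau>"
    if F: "finite F" "F \<subseteq> J0" "\<forall>j\<in>F. level j = k" for k x F
  proof -
    have "vol (cen j) (scale k) powr \<tau> / ldist k x j ^ (nv + n)
        \<le> Kv * vol x (scale k) powr \<tau> * (1 / ldist k x j ^ n)" for j
    proof -
      have "vol (cen j) (scale k) powr \<tau> / ldist k x j ^ (nv + n)
          \<le> Kv * ldist k x j ^ nv * vol x (scale k) powr \<tau> / ldist k x j ^ (nv + n)"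
        using Kv(2)[OF scale_pos] rdist_pos[OF scale_pos] by (intro divide_right_mono) (auto simp: less_imp_le)
      then show ?thesis using rdist_pos[OF scale_pos, of k x "cen j"] by (simp add: power_add)
    qed
    then have "(\<Sum>j\<in>F. vol (cen j) (scale k) powr \<tau> / ldist k x j ^ (nv + n))
        \<le> Kv * vol x (scale k) powr \<tau> * (\<Sum>j\<in>F. 1 / ldist k x j ^ n)"
      unfolding sum_distrib_left by (intro sum_mono)
    also have "\<dots> \<le> Kv * vol x (scale k) powr \<tau> * K"
      using K(2)[OF F] Kv(1) by (intro mult_left_mono) auto
    finally show ?thesis by (simp add: mult_ac)
  qed
  moreover have "1 \<le> Kv * K" using mult_mono[of 1 Kv 1 K] Kv K by auto
  ultimately show ?thesis by blast
qed

text \<open>The old centre next to a new one is separated from it, so one of the two is far from \<open>x\<close>.\<close>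

lemma new_point_far:
  assumes \<beta>: "\<beta> \<in> new_index A pt k"
  obtains p where "rdist (scale k) (pt (k + 1) \<beta>) p \<le> 1 + C0"
    "\<And>y. y \<in> qball d p (c0 * \<delta> / (4 * A0\<^sup>2) * scale k) \<Longrightarrow> c0 * \<delta> / (4 * A0\<^sup>2) * scale k \<le> d x y"
proof -
  let ?p = "pt (k + 1) \<beta>" and ?R = "scale k"
  \<comment> \<open>One factor \<open>2 * A0\<close> is lost in showing that x is far from one of
    the two centres, a second one in passing from that centre to all points of a ball around
    it.\<close>
  define b where "b = c0 * \<delta> / (4 * A0\<^sup>2)"
  have A0: "0 < A0" using A0_ge_1 by simp
  obtain \<alpha> where \<alpha>: "\<alpha> \<in> A k" "d ?p (pt k \<alpha>) < C0 * ?R" using net[of k ?p] by (auto simp: scale_def)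
  then obtain \<gamma> where \<gamma>: "\<gamma> \<in> A (k + 1)" "pt k \<alpha> = pt (k + 1) \<gamma>" using nested_points[of k] by blast
  have "pt (k + 1) \<gamma> \<in> pt k ` A k" using \<alpha>(1) \<gamma>(2) by (metis imageI)
  then have "\<beta> \<noteq> \<gamma>" using \<beta> by (auto simp: new_index_def)
  then have sep: "c0 * \<delta> * ?R \<le> d ?p (pt k \<alpha>)"
    using separated[OF new_index_subset[OF \<beta>] \<gamma>(1)] \<gamma>(2) scale_Suc[of k] by (simp add: scale_def)
  have far: "b * ?R \<le> d x y" if q: "2 * A0 * b * ?R \<le> d x q" and y: "y \<in> qball d q (b * ?R)" for q y
  proof -
    have "2 * A0 * b * ?R \<le> A0 * (d x y + d y q)" using q quasi_triangle[of x q y] by linarith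
    then have "2 * b * ?R \<le> d x y + d y q"
      using A0 by (subst (asm) mult.assoc, subst (asm) mult.assoc, subst (asm) mult.left_commute)
        (simp add: mult_ac)
    then show ?thesis using y by (simp add: qball_iff d_sym)
  qed
  have "2 * A0 * b * ?R \<le> d x ?p \<or> 2 * A0 * b * ?R \<le> d x (pt k \<alpha>)"
  proof (rule ccontr)
    assume "\<not> ?thesis"
    then have "A0 * (d ?p x + d x (pt k \<alpha>)) < A0 * (4 * A0 * b * ?R)"
      using A0 by (intro mult_strict_left_mono) (auto simp: d_sym)
    moreover have "d ?p (pt k \<alpha>) \<le> A0 * (d ?p x + d x (pt k \<alpha>))" by (rule quasi_triangle)
    moreover have "A0 * (4 * A0 * b * ?R) = c0 * \<delta> * ?R"
      using A0 by (simp add: b_def power2_eq_square)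
    ultimately show False using sep by linarith
  qed
  then show thesis
  proof
    assume "2 * A0 * b * ?R \<le> d x ?p"
    note far' = far[OF this]
    show thesis
      using c0_pos c0_less_C0 far' by (intro that[of ?p]) (auto simp: b_def rdist_def)
  next
    assume "2 * A0 * b * ?R \<le> d x (pt k \<alpha>)"
    note far' = far[OF this]
    show thesis
      using \<alpha>(2) scale_pos far' by (intro that[of "pt k \<alpha>"]) (auto simp: b_def intro: rdist_le_of_less)
  qed
qed

text \<open>The far centre provided by \<open>new_point_far\<close> lies within a bounded multiple
  of the scale from the new point, so the weight may be taken at the new point instead, at the price
  of the constant e.\<close>

lemma new_level_drop:
  assumes m: "hdim < m" and \<tau>: "0 < \<tau>"
  shows "\<exists>K\<ge>1. \<exists>n. \<forall>k x. \<forall>\<beta>\<in>new_index A pt k.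
    vol x (scale k) powr \<tau> / rdist (scale k) x (pt (k + 1) \<beta>) ^ n
      \<le> K * (smooth_vol m x (scale k) powr \<tau> - smooth_vol m x (scale (k + 1)) powr \<tau>)"
proof -
  define b where "b = c0 * \<delta> / (4 * A0\<^sup>2)"
  have b: "0 < b" using c0_pos \<delta>_pos A0_ge_1 by (simp add: b_def)
  obtain K n where K: "1 \<le> K" "\<And>x p R. 0 < R \<Longrightarrow> \<forall>y\<in>qball d p (b * R). b * R \<le> d x y \<Longrightarrow>
    vol x R powr \<tau> / rdist R x p ^ n
      \<le> K * (smooth_vol m x R powr \<tau> - smooth_vol m x (\<delta> * R) powr \<tau>)"
    using vol_powr_le_drop[OF \<delta>_pos \<delta>_less_1 b m \<tau>] by blast
  define e where "e = (A0 * (1 + C0)) ^ n"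
  have "1 \<le> A0 * (1 + C0)"
    using mult_mono[of 1 A0 1 "1 + C0"] A0_ge_1 c0_pos c0_less_C0 by auto
  then have e: "1 \<le> e" unfolding e_def by (rule one_le_power)
  have "vol x (scale k) powr \<tau> / rdist (scale k) x (pt (k + 1) \<beta>) ^ n
      \<le> e * K * (smooth_vol m x (scale k) powr \<tau> - smooth_vol m x (scale (k + 1)) powr \<tau>)"
    if \<beta>: "\<beta> \<in> new_index A pt k" for k x \<beta>
  proof -
    let ?p = "pt (k + 1) \<beta>" and ?R = "scale k"
    obtain q where q: "rdist ?R ?p q \<le> 1 + C0"
      "\<And>y. y \<in> qball d q (b * ?R) \<Longrightarrow> b * ?R \<le> d x y"
      using new_point_far[OF \<beta>, of x] unfolding b_def by metis
    have r: "1 \<le> rdist ?R x ?p" "1 \<le> rdist ?R x q" using rdist_ge_1[OF scale_pos] by auto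
    have "rdist ?R x q \<le> A0 * rdist ?R x ?p * rdist ?R ?p q" by (rule rdist_triangle[OF scale_pos])
    also have "\<dots> \<le> A0 * rdist ?R x ?p * (1 + C0)"
      using q A0_ge_1 r by (intro mult_left_mono) auto
    finally have "rdist ?R x q ^ n \<le> (A0 * rdist ?R x ?p * (1 + C0)) ^ n"
      using r by (intro power_mono) auto
    also have "\<dots> = e * rdist ?R x ?p ^ n" by (simp add: e_def power_mult_distrib mult_ac)
    finally have "1 / rdist ?R x ?p ^ n \<le> e * (1 / rdist ?R x q ^ n)"
      using r by (simp add: divide_simps mult_ac)
    from mult_left_mono[OF this, of "vol x ?R powr \<tau>"]
    have "vol x ?R powr \<tau> / rdist ?R x ?p ^ n \<le> e * (vol x ?R powr \<tau> / rdist ?R x q ^ n)"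
      by (simp add: mult.commute)
    also have "\<dots> \<le> e * (K * (smooth_vol m x ?R powr \<tau> - smooth_vol m x (\<delta> * ?R) powr \<tau>))"
      using K(2)[OF scale_pos, where p = q and x = x] q(2) e by (intro mult_left_mono) auto
    finally show ?thesis by (simp add: scale_Suc mult.assoc)
  qed
  moreover have "1 \<le> e * K" using mult_mono[of 1 e 1 K] e K by auto
  ultimately show ?thesis by blast
qed

text \<open>The set of levels may have gaps; as every drop is nonnegative, they can be filled before
  telescoping.\<close>

lemma smooth_vol_telescope:
  assumes L: "finite L" "\<And>k. k \<in> L \<Longrightarrow> k0 \<le> k" and m: "hdim < m" and \<tau>: "0 < \<tau>"
  shows "(\<Sum>k\<in>L. smooth_vol m x (scale k) powr \<tau> - smooth_vol m x (scale (k + 1)) powr \<tau>)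
    \<le> smooth_vol m x (scale k0) powr \<tau>"
proof -
  define g where "g n = smooth_vol m x (scale (k0 + int n)) powr \<tau>" for n
  let ?h = "\<lambda>k. smooth_vol m x (scale k) powr \<tau> - smooth_vol m x (scale (k + 1)) powr \<tau>"
  have h0: "0 \<le> ?h k" for k
    using smooth_vol_mono[OF scale_pos scale_antimono m, of k "k + 1"] \<tau> smooth_vol_pos[OF scale_pos m]
    by (auto intro!: powr_mono2 simp: less_imp_le)
  obtain N where N: "\<And>k. k \<in> L \<Longrightarrow> nat (k - k0) < N"
    using finite_nat_set_iff_bounded[of "(\<lambda>k. nat (k - k0)) ` L"] L(1) by auto
  have "L \<subseteq> (\<lambda>n. k0 + int n) ` {..<N}"
  proof
    fix k assume "k \<in> L"
    then show "k \<in> (\<lambda>n. k0 + int n) ` {..<N}"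
      using L(2)[of k] N[of k] by (intro image_eqI[of _ _ "nat (k - k0)"]) auto
  qed
  then have "(\<Sum>k\<in>L. ?h k) \<le> (\<Sum>k\<in>(\<lambda>n. k0 + int n) ` {..<N}. ?h k)"
    using h0 by (intro sum_mono2) auto
  also have "\<dots> = (\<Sum>n<N. g n - g (Suc n))"
    by (subst sum.reindex) (auto simp: inj_on_def g_def ac_simps)
  also have "\<dots> = g 0 - g N" by (rule sum_lessThan_telescope')
  also have "\<dots> \<le> smooth_vol m x (scale k0) powr \<tau>" by (simp add: g_def)
  finally show ?thesis .
qed

text \<open>The substitute for geometric decay of volumes. On each level the packing bound reduces
  the sum to \<open>vol x (scale l) powr \<tau>\<close>, and the nearest new point of that level
  turns this into a drop of the smoothed volume; the drops telescope to the coarsest level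
  k.\<close>

lemma high_level_sum:
  assumes \<tau>: "0 < \<tau>"
  shows "\<exists>K\<ge>1. \<exists>n. \<forall>k x F. finite F \<longrightarrow> F \<subseteq> J0 \<longrightarrow> (\<forall>j\<in>F. k \<le> level j) \<longrightarrow> 0 \<le> k \<longrightarrow>
    (\<Sum>j\<in>F. vol (cen j) (scale (level j)) powr \<tau> / ldist (level j) x j ^ n)
      \<le> K * vol x (scale k) powr \<tau>"
proof -
  define m where "m = Suc hdim"
  have m: "hdim < m" by (simp add: m_def)
  obtain K1 n1 where K1: "1 \<le> K1" "\<And>k x F. finite F \<Longrightarrow> F \<subseteq> J0 \<Longrightarrow> \<forall>j\<in>F. level j = k \<Longrightarrow>
    (\<Sum>j\<in>F. vol (cen j) (scale k) powr \<tau> / ldist k x j ^ n1) \<le> K1 * vol x (scale k) powr \<tau>"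
    using level_sum by blast
  obtain K2 n2 where K2: "1 \<le> K2" "\<And>k x \<beta>. \<beta> \<in> new_index A pt k \<Longrightarrow>
    vol x (scale k) powr \<tau> / rdist (scale k) x (pt (k + 1) \<beta>) ^ n2
      \<le> K2 * (smooth_vol m x (scale k) powr \<tau> - smooth_vol m x (scale (k + 1)) powr \<tau>)"
    using new_level_drop[OF m \<tau>] by blast
  \<comment> \<open>n1 pays for the sum within a level, n2 for the distance from x to the nearest
    new point.\<close>
  define n where "n = n1 + n2"
  define c where "c = (2 ^ Suc m) powr \<tau>"
  have c: "0 \<le> c" by (simp add: c_def)
  let ?t = "\<lambda>x j. vol (cen j) (scale (level j)) powr \<tau> / ldist (level j) x j ^ n"
  let ?h = "\<lambda>x k. smooth_vol m x (scale k) powr \<tau> - smooth_vol m x (scale (k + 1)) powr \<tau>"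
  have bound: "(\<Sum>j\<in>F. ?t x j) \<le> (K1 + K1 * K2 * c) * vol x (scale k) powr \<tau>"
    if F: "finite F" "F \<subseteq> J0" "\<forall>j\<in>F. k \<le> level j" "0 \<le> k" for k x F
  proof -
    have eq: "F = (F \<inter> range Inl) \<union> (F \<inter> range Inr)"
      using F(2) by (auto simp: wavelet_index_def)
    have split: "(\<Sum>j\<in>F. ?t x j) = (\<Sum>j\<in>F \<inter> range Inl. ?t x j) + (\<Sum>j\<in>F \<inter> range Inr. ?t x j)"
      using F(1) by (subst eq, subst sum.union_disjoint) auto
    have l: "(\<Sum>j\<in>F \<inter> range Inl. ?t x j) \<le> K1 * vol x (scale k) powr \<tau>"
    proof (cases "F \<inter> range Inl = {}")
      case False
      then obtain j where "j \<in> F \<inter> range Inl" by blast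
      then have "level j = 0" "k \<le> level j" using F by (auto simp: wavelet_index_def)
      \<comment> \<open>The functions \<phi> occur at level 0 only, so they contribute at most one
        level and need no telescoping.\<close>
      then have k: "k = 0" using F(4) by simp
      have lev: "level j = 0" if "j \<in> F \<inter> range Inl" for j using that F(2) by (auto simp: wavelet_index_def)
      have "(\<Sum>j\<in>F \<inter> range Inl. ?t x j) \<le>
          (\<Sum>j\<in>F \<inter> range Inl. vol (cen j) (scale 0) powr \<tau> / ldist 0 x j ^ n1)"
        using lev by (intro sum_mono) (auto simp: n_def intro!: rdist_power_mono)
      also have "\<dots> \<le> K1 * vol x (scale 0) powr \<tau>" using F lev by (intro K1) auto
      finally show ?thesis using k by simp
    qed (use K1 in simp)
    define F' where "F' = F \<inter> range Inr"
    have F': "finite F'" using F by (simp add: F'_def)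
    have one: "(\<Sum>j\<in>{j\<in>F'. level j = l}. ?t x j) \<le> K1 * K2 * ?h x l" if "l \<in> level ` F'" for l
    proof -
      let ?L = "{j\<in>F'. level j = l}"
      \<comment> \<open>The n2 part of every weight on level l is bounded by that of the index
        nearest to x, so it can be taken out of the sum.\<close>
      let ?R = "(\<lambda>j. ldist l x j) ` ?L"
      have "finite ?R" "?R \<noteq> {}" using that F' by auto
      then have "Min ?R \<in> ?R" by (rule Min_in)
      then obtain j0 where j0: "j0 \<in> F'" "level j0 = l" "Min ?R = ldist l x j0" by auto
      let ?e = "ldist l x j0"
      have e: "1 \<le> ?e" by (rule rdist_ge_1[OF scale_pos])
      have min: "?e \<le> ldist l x j" if "j \<in> ?L" for j
        using that j0(3) F' by (metis (no_types, lifting) Min_le \<open>finite ?R\<close> imageI)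
      have "(\<Sum>j\<in>?L. ?t x j) \<le>
          (\<Sum>j\<in>?L. (vol (cen j) (scale l) powr \<tau> / ldist l x j ^ n1) * (1 / ?e ^ n2))"
      proof (intro sum_mono)
        fix j assume j: "j \<in> ?L"
        have r: "0 < ldist l x j" by (rule rdist_pos[OF scale_pos])
        have "?e ^ n2 \<le> ldist l x j ^ n2" using min[OF j] e by (intro power_mono) auto
        then have "1 / ldist l x j ^ n2 \<le> 1 / ?e ^ n2"
          using e by (intro divide_left_mono) (auto simp: r)
        then have "(vol (cen j) (scale l) powr \<tau> / ldist l x j ^ n1) * (1 / ldist l x j ^ n2)
            \<le> (vol (cen j) (scale l) powr \<tau> / ldist l x j ^ n1) * (1 / ?e ^ n2)"
          using r by (intro mult_left_mono) auto
        then show "?t x j \<le> (vol (cen j) (scale l) powr \<tau> / ldist l x j ^ n1) * (1 / ?e ^ n2)"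
          using j by (simp add: n_def power_add)
      qed
      also have "\<dots> = (\<Sum>j\<in>?L. vol (cen j) (scale l) powr \<tau> / ldist l x j ^ n1) * (1 / ?e ^ n2)"
        by (simp only: sum_distrib_right)
      also have "\<dots> \<le> K1 * vol x (scale l) powr \<tau> * (1 / ?e ^ n2)"
        using finite_subset[of ?L F'] F' F(2) e by (intro mult_right_mono K1) (auto simp: F'_def)
      also have "\<dots> = K1 * (vol x (scale l) powr \<tau> / ?e ^ n2)" by simp
      also have "\<dots> \<le> K1 * (K2 * ?h x l)"
      proof -
        \<comment> \<open>F' contains right summands only, so the nearest index belongs to a new
          point and \<open>new_level_drop\<close> applies.\<close>
        obtain \<beta> where "j0 = Inr (l, \<beta>)" "\<beta> \<in> new_index A pt l"
          using j0 F(2) by (auto simp: F'_def wavelet_index_def)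
        then show ?thesis using K2(2)[of \<beta> l x] K1(1) by (intro mult_left_mono) auto
      qed
      finally show ?thesis by (simp add: mult.assoc)
    qed
    have "(\<Sum>j\<in>F'. ?t x j) = (\<Sum>l\<in>level ` F'. \<Sum>j\<in>{j\<in>F'. level j = l}. ?t x j)"
      using F' by (rule sum.image_gen)
    also have "\<dots> \<le> (\<Sum>l\<in>level ` F'. K1 * K2 * ?h x l)" using one by (intro sum_mono) auto
    also have "\<dots> = K1 * K2 * (\<Sum>l\<in>level ` F'. ?h x l)" by (simp add: sum_distrib_left)
    also have "\<dots> \<le> K1 * K2 * (smooth_vol m x (scale k) powr \<tau>)"
      using F' F(3) K1(1) K2(1) by (intro mult_left_mono smooth_vol_telescope m \<tau>) (auto simp: F'_def)
    also have "\<dots> \<le> K1 * K2 * (c * vol x (scale k) powr \<tau>)"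
    proof -
      have "smooth_vol m x (scale k) powr \<tau> \<le> (2 ^ Suc m * vol x (scale k)) powr \<tau>"
        using smooth_vol_le[OF scale_pos m] smooth_vol_pos[OF scale_pos m] \<tau>
        by (intro powr_mono2) (auto simp: less_imp_le)
      also have "\<dots> = c * vol x (scale k) powr \<tau>" by (simp add: c_def powr_mult)
      finally show ?thesis using K1(1) K2(1) by (intro mult_left_mono) auto
    qed
    finally show ?thesis using l split by (simp add: F'_def algebra_simps)
  qed
  have "0 \<le> K1 * K2 * c" using K1 K2 c by simp
  then have "1 \<le> K1 + K1 * K2 * c" using K1 by linarith
  with bound show ?thesis by blast
qed

end

section \<open>Lipschitz functions\<close>

lemma ennreal_divide_le_iff:
  assumes "0 < c"
  shows "a / ennreal c \<le> N \<longleftrightarrow> a \<le> N * ennreal c"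
proof
  assume "a / ennreal c \<le> N"
  then have "a / ennreal c * ennreal c \<le> N * ennreal c" by (intro mult_right_mono) auto
  then show "a \<le> N * ennreal c" using assms by (simp add: ennreal_divide_times)
next
  assume "a \<le> N * ennreal c"
  then show "a / ennreal c \<le> N"
    using assms by (intro divide_le_posI_ennreal) (auto simp: mult.commute)
qed

context homogeneous_type
begin

lemma ball_contains_of_AE:
  assumes "AE x in M. P x" "0 < r"
  obtains x where "x \<in> qball d z r" "P x"
proof (rule ccontr)
  assume "\<not> thesis"
  with that have "\<And>x. x \<in> qball d z r \<Longrightarrow> \<not> P x" by blast
  then have "AE x in M. x \<notin> qball d z r" using assms(1) by auto
  then have "emeasure M (qball d z r) = 0"
    by (simp add: AE_iff_null_sets[symmetric] null_setsD1)
  then show False using qball_measure_pos[OF assms(2), of z] by simp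
qed

text \<open>The bound \<open>e \<le> 1\<close> puts the small ball in the regime where
  \<open>lip_local\<close> measures oscillation.\<close>

lemma qball_subset_small:
  assumes "x \<in> qball d z r"
  obtains e where "0 < e" "e \<le> 1" "qball d x e \<subseteq> qball d z r"
proof -
  have "0 < r" using assms qball_nonpos[of r z] by (cases "0 < r") auto
  then obtain e where "0 < e" "qball d x e \<subseteq> qball d z r"
    using qball_open[of r z] assms by (auto simp: qopen_def)
  then show thesis using qball_mono[of "min e 1" e x] by (intro that[of "min e 1"]) auto
qed

text \<open>A version of the norm bound that holds at every point instead of essentially, and whose
  oscillation clause covers all radii. It passes to pointwise limits and allows values to be
  compared point by point.\<close>

definition lip_bound :: "real \<Rightarrow> real \<Rightarrow> ('a \<Rightarrow> complex) \<Rightarrow> bool" where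
  "lip_bound \<theta> N g \<longleftrightarrow> (\<forall>z r. 0 < r \<longrightarrow>
     (\<forall>x\<in>qball d z r. \<forall>y\<in>qball d z r. cmod (g x - g y) \<le> N * vol z r powr \<theta>) \<and>
     (1 < r \<longrightarrow> (\<forall>x\<in>qball d z r. cmod (g x) \<le> N * vol z r powr \<theta>)))"

lemma lip_boundD:
  assumes "lip_bound \<theta> N g" "0 < r"
  shows "x \<in> qball d z r \<Longrightarrow> y \<in> qball d z r \<Longrightarrow> cmod (g x - g y) \<le> N * vol z r powr \<theta>"
    and "1 < r \<Longrightarrow> x \<in> qball d z r \<Longrightarrow> cmod (g x) \<le> N * vol z r powr \<theta>"
  using assms by (auto simp: lip_bound_def)

text \<open>On a large ball only an essential bound is given; every point x has in each small ball
  around it a point where this bound holds, and the oscillation on that ball carries it over to x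
  with constant 2N. The oscillation on a large ball is then at most twice this; hence 4.\<close>

lemma lip_imp_lip_bound:
  assumes g: "g \<in> borel_measurable M" and N: "lip_norm M d \<theta> g \<le> ennreal N" "0 \<le> N" and \<theta>: "0 < \<theta>"
  shows "lip_bound \<theta> (4 * N) g"
proof -
  have loc: "lip_local M d \<theta> g z r \<le> ennreal N" if "0 < r" for z r
  proof -
    have "lip_local M d \<theta> g z r \<le> lip_norm M d \<theta> g"
      unfolding lip_norm_def using that
      by (intro SUP_upper2[of z] SUP_upper) auto
    then show ?thesis using N(1) by (rule order_trans)
  qed
  have mul: "ennreal N * ennreal (vol z r powr \<theta>) = ennreal (N * vol z r powr \<theta>)" for z r
    using N(2) by (simp add: ennreal_mult)
  have small: "cmod (g x - g y) \<le> N * vol z r powr \<theta>"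
    if "0 < r" "r \<le> 1" "x \<in> qball d z r" "y \<in> qball d z r" for z r x y
  proof -
    have "0 < vol z r powr \<theta>" using vol_pos[OF that(1), of z] by simp
    then have "(SUP y\<in>qball d z r. SUP x\<in>qball d z r. ennreal (cmod (g y - g x))) \<le> ennreal (N * vol z r powr \<theta>)"
      using loc[OF that(1), of z] that unfolding lip_local_def vol_def[symmetric]
      by (simp add: ennreal_divide_le_iff mul)
    then have "ennreal (cmod (g x - g y)) \<le> ennreal (N * vol z r powr \<theta>)"
      using that by (auto simp: SUP_le_iff)
    then show ?thesis using N(2) by (subst (asm) ennreal_le_iff) auto
  qed
  have big: "cmod (g x) \<le> 2 * N * vol z r powr \<theta>" if r: "1 < r" and x: "x \<in> qball d z r" for z r x
  proof -
    have pos: "0 < vol z r powr \<theta>" using vol_pos[of r z] r by simp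
    have "AE y in M. indicator (qball d z r) y * ennreal (cmod (g y)) \<le> ennreal (N * vol z r powr \<theta>)"
    proof -
      have "esssup M (\<lambda>y. indicator (qball d z r) y * ennreal (cmod (g y))) \<le> ennreal (N * vol z r powr \<theta>)"
        using loc[of r z] r pos unfolding lip_local_def vol_def[symmetric]
        by (simp add: ennreal_divide_le_iff mul)
      then show ?thesis
        using esssup_AE[of "\<lambda>y. indicator (qball d z r) y * ennreal (cmod (g y))" M]
        by (auto intro: order_trans)
    qed
    moreover obtain e where e: "0 < e" "e \<le> 1" "qball d x e \<subseteq> qball d z r" using qball_subset_small[OF x] .
    ultimately obtain y where y: "y \<in> qball d x e"
        "indicator (qball d z r) y * ennreal (cmod (g y)) \<le> ennreal (N * vol z r powr \<theta>)"
      using ball_contains_of_AE by blast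
    then have "cmod (g y) \<le> N * vol z r powr \<theta>"
      using e N(2) by (auto simp: subset_eq ennreal_le_iff)
    moreover have "cmod (g x - g y) \<le> N * vol x e powr \<theta>"
      using e y by (intro small) (auto simp: qball_iff)
    moreover have "N * vol x e powr \<theta> \<le> N * vol z r powr \<theta>"
      using N(2) \<theta> vol_subset[OF e(3)] by (intro mult_left_mono powr_mono2) auto
    moreover have "cmod (g x) \<le> cmod (g x - g y) + cmod (g y)"
      using norm_triangle_ineq[of "g x - g y" "g y"] by simp
    ultimately show ?thesis by linarith
  qed
  have "cmod (g x - g y) \<le> 4 * N * vol z r powr \<theta>"
    if r: "0 < r" and xy: "x \<in> qball d z r" "y \<in> qball d z r" for z r x y
  proof (cases "r \<le> 1")
    case True
    have "N * vol z r powr \<theta> \<ge> 0" using N(2) by simp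
    then show ?thesis using small[OF r True xy] by linarith
  next
    case False
    then show ?thesis using big[of r x z] big[of r y z] xy norm_triangle_ineq4[of "g x" "g y"] by simp
  qed
  moreover have "cmod (g x) \<le> 4 * N * vol z r powr \<theta>" if r: "1 < r" and x: "x \<in> qball d z r" for z r x
  proof -
    have "0 \<le> N * vol z r powr \<theta>" using N(2) by simp
    then show ?thesis using big[OF r x] by linarith
  qed
  ultimately show ?thesis by (auto simp: lip_bound_def)
qed

lemma lip_norm_le:
  assumes g: "g \<in> borel_measurable M" and b: "lip_bound \<theta> N g" and N: "0 \<le> N"
  shows "lip_norm M d \<theta> g \<le> ennreal N"
  unfolding lip_norm_def
proof (intro SUP_least)
  fix z r assume "r \<in> {0::real<..}"
  then have r: "0 < r" by simp
  have pos: "0 < vol z r powr \<theta>" using vol_pos[OF r, of z] by simp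
  have mul: "ennreal N * ennreal (vol z r powr \<theta>) = ennreal (N * vol z r powr \<theta>)"
    using N by (simp add: ennreal_mult)
  have "esssup M (\<lambda>y. indicator (qball d z r) y * ennreal (cmod (g y))) \<le> ennreal (N * vol z r powr \<theta>)"
    if "1 < r"
    using lip_boundD(2)[OF b r that] g
    by (intro esssup_I) (auto simp: indicator_def intro!: ennreal_leI)
  then show "lip_local M d \<theta> g z r \<le> ennreal N"
    unfolding lip_local_def vol_def[symmetric] ennreal_divide_le_iff[OF pos] mul
    using lip_boundD(1)[OF b r] by (auto intro!: SUP_least ennreal_leI)
qed

text \<open>Points are null sets, so the oscillation allowed by \<open>lip_bound\<close> tends to 0
  on shrinking balls: Lipschitz functions have determined point values.\<close>

lemma vol_tendsto_0: "(\<lambda>n. vol x (1 / Suc n)) \<longlonglongrightarrow> 0"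
proof -
  have dec: "decseq (\<lambda>n. qball d x (1 / Suc n))"
    unfolding decseq_def by (intro allI impI qball_mono) (auto simp: field_simps)
  have "(\<Inter>n. qball d x (1 / Suc n)) = {x}"
  proof (intro antisym subsetI)
    fix y assume y: "y \<in> (\<Inter>n. qball d x (1 / Suc n))"
    have "d x y = 0"
    proof (rule ccontr)
      assume "d x y \<noteq> 0"
      then have "0 < d x y" using d_nonneg[of x y] by simp
      then obtain n where "inverse (real (Suc n)) < d x y" using reals_Archimedean by blast
      moreover have "d x y < 1 / Suc n" using y by (auto simp: qball_iff)
      ultimately show False by (simp add: inverse_eq_divide)
    qed
    then show "y \<in> {x}" by (simp add: d_eq_0_iff)
  qed (simp add: qball_iff)
  moreover have "(\<lambda>n. vol x (1 / Suc n)) \<longlonglongrightarrow> measure M (\<Inter>n. qball d x (1 / Suc n))"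
    unfolding vol_def using dec by (intro Lim_measure_decseq) (auto simp: emeasure_qball)
  moreover have "measure M {x} = 0" by (simp add: measure_def point_null)
  ultimately show ?thesis by simp
qed

text \<open>Every small ball around x contains a point where f and g agree, and both vary by an
  arbitrarily small amount on it. Thus a class has only one Lipschitz representative, and norm
  bounds proved for a constructed one hold for any given one.\<close>

lemma lip_bound_AE_eq:
  assumes f: "lip_bound \<theta> N f" and g: "lip_bound \<theta> N' g" and ae: "AE x in M. f x = g x"
    and \<theta>: "0 < \<theta>"
  shows "f = g"
proof
  fix x
  have "cmod (f x - g x) \<le> (N + N') * vol x (1 / Suc n) powr \<theta>" for n
  proof -
    have p: "(0::real) < 1 / Suc n" by simp
    obtain y where y: "y \<in> qball d x (1 / Suc n)" "f y = g y" using ball_contains_of_AE[OF ae p] .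
    have "cmod (f x - f y) \<le> N * vol x (1 / Suc n) powr \<theta>"
      by (rule lip_boundD(1)[OF f p]) (use y in \<open>simp_all add: qball_iff\<close>)
    moreover have "cmod (g x - g y) \<le> N' * vol x (1 / Suc n) powr \<theta>"
      by (rule lip_boundD(1)[OF g p]) (use y in \<open>simp_all add: qball_iff\<close>)
    moreover have "cmod (f x - g x) \<le> cmod (f x - f y) + cmod (g x - g y)"
      using norm_triangle_ineq4[of "f x - f y" "g x - g y"] y(2) by simp
    ultimately show ?thesis by (simp add: distrib_right)
  qed
  moreover have "(\<lambda>n. (N + N') * vol x (1 / Suc n) powr \<theta>) \<longlonglongrightarrow> (N + N') * 0 powr \<theta>"
    using \<theta> by (intro tendsto_mult tendsto_powr2 tendsto_const vol_tendsto_0) auto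
  ultimately have "cmod (f x - g x) \<le> (N + N') * 0 powr \<theta>"
    by (intro LIMSEQ_le_const) auto
  then show "f x = g x" by simp
qed

lemma lip_bound_L2B:
  assumes g: "g \<in> borel_measurable M" and b: "lip_bound \<theta> N g"
  shows "L2B M d g"
  unfolding L2B_def set_integrable_def
proof (intro conjI g allI impI)
  fix x and r :: real assume r: "0 < r"
  \<comment> \<open>Radius \<open>r + 1\<close> exceeds 1, so the size clause of
    \<open>lip_bound\<close> applies even for small r.\<close>
  let ?c = "N * vol x (r + 1) powr \<theta>"
  show "integrable M (\<lambda>y. indicat_real (qball d x r) y *\<^sub>R (cmod (g y))\<^sup>2)"
  proof (rule integrableI_bounded_set[where A = "qball d x r" and B = "?c\<^sup>2"])
    show "AE y\<in>qball d x r in M. norm (indicat_real (qball d x r) y *\<^sub>R (cmod (g y))\<^sup>2) \<le> ?c\<^sup>2"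
    proof (intro AE_I2 impI)
      fix y assume y: "y \<in> qball d x r"
      have "cmod (g y) \<le> ?c" using r y by (intro lip_boundD(2)[OF b]) (auto simp: qball_iff)
      then show "norm (indicat_real (qball d x r) y *\<^sub>R (cmod (g y))\<^sup>2) \<le> ?c\<^sup>2"
        using y by (simp add: power_mono)
    qed
    show "emeasure M (qball d x r) < \<infinity>" using r by (rule qball_measure_finite)
  qed (use g in \<open>auto simp: indicator_def\<close>)
qed

lemma lip_bound_in_lip:
  assumes "g \<in> borel_measurable M" "lip_bound \<theta> N g" "0 \<le> N"
  shows "g \<in> lip M d \<theta>"
  using lip_bound_L2B[OF assms(1,2)] lip_norm_le[OF assms]
  by (auto simp: lip_def intro: le_less_trans)

text \<open>Both points lie in the ball about p of radius \<open>2 * rdist R x p * R\<close>, whose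
  volume is polynomial in \<open>rdist\<close>. The factor 2 makes this radius larger than R, so the
  size clause applies as soon as \<open>1 \<le> R\<close>.\<close>

lemma lip_bound_growth:
  assumes \<theta>: "0 < \<theta>"
  shows "\<exists>K\<ge>1. \<exists>n. \<forall>N g p x. \<forall>R>0. 0 \<le> N \<longrightarrow> lip_bound \<theta> N g \<longrightarrow>
    cmod (g x - g p) \<le> K * N * rdist R x p ^ n * vol p R powr \<theta> \<and>
    (1 \<le> R \<longrightarrow> cmod (g x) \<le> K * N * rdist R x p ^ n * vol p R powr \<theta>)"
proof -
  let ?w = "upper_dim M d"
  define n where "n = nat \<lceil>?w * \<theta>\<rceil>"
  have n: "?w * \<theta> \<le> real n" unfolding n_def by linarith
  define K where "K = (dconst * 2 powr ?w) powr \<theta>"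
  have "1 \<le> dconst * 2 powr ?w"
    using mult_mono[of 1 dconst 1 "2 powr ?w"] dconst_ge_1 by (simp add: two_powr_upper_dim)
  then have K: "1 \<le> K" unfolding K_def using \<theta> by (intro ge_one_powr_ge_zero) auto
  have vb: "vol p (2 * rdist R x p * R) powr \<theta> \<le> K * rdist R x p ^ n * vol p R powr \<theta>"
    if R: "0 < R" for p x R
  proof -
    have r: "1 \<le> rdist R x p" by (rule rdist_ge_1[OF R])
    have "vol p (2 * rdist R x p * R) powr \<theta> \<le> (dconst * (2 * rdist R x p) powr ?w * vol p R) powr \<theta>"
      using r R \<theta> by (intro powr_mono2 vol_scale) auto
    also have "\<dots> = K * rdist R x p powr (?w * \<theta>) * vol p R powr \<theta>"
      using dconst_ge_1 r by (simp add: powr_mult powr_powr K_def mult_ac)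
    also have "\<dots> \<le> K * rdist R x p ^ n * vol p R powr \<theta>"
      using K r n by (intro mult_right_mono mult_left_mono powr_le_power) auto
    finally show ?thesis .
  qed
  have in_ball: "x \<in> qball d p (2 * rdist R x p * R)" "p \<in> qball d p (2 * rdist R x p * R)"
    "R < 2 * rdist R x p * R" if R: "0 < R" for p x R
    using R d_nonneg[of x p] by (auto simp: qball_iff rdist_def algebra_simps d_sym[of p])
  have "cmod (g x - g p) \<le> K * N * rdist R x p ^ n * vol p R powr \<theta> \<and>
    (1 \<le> R \<longrightarrow> cmod (g x) \<le> K * N * rdist R x p ^ n * vol p R powr \<theta>)"
    if R: "0 < R" and N: "0 \<le> N" and g: "lip_bound \<theta> N g" for N g p x R
  proof -
    have pos: "0 < 2 * rdist R x p * R" using R rdist_pos[OF R, of x p] by simp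
    have "N * vol p (2 * rdist R x p * R) powr \<theta> \<le> N * (K * rdist R x p ^ n * vol p R powr \<theta>)"
      using vb[OF R] N by (intro mult_left_mono)
    also have "\<dots> = K * N * rdist R x p ^ n * vol p R powr \<theta>" by (simp add: mult_ac)
    finally show ?thesis
      using lip_boundD(1)[OF g pos in_ball(1)[OF R, of x p] in_ball(2)[OF R, of p x]]
        lip_boundD(2)[OF g pos _ in_ball(1)[OF R, of x p]] in_ball(3)[OF R, of x p] by auto
  qed
  then show ?thesis using K by blast
qed

lemma integrable_of_decay:
  fixes h :: "'a \<Rightarrow> 'b::{banach, second_countable_topology}"
  assumes h: "h \<in> borel_measurable M" and R: "0 < R" and m: "hdim < m"
    and le: "\<And>x. norm (h x) \<le> B / rdist R x p ^ m"
  shows "integrable M h" "norm (integral\<^sup>L M h) \<le> B * (2 ^ Suc m * vol p R)"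
proof -
  have "0 \<le> B / rdist R p p ^ m" using le[of p] norm_ge_zero order_trans by blast
  then have B: "0 \<le> B" using zero_less_power[OF rdist_pos[OF R, of p p], of m]
    by (simp add: zero_le_divide_iff)
  have int: "integrable M (\<lambda>x. B * (1 / rdist R p x ^ m))"
    using integrable_rdist[OF R m, of p] by (rule integrable_mult_right)
  have le': "norm (h x) \<le> B * (1 / rdist R p x ^ m)" for x using le[of x] by (simp add: rdist_sym)
  then show i: "integrable M h"
    using h order_trans[OF le' abs_ge_self]
    by (intro Bochner_Integration.integrable_bound[OF int]) (simp_all only: real_norm_def AE_I2)
  have "norm (integral\<^sup>L M h) \<le> (LINT x|M. norm (h x))" by (rule integral_norm_bound)
  also have "\<dots> \<le> (LINT x|M. B * (1 / rdist R p x ^ m))"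
    using i int le' by (intro integral_mono) auto
  also have "\<dots> = B * smooth_vol m p R" unfolding smooth_vol_def by (rule integral_mult_right_zero)
  also have "\<dots> \<le> B * (2 ^ Suc m * vol p R)" using B smooth_vol_le[OF R m] by (intro mult_left_mono)
  finally show "norm (integral\<^sup>L M h) \<le> B * (2 ^ Suc m * vol p R)" .
qed

end

section \<open>Wavelet estimates\<close>

text \<open>For t > 1, t^m is at most the n-th power of t powr s, which is compared with the
  exponential through (1 + x/n)^n \<le> exp x.\<close>

lemma exp_powr_le_power:
  fixes \<nu> s :: real
  assumes \<nu>: "0 < \<nu>" and s: "0 < s"
  shows "\<exists>K\<ge>1. \<forall>t\<ge>0. exp (- \<nu> * t powr s) \<le> K / (1 + t) ^ m"
proof -
  \<comment> \<open>Large enough for \<open>real m \<le> s * real n\<close>; the successor keeps n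
    positive for the division by n.\<close>
  define n where "n = Suc (nat \<lceil>real m / s\<rceil>)"
  have n0: "0 < n" by (simp add: n_def)
  have "real m / s \<le> real n" unfolding n_def by linarith
  then have n: "real m \<le> s * real n" using s by (simp add: pos_divide_le_eq mult.commute)
  define K where "K = 2 ^ m * (1 + (real n / \<nu>) ^ n)"
  have nn: "0 \<le> (real n / \<nu>) ^ n" using \<nu> by simp
  have K: "1 \<le> K"
    unfolding K_def using mult_mono[of 1 "2 ^ m" 1 "1 + (real n / \<nu>) ^ n"] nn by simp
  have "(1 + t) ^ m * exp (- (\<nu> * t powr s)) \<le> K" if t: "0 \<le> t" for t
  proof (cases "t \<le> 1")
    case True
    have "(1 + t) ^ m * exp (- (\<nu> * t powr s)) \<le> 2 ^ m * 1"
      using t True \<nu> by (intro mult_mono power_mono) auto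
    also have "\<dots> \<le> K" unfolding K_def using nn by (intro mult_left_mono) auto
    finally show ?thesis .
  next
    case False
    let ?u = "t powr s"
    have u: "0 < ?u" using False by simp
    have "t ^ m = t powr real m" using False by (simp add: powr_realpow)
    also have "\<dots> \<le> t powr (s * real n)" using False n by (intro powr_mono) auto
    also have "\<dots> = ?u ^ n" using False by (simp add: powr_powr[symmetric] powr_realpow)
    finally have tm: "t ^ m \<le> ?u ^ n" .
    have "(\<nu> * ?u / n) ^ n \<le> (1 + \<nu> * ?u / n) ^ n" using \<nu> u by (intro power_mono) auto
    also have "\<dots> \<le> exp (\<nu> * ?u)"
      using \<nu> u n0 by (intro exp_ge_one_plus_x_over_n_power_n) (auto intro: order_trans[of _ 0])
    finally have "(real n / \<nu>) ^ n * (\<nu> * ?u / n) ^ n \<le> (real n / \<nu>) ^ n * exp (\<nu> * ?u)"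
      using nn by (rule mult_left_mono)
    then have un: "?u ^ n \<le> (real n / \<nu>) ^ n * exp (\<nu> * ?u)"
      using \<nu> n0 by (simp add: power_mult_distrib[symmetric])
    have "(1 + t) ^ m \<le> (2 * t) ^ m" using False by (intro power_mono) auto
    also have "\<dots> = 2 ^ m * t ^ m" by (simp add: power_mult_distrib)
    also have "\<dots> \<le> 2 ^ m * ((real n / \<nu>) ^ n * exp (\<nu> * ?u))" using tm un by (intro mult_left_mono) auto
    also have "\<dots> \<le> K * exp (\<nu> * ?u)" unfolding K_def by (simp add: algebra_simps)
    finally show ?thesis by (simp add: exp_minus divide_simps)
  qed
  then have "exp (- \<nu> * t powr s) \<le> K / (1 + t) ^ m" if "0 \<le> t" for t
    using that by (simp add: pos_le_divide_eq mult.commute)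
  then show ?thesis using K by blast
qed

context homogeneous_type
begin

text \<open>The Hoelder bound is freed from the restriction to \<open>d x y \<le> R\<close>: beyond
  it the factor \<open>(d x y / R) powr \<eta>\<close> is at least 1, and the size bounds at x and
  at y suffice. This is why the weights of both points appear.\<close>

lemma wavelet_bounds_decay:
  fixes \<nu> s K0 :: real
  assumes \<nu>: "0 < \<nu>" and s: "0 < s" and K0: "0 < K0" and \<eta>: "0 \<le> \<eta>"
  shows "\<exists>K\<ge>1. \<forall>p w. \<forall>R>0. wavelet_bounds M d s \<eta> \<nu> K0 p R w \<longrightarrow>
    (\<forall>x. \<bar>w x\<bar> \<le> K * vol p R powr (-1/2) / rdist R x p ^ m) \<and>
    (\<forall>x y. \<bar>w x - w y\<bar> \<le> K * vol p R powr (-1/2) * (d x y / R) powr \<eta> *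
      (1 / rdist R x p ^ m + 1 / rdist R y p ^ m))"
proof -
  obtain E where E: "1 \<le> E" "\<And>t. 0 \<le> t \<Longrightarrow> exp (- \<nu> * t powr s) \<le> E / (1 + t) ^ m"
    using exp_powr_le_power[OF \<nu> s, of m] by blast
  define K where "K = max 1 (K0 * E)"
  have K: "1 \<le> K" "K0 * E \<le> K" by (auto simp: K_def)
  have "(\<forall>x. \<bar>w x\<bar> \<le> K * vol p R powr (-1/2) / rdist R x p ^ m) \<and>
    (\<forall>x y. \<bar>w x - w y\<bar> \<le> K * vol p R powr (-1/2) * (d x y / R) powr \<eta> *
      (1 / rdist R x p ^ m + 1 / rdist R y p ^ m))"
    if R: "0 < R" and w: "wavelet_bounds M d s \<eta> \<nu> K0 p R w" for p w R
  proof -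
    let ?V = "vol p R powr (-1/2)"
    have r: "0 < rdist R x p ^ m" for x using rdist_pos[OF R] by simp
    have exp_le: "c * exp (- \<nu> * (d x p / R) powr s) \<le> c * (E / rdist R x p ^ m)" if "0 \<le> c" for c x
      using E(2)[of "d x p / R"] d_nonneg R that by (intro mult_left_mono) (auto simp: rdist_def)
    have KE: "c * (E / b) * K0 \<le> K * c / b" if "0 \<le> c" "0 < b" for b c
    proof -
      have "K0 * E * c \<le> K * c" using K that by (intro mult_right_mono) auto
      then show ?thesis using that by (simp add: divide_simps mult_ac)
    qed
    have size: "\<bar>w x\<bar> \<le> K * ?V / rdist R x p ^ m" for x
    proof -
      have "\<bar>w x\<bar> \<le> K0 * ?V * exp (- \<nu> * (d x p / R) powr s)"
        using w by (simp add: wavelet_bounds_def vol_def)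
      also have "\<dots> \<le> K0 * ?V * (E / rdist R x p ^ m)" using K0 by (intro exp_le) simp
      also have "\<dots> \<le> K * ?V / rdist R x p ^ m" using KE[of ?V "rdist R x p ^ m"] r by (simp add: mult_ac)
      finally show ?thesis .
    qed
    have "\<bar>w x - w y\<bar> \<le> K * ?V * (d x y / R) powr \<eta> * (1 / rdist R x p ^ m + 1 / rdist R y p ^ m)"
      for x y
    proof (cases "d x y \<le> R")
      case True
      let ?h = "(d x y / R) powr \<eta>"
      have "\<bar>w x - w y\<bar> \<le> K0 * ?V * ?h * exp (- \<nu> * (d x p / R) powr s)"
        using w True by (simp add: wavelet_bounds_def vol_def)
      also have "\<dots> \<le> K0 * ?V * ?h * (E / rdist R x p ^ m)" using K0 by (intro exp_le) simp
      also have "\<dots> \<le> K * (?V * ?h) / rdist R x p ^ m"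
        using KE[of "?V * ?h" "rdist R x p ^ m"] r by (simp add: mult_ac)
      also have "\<dots> \<le> K * ?V * ?h * (1 / rdist R x p ^ m + 1 / rdist R y p ^ m)"
        using K r[of y] by (simp add: distrib_left mult.assoc)
      finally show ?thesis .
    next
      case False
      have h: "1 \<le> (d x y / R) powr \<eta>" using False R \<eta> by (intro ge_one_powr_ge_zero) auto
      have "\<bar>w x - w y\<bar> \<le> K * ?V / rdist R x p ^ m + K * ?V / rdist R y p ^ m"
        using size[of x] size[of y] by linarith
      also have "\<dots> = K * ?V * 1 * (1 / rdist R x p ^ m + 1 / rdist R y p ^ m)"
        by (simp add: distrib_left)
      also have "\<dots> \<le> K * ?V * (d x y / R) powr \<eta> * (1 / rdist R x p ^ m + 1 / rdist R y p ^ m)"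
        using h K r[of x] r[of y] by (intro mult_right_mono mult_left_mono) auto
      finally show ?thesis .
    qed
    then show ?thesis using size by blast
  qed
  then show ?thesis using K by blast
qed

end

section \<open>Coefficients of Lipschitz functions and sums of wavelets\<close>

context wavelet_system
begin

abbreviation wv :: "int \<times> 'i + int \<times> 'i \<Rightarrow> 'a \<Rightarrow> real" where
  "wv \<equiv> wavelet \<phi> \<psi>"

abbreviation jscale :: "int \<times> 'i + int \<times> 'i \<Rightarrow> real" where
  "jscale j \<equiv> scale (level j)"

abbreviation jvol :: "int \<times> 'i + int \<times> 'i \<Rightarrow> real" where
  "jvol j \<equiv> vol (cen j) (jscale j)"

abbreviation cwv :: "int \<times> 'i + int \<times> 'i \<Rightarrow> 'a \<Rightarrow> complex" where
  "cwv j x \<equiv> complex_of_real (wv j x)"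

abbreviation coef :: "('a \<Rightarrow> complex) \<Rightarrow> int \<times> 'i + int \<times> 'i \<Rightarrow> complex" where
  "coef f j \<equiv> pairing M f (wv j)"

abbreviation coef_bound :: "real \<Rightarrow> real \<Rightarrow> (int \<times> 'i + int \<times> 'i \<Rightarrow> complex) \<Rightarrow> bool" where
  "coef_bound \<theta> N c \<equiv> \<forall>j\<in>J0. cmod (c j) \<le> N * jvol j powr (1/2 + \<theta>)"

abbreviation star :: "real \<Rightarrow> ('a \<Rightarrow> complex) \<Rightarrow> ennreal" where
  "star \<equiv> star_norm M A pt Q \<phi> \<psi>"

abbreviation expands :: "('a \<Rightarrow> complex) \<Rightarrow> bool" where
  "expands \<equiv> wavelet_expansion M d A pt \<phi> \<psi>"

lemma wavelet_bounds_wv: "j \<in> J0 \<Longrightarrow> wavelet_bounds M d s \<eta> \<nu> C (cen j) (jscale j) (wv j)"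
  using \<phi>_bounds[of _ 0] \<psi>_bounds by (auto elim!: J0_cases simp: scale_def)

lemma L2_wv: "j \<in> J0 \<Longrightarrow> L2 M (wv j)"
  using orthonormal_basis[of 0] by (auto simp: orthonormal_basis_L2_def)

lemma wv_measurable [measurable]: "j \<in> J0 \<Longrightarrow> wv j \<in> borel_measurable M"
  using L2_wv by (auto simp: L2_def)

lemma wv_decay:
  "\<exists>K\<ge>1. (\<forall>j\<in>J0. \<forall>x. \<bar>wv j x\<bar> \<le> K * jvol j powr (-1/2) / ldist (level j) x j ^ m) \<and>
    (\<forall>j\<in>J0. \<forall>x y. \<bar>wv j x - wv j y\<bar> \<le> K * jvol j powr (-1/2) * (d x y / jscale j) powr \<eta> *
      (1 / ldist (level j) x j ^ m + 1 / ldist (level j) y j ^ m))"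
  using wavelet_bounds_decay[OF \<nu>_pos s_pos C_pos less_imp_le[OF \<eta>_pos], of m]
    wavelet_bounds_wv scale_pos by meson

text \<open>The normalisation \<open>V powr (-1/2)\<close> of the wavelet, the growth
  \<open>V powr \<theta>\<close> of g and the mass V at the scale of the wavelet multiply to
  \<open>V powr (1/2 + \<theta>)\<close>. Of the decay exponent n + m, n absorbs the growth of g and
  m leaves an integrable weight.\<close>

lemma lip_coefficients:
  assumes \<theta>: "0 < \<theta>"
  shows "\<exists>K\<ge>1. \<forall>N g. 0 \<le> N \<longrightarrow> g \<in> borel_measurable M \<longrightarrow> lip_bound \<theta> N g \<longrightarrow> (\<forall>j\<in>J0.
    pairing_converges M g (wv j) \<and> cmod (coef g j) \<le> K * N * jvol j powr (1/2 + \<theta>))"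
proof -
  obtain Kg n where Kg: "1 \<le> Kg" "\<And>N g p x R. 0 < R \<Longrightarrow> 0 \<le> N \<Longrightarrow> lip_bound \<theta> N g \<Longrightarrow>
    cmod (g x - g p) \<le> Kg * N * rdist R x p ^ n * vol p R powr \<theta> \<and>
    (1 \<le> R \<longrightarrow> cmod (g x) \<le> Kg * N * rdist R x p ^ n * vol p R powr \<theta>)"
    using lip_bound_growth[OF \<theta>] by blast
  define m where "m = Suc hdim"
  have m: "hdim < m" by (simp add: m_def)
  obtain Kw where Kw: "1 \<le> Kw"
      "\<And>j x. j \<in> J0 \<Longrightarrow> \<bar>wv j x\<bar> \<le> Kw * jvol j powr (-1/2) / ldist (level j) x j ^ (n + m)"
    using wv_decay[of "n + m"] by blast
  define K where "K = Kg * Kw * 2 ^ Suc m"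
  have "1 \<le> Kg * Kw" using mult_mono[of 1 Kg 1 Kw] Kg(1) Kw(1) by auto
  then have K: "1 \<le> K" unfolding K_def
    using mult_mono[of 1 "Kg * Kw" 1 "2 ^ Suc m"] one_le_power[of "2::real" "Suc m"] by auto
  have "pairing_converges M g (wv j) \<and> cmod (coef g j) \<le> K * N * jvol j powr (1/2 + \<theta>)"
    if N: "0 \<le> N" and g [measurable]: "g \<in> borel_measurable M" and b: "lip_bound \<theta> N g" and j: "j \<in> J0" for N g j
  proof -
    let ?p = "cen j" and ?R = "jscale j" and ?V = "jvol j"
    have R: "0 < ?R" by (rule scale_pos)
    have V: "0 < ?V" by (rule vol_pos[OF R])
    note [measurable] = wv_measurable[OF j]
    have key: "integrable M h" "cmod (integral\<^sup>L M h) \<le> K * N * ?V powr (1/2 + \<theta>)"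
      if h: "\<And>x. h x = u x * cwv j x" and u [measurable]: "u \<in> borel_measurable M"
        and le: "\<And>x. cmod (u x) \<le> Kg * N * rdist ?R x ?p ^ n * ?V powr \<theta>" for u h
    proof -
      have hle: "cmod (h x) \<le> Kg * Kw * N * ?V powr (\<theta> - 1/2) / rdist ?R x ?p ^ m" for x
      proof -
        have r: "0 < rdist ?R x ?p" by (rule rdist_pos[OF R])
        have "cmod (h x) = cmod (u x) * \<bar>wv j x\<bar>" by (simp add: h norm_mult)
        also have "\<dots> \<le> (Kg * N * rdist ?R x ?p ^ n * ?V powr \<theta>) * (Kw * ?V powr (-1/2) / rdist ?R x ?p ^ (n + m))"
          using Kg(1) N r by (intro mult_mono le Kw(2) j) auto
        also have "\<dots> = Kg * Kw * N * (?V powr \<theta> * ?V powr (-1/2)) / rdist ?R x ?p ^ m"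
          using r by (simp add: power_add)
        also have "?V powr \<theta> * ?V powr (-1/2) = ?V powr (\<theta> - 1/2)"
          by (simp add: powr_add[symmetric])
        finally show ?thesis .
      qed
      have hm: "h \<in> borel_measurable M" unfolding h by measurable
      show "integrable M h" by (rule integrable_of_decay[OF hm R m hle])
      have "cmod (integral\<^sup>L M h) \<le> Kg * Kw * N * ?V powr (\<theta> - 1/2) * (2 ^ Suc m * ?V)"
        by (rule integrable_of_decay[OF hm R m hle])
      also have "\<dots> = K * N * (?V powr (\<theta> - 1/2) * ?V powr 1)" using V by (simp add: K_def)
      also have "?V powr (\<theta> - 1/2) * ?V powr 1 = ?V powr (1/2 + \<theta>)"
        by (simp only: powr_add[symmetric]) simp
      finally show "cmod (integral\<^sup>L M h) \<le> K * N * ?V powr (1/2 + \<theta>)" .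
    qed
    show ?thesis
      using j
    proof (cases rule: J0_cases)
      case (Inl \<alpha>)
      \<comment> \<open>\<phi> comes without cancellation, but only at scale 1, where g itself
        satisfies the bound that its differences satisfy at finer scales.\<close>
      then have "1 \<le> ?R" by simp
      then have "cmod (g x) \<le> Kg * N * rdist ?R x ?p ^ n * ?V powr \<theta>" for x
        using Kg(2)[OF R N b] by blast
      from key[OF refl g this] show ?thesis by (simp add: pairing_converges_def pairing_def)
    next
      case (Inr k \<beta>)
      have w0: "has_bochner_integral M (wv j) 0" using \<psi>_cancellation[OF Inr(3)] Inr(1) by simp
      \<comment> \<open>\<psi> has integral zero, so subtracting the constant \<open>g ?p\<close>
        leaves the coefficient unchanged.\<close>
      then have wi: "has_bochner_integral M (\<lambda>x. g ?p * cwv j x) (g ?p * complex_of_real 0)"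
        by (intro has_bochner_integral_mult_right has_bochner_integral_of_real)
      have "cmod (g x - g ?p) \<le> Kg * N * rdist ?R x ?p ^ n * ?V powr \<theta>" for x
        using Kg(2)[OF R N b] by blast
      note k = key[OF refl _ this, simplified]
      have "has_bochner_integral M (\<lambda>x. (g x - g ?p) * cwv j x + g ?p * cwv j x)
          ((LINT x|M. (g x - g ?p) * cwv j x) + g ?p * complex_of_real 0)"
        using k(1) by (intro has_bochner_integral_add wi has_bochner_integral_integrable) auto
      then have "has_bochner_integral M (\<lambda>x. g x * cwv j x)
          (LINT x|M. (g x - g ?p) * cwv j x)"
        by (simp add: algebra_simps)
      then show ?thesis using k(2)
        by (auto simp: pairing_converges_def pairing_def has_bochner_integral_iff)
    qed
  qed
  then show ?thesis using K by blast
qed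

lemma synthesis_term_le:
  assumes c: "cmod c \<le> N * jvol j powr (1/2 + \<theta>)" and N: "0 \<le> N" and u: "u \<le> K * jvol j powr (-1/2) * r"
    and K: "0 \<le> K" and r: "0 \<le> r" "0 \<le> u"
  shows "cmod c * u \<le> K * N * (jvol j powr \<theta> * r)"
proof -
  have "cmod c * u \<le> (N * jvol j powr (1/2 + \<theta>)) * (K * jvol j powr (-1/2) * r)"
    using assms by (intro mult_mono) auto
  also have "\<dots> = K * N * ((jvol j powr (1/2 + \<theta>) * jvol j powr (-1/2)) * r)" by simp
  also have "jvol j powr (1/2 + \<theta>) * jvol j powr (-1/2) = jvol j powr \<theta>"
    by (simp add: powr_add[symmetric])
  finally show ?thesis .
qed

text \<open>Coefficient bound and normalisation leave \<open>jvol j powr \<theta>\<close> in each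
  term, which is \<open>high_level_sum\<close> with exponent \<theta>.\<close>

lemma synthesis_high:
  assumes \<theta>: "0 < \<theta>"
  shows "\<exists>K\<ge>1. \<forall>N c F k x. 0 \<le> N \<longrightarrow> finite F \<longrightarrow> F \<subseteq> J0 \<longrightarrow>
    coef_bound \<theta> N c \<longrightarrow> 0 \<le> k \<longrightarrow> (\<forall>j\<in>F. k \<le> level j) \<longrightarrow>
    (\<Sum>j\<in>F. cmod (c j) * \<bar>wv j x\<bar>) \<le> K * N * vol x (scale k) powr \<theta>"
proof -
  obtain K n where K: "1 \<le> K" "\<And>k x F. finite F \<Longrightarrow> F \<subseteq> J0 \<Longrightarrow> \<forall>j\<in>F. k \<le> level j \<Longrightarrow> 0 \<le> k \<Longrightarrow>
    (\<Sum>j\<in>F. jvol j powr \<theta> / ldist (level j) x j ^ n) \<le> K * vol x (scale k) powr \<theta>"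
    using high_level_sum[OF \<theta>] by blast
  obtain Kw where Kw: "1 \<le> Kw"
      "\<And>j x. j \<in> J0 \<Longrightarrow> \<bar>wv j x\<bar> \<le> Kw * jvol j powr (-1/2) / ldist (level j) x j ^ n"
    using wv_decay[of n] by blast
  have "(\<Sum>j\<in>F. cmod (c j) * \<bar>wv j x\<bar>) \<le> Kw * K * N * vol x (scale k) powr \<theta>"
    if N: "0 \<le> N" and F: "finite F" "F \<subseteq> J0" and c: "coef_bound \<theta> N c"
      and k: "0 \<le> k" "\<forall>j\<in>F. k \<le> level j" for N c F k x
  proof -
    have "(\<Sum>j\<in>F. cmod (c j) * \<bar>wv j x\<bar>) \<le> (\<Sum>j\<in>F. Kw * N * (jvol j powr \<theta> * (1 / ldist (level j) x j ^ n)))"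
      using F c N Kw rdist_pos[OF scale_pos]
      by (intro sum_mono synthesis_term_le) (auto simp: less_imp_le subset_iff)
    also have "\<dots> = Kw * N * (\<Sum>j\<in>F. jvol j powr \<theta> / ldist (level j) x j ^ n)"
      by (simp add: sum_distrib_left)
    also have "\<dots> \<le> Kw * N * (K * vol x (scale k) powr \<theta>)"
      using K(2)[OF F k(2,1)] Kw N by (intro mult_left_mono) auto
    finally show ?thesis by (simp add: mult_ac)
  qed
  moreover have "1 \<le> Kw * K" using mult_mono[of 1 Kw 1 K] K Kw by auto
  ultimately show ?thesis by blast
qed

text \<open>Levels are kept apart, because the gain \<open>(d x y / scale k) powr \<eta>\<close>
  depends on the level and is what later makes the sum over coarse levels geometric.\<close>

lemma synthesis_level:
  "\<exists>K\<ge>1. \<forall>N c F k x y. 0 \<le> N \<longrightarrow> finite F \<longrightarrow> F \<subseteq> J0 \<longrightarrow>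
    coef_bound \<theta> N c \<longrightarrow> (\<forall>j\<in>F. level j = k) \<longrightarrow>
    (\<Sum>j\<in>F. cmod (c j) * \<bar>wv j x - wv j y\<bar>)
      \<le> K * N * (d x y / scale k) powr \<eta> * (vol x (scale k) powr \<theta> + vol y (scale k) powr \<theta>)"
proof -
  obtain K n where K: "1 \<le> K" "\<And>k x F. finite F \<Longrightarrow> F \<subseteq> J0 \<Longrightarrow> \<forall>j\<in>F. level j = k \<Longrightarrow>
    (\<Sum>j\<in>F. vol (cen j) (scale k) powr \<theta> / ldist k x j ^ n) \<le> K * vol x (scale k) powr \<theta>"
    using level_sum by blast
  obtain Kw where Kw: "1 \<le> Kw"
      "\<And>j x y. j \<in> J0 \<Longrightarrow> \<bar>wv j x - wv j y\<bar> \<le> Kw * jvol j powr (-1/2) * (d x y / jscale j) powr \<eta> *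
      (1 / ldist (level j) x j ^ n + 1 / ldist (level j) y j ^ n)"
    using wv_decay[of n] by blast
  have "(\<Sum>j\<in>F. cmod (c j) * \<bar>wv j x - wv j y\<bar>)
      \<le> Kw * K * N * (d x y / scale k) powr \<eta> * (vol x (scale k) powr \<theta> + vol y (scale k) powr \<theta>)"
    if N: "0 \<le> N" and F: "finite F" "F \<subseteq> J0" and c: "coef_bound \<theta> N c"
      and k: "\<forall>j\<in>F. level j = k" for N c F k x y
  proof -
    let ?h = "(d x y / scale k) powr \<eta>"
    let ?r = "\<lambda>x j. vol (cen j) (scale k) powr \<theta> / ldist k x j ^ n"
    have "cmod (c j) * \<bar>wv j x - wv j y\<bar> \<le> Kw * N * ?h * (?r x j + ?r y j)" if j: "j \<in> F" for j
    proof -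
      have "cmod (c j) * \<bar>wv j x - wv j y\<bar> \<le> Kw * N * (jvol j powr \<theta> *
          (?h * (1 / ldist (level j) x j ^ n + 1 / ldist (level j) y j ^ n)))"
        using j F c N Kw(1) Kw(2)[of j x y] k rdist_pos[OF scale_pos]
        by (intro synthesis_term_le) (auto simp: less_imp_le subset_iff mult.assoc)
      then show ?thesis using k j by (simp add: algebra_simps)
    qed
    then have "(\<Sum>j\<in>F. cmod (c j) * \<bar>wv j x - wv j y\<bar>) \<le> (\<Sum>j\<in>F. Kw * N * ?h * (?r x j + ?r y j))"
      by (rule sum_mono)
    also have "\<dots> = Kw * N * ?h * ((\<Sum>j\<in>F. ?r x j) + (\<Sum>j\<in>F. ?r y j))"
      by (simp only: sum_distrib_left[symmetric] sum.distrib)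
    also have "\<dots> \<le> Kw * N * ?h * (K * vol x (scale k) powr \<theta> + K * vol y (scale k) powr \<theta>)"
      using K(2)[OF F k] Kw N by (intro mult_left_mono add_mono) auto
    finally show ?thesis by (simp add: algebra_simps)
  qed
  moreover have "1 \<le> Kw * K" using mult_mono[of 1 Kw 1 K] K Kw by auto
  ultimately show ?thesis by blast
qed

end

section \<open>Synthesis\<close>

lemma sum_geometric_int_le:
  fixes q :: real
  assumes q: "0 < q" "q < 1" and L: "finite L" "\<And>k. k \<in> L \<Longrightarrow> k \<le> (k0::int)"
  shows "(\<Sum>k\<in>L. q ^ nat (k0 - k)) \<le> 1 / (1 - q)"
proof -
  have inj: "inj_on (\<lambda>k. nat (k0 - k)) L"
  proof (rule inj_onI)
    fix x y assume "x \<in> L" "y \<in> L" "nat (k0 - x) = nat (k0 - y)"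
    then show "x = y" using L(2)[of x] L(2)[of y] by simp
  qed
  have "(\<Sum>k\<in>L. q ^ nat (k0 - k)) = (\<Sum>n\<in>(\<lambda>k. nat (k0 - k)) ` L. q ^ n)"
    by (subst sum.reindex[OF inj]) simp
  also have "\<dots> \<le> (\<Sum>n. q ^ n)"
    using q L by (intro sum_le_suminf summable_geometric) auto
  also have "\<dots> = 1 / (1 - q)" using q by (simp add: suminf_geometric)
  finally show ?thesis .
qed

text \<open>A sequence that is eventually above every finite subset: it makes sequential results,
  such as measurability of limits and Fatou's lemma, available for unconditional sums.\<close>

lemma countable_finite_exhaustion:
  assumes "countable J"
  obtains F :: "nat \<Rightarrow> 'j set" where "filterlim F (finite_subsets_at_top J) sequentially"
    "\<And>n. finite (F n)" "\<And>n. F n \<subseteq> J"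
proof (cases "J = {}")
  case True
  then show thesis
    by (intro that[of "\<lambda>_. {}"]) (auto simp: filterlim_finite_subsets_at_top)
next
  case False
  let ?F = "\<lambda>n. from_nat_into J ` {..n}"
  have ran: "from_nat_into J ` S \<subseteq> J" for S using from_nat_into[OF False] by auto
  have "filterlim ?F (finite_subsets_at_top J) sequentially"
    unfolding filterlim_finite_subsets_at_top
  proof (intro allI impI)
    fix X assume X: "finite X \<and> X \<subseteq> J"
    obtain N where N: "\<And>x. x \<in> X \<Longrightarrow> to_nat_on J x \<le> N"
      using X finite_nat_set_iff_bounded_le[of "to_nat_on J ` X"] by auto
    have "X \<subseteq> ?F n" if "N \<le> n" for n
    proof
      fix x assume x: "x \<in> X"
      then have "x = from_nat_into J (to_nat_on J x)" using X assms by (auto simp: from_nat_into_to_nat_on)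
      then show "x \<in> ?F n" using N[OF x] that by (intro image_eqI[of _ _ "to_nat_on J x"]) auto
    qed
    then show "\<forall>\<^sub>F n in sequentially. finite (?F n) \<and> X \<subseteq> ?F n \<and> ?F n \<subseteq> J"
      using ran by (auto simp: eventually_at_top_linorder intro!: exI[of _ N])
  qed
  then show thesis using ran by (intro that[of ?F]) auto
qed

context homogeneous_type
begin

text \<open>Here the exponent must be exactly \<omega>\<theta>, not its rounded version, since it is
  weighed against \<eta>.\<close>

lemma vol_ball_compare:
  assumes \<theta>: "0 < \<theta>"
  shows "\<exists>K\<ge>1. \<forall>x z r R. 0 < r \<longrightarrow> r \<le> R \<longrightarrow> x \<in> qball d z r \<longrightarrow>
    vol x R powr \<theta> \<le> K * (R / r) powr (upper_dim M d * \<theta>) * vol z r powr \<theta>"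
proof -
  let ?w = "upper_dim M d"
  define K where "K = (dconst * (2 * A0) powr ?w) powr \<theta>"
  have "1 \<le> (2 * A0) powr ?w" using A0_ge_1 upper_dim_nonneg by (intro ge_one_powr_ge_zero) auto
  then have "1 \<le> dconst * (2 * A0) powr ?w" using mult_mono[of 1 dconst 1 "(2 * A0) powr ?w"] dconst_ge_1 by simp
  then have K: "1 \<le> K" unfolding K_def using \<theta> by (intro ge_one_powr_ge_zero) auto
  have "vol x R powr \<theta> \<le> K * (R / r) powr (?w * \<theta>) * vol z r powr \<theta>"
    if r: "0 < r" "r \<le> R" and x: "x \<in> qball d z r" for x z r R
  proof -
    have Rr: "1 \<le> R / r" using r by simp
    have a: "1 \<le> 2 * A0 * (R / r)" using mult_mono[of 1 "2 * A0" 1 "R / r"] A0_ge_1 Rr by auto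
    have "A0 * (d z x + R) \<le> A0 * (2 * R)" using x r A0_ge_1 by (intro mult_left_mono) (auto simp: qball_iff)
    also have "\<dots> = 2 * A0 * (R / r) * r" using r by simp
    finally have "vol x R \<le> dconst * (2 * A0 * (R / r)) powr ?w * vol z r"
      using a r by (intro vol_compare_scale) auto
    then have "vol x R powr \<theta> \<le> (dconst * (2 * A0 * (R / r)) powr ?w * vol z r) powr \<theta>"
      using \<theta> by (intro powr_mono2) auto
    also have "\<dots> = (dconst * (2 * A0) powr ?w * (R / r) powr ?w * vol z r) powr \<theta>"
      using A0_ge_1 Rr by (subst powr_mult) (auto simp: mult_ac)
    also have "\<dots> = K * (R / r) powr (?w * \<theta>) * vol z r powr \<theta>"
      using dconst_ge_1 Rr by (simp only: K_def powr_mult powr_powr)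
    finally show ?thesis .
  qed
  then show ?thesis using K by blast
qed

lemma lip_bound_limit:
  assumes b: "\<forall>\<^sub>F n in Fl. lip_bound \<theta> N (g n)" and lim: "\<And>x. ((\<lambda>n. g n x) \<longlongrightarrow> h x) Fl"
    and nb: "Fl \<noteq> bot"
  shows "lip_bound \<theta> N h"
  unfolding lip_bound_def
proof (intro allI impI conjI ballI)
  fix z x y and r :: real assume r: "0 < r" and xy: "x \<in> qball d z r" "y \<in> qball d z r"
  have ev: "\<forall>\<^sub>F n in Fl. cmod (g n x - g n y) \<le> N * vol z r powr \<theta>"
    using b lip_boundD(1)[OF _ r xy] by (auto elim: eventually_mono)
  show "cmod (h x - h y) \<le> N * vol z r powr \<theta>"
    by (rule tendsto_upperbound[OF _ ev nb]) (intro tendsto_norm tendsto_diff lim)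
next
  fix z x and r :: real assume r: "0 < r" "1 < r" and x: "x \<in> qball d z r"
  have ev: "\<forall>\<^sub>F n in Fl. cmod (g n x) \<le> N * vol z r powr \<theta>"
    using b lip_boundD(2)[OF _ r x] by (auto elim: eventually_mono)
  show "cmod (h x) \<le> N * vol z r powr \<theta>"
    by (rule tendsto_upperbound[OF _ ev nb]) (intro tendsto_norm lim)
qed

end

context dyadic_system
begin

lemma scale_bracket:
  assumes "0 < r" "r \<le> 1"
  obtains k where "0 \<le> k" "r \<le> scale k" "scale (k + 1) < r"
proof -
  have ex: "\<exists>n. \<delta> ^ n < r" using assms \<delta>_pos \<delta>_less_1 by (intro real_arch_pow_inv) auto
  define n where "n = (LEAST n. \<delta> ^ n < r)"
  have n: "\<delta> ^ n < r" unfolding n_def using ex by (rule LeastI_ex)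
  have "n \<noteq> 0" using n assms by (intro notI) simp
  then obtain m where m: "n = Suc m" by (cases n) auto
  have "\<not> \<delta> ^ m < r" using not_less_Least[of m] m unfolding n_def by (metis lessI n_def not_less_Least)
  then show thesis
    using n m scale_add_nat[of 0 m] scale_Suc[of "int m"] by (intro that[of "int m"]) auto
qed

lemma countable_J0: "countable J0"
proof -
  have "countable (new_index A pt k)" for k
    using countable_subset[OF _ countable_A[of "k + 1"]] new_index_subset by blast
  then show ?thesis
    unfolding wavelet_index_def by (intro countable_Plus countable_SIGMA countable_A) auto
qed

end

context wavelet_system
begin

text \<open>Levels finer than the distance of the points are summed by size, coarser ones by
  smoothness; the latter gives a geometric series with ratio \<open>\<delta>\<close> to the power \<open>\<eta> - \<omega>\<theta>\<close>.\<close>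

lemma synthesis_lip_bound:
  assumes \<theta>: "0 < \<theta>" "\<theta> < \<eta> / upper_dim M d"
  shows "\<exists>K\<ge>1. \<forall>N c F. 0 \<le> N \<longrightarrow> coef_bound \<theta> N c \<longrightarrow>
    finite F \<longrightarrow> F \<subseteq> J0 \<longrightarrow> lip_bound \<theta> (K * N) (\<lambda>x. \<Sum>j\<in>F. c j * cwv j x)"
proof -
  let ?w = "upper_dim M d"
  \<comment> \<open>Division by zero yields 0, so for \<omega> = 0 the hypothesis would read
    \<theta> < 0.\<close>
  have "?w \<noteq> 0" using \<theta> by (intro notI) simp
  then have w: "0 < ?w" using upper_dim_nonneg by simp
  define \<epsilon> where "\<epsilon> = \<eta> - ?w * \<theta>"
  have \<epsilon>: "0 < \<epsilon>" using \<theta>(2) w by (simp add: \<epsilon>_def pos_less_divide_eq mult.commute)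
  define q where "q = \<delta> powr \<epsilon>"
  have q: "0 < q" "q < 1"
    using \<delta>_pos \<delta>_less_1 \<epsilon> powr_less_mono2[of \<epsilon> \<delta> 1] by (auto simp: q_def)
  obtain Kh where Kh: "1 \<le> Kh" "\<And>N c F k x. 0 \<le> N \<Longrightarrow> finite F \<Longrightarrow> F \<subseteq> J0 \<Longrightarrow>
    coef_bound \<theta> N c \<Longrightarrow> 0 \<le> k \<Longrightarrow> \<forall>j\<in>F. k \<le> level j \<Longrightarrow>
    (\<Sum>j\<in>F. cmod (c j) * \<bar>wv j x\<bar>) \<le> Kh * N * vol x (scale k) powr \<theta>"
    using synthesis_high[OF \<theta>(1)] by blast
  obtain Kl where Kl: "1 \<le> Kl" "\<And>N c F k x y. 0 \<le> N \<Longrightarrow> finite F \<Longrightarrow> F \<subseteq> J0 \<Longrightarrow>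
    coef_bound \<theta> N c \<Longrightarrow> \<forall>j\<in>F. level j = k \<Longrightarrow>
    (\<Sum>j\<in>F. cmod (c j) * \<bar>wv j x - wv j y\<bar>)
      \<le> Kl * N * (d x y / scale k) powr \<eta> * (vol x (scale k) powr \<theta> + vol y (scale k) powr \<theta>)"
    using synthesis_level by blast
  obtain Kv where Kv: "1 \<le> Kv" "\<And>x z r R. 0 < r \<Longrightarrow> r \<le> R \<Longrightarrow> x \<in> qball d z r \<Longrightarrow>
    vol x R powr \<theta> \<le> Kv * (R / r) powr (?w * \<theta>) * vol z r powr \<theta>"
    using vol_ball_compare[OF \<theta>(1)] by blast
  \<comment> \<open>H serves the fine levels: the bracketing scale is at most r / \<delta>, hence
    the power of 1 / \<delta>. G serves the coarse ones: \<open>d x y \<le> 2 * A0 * r\<close>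
    within a ball, and the volumes at x and y both count.\<close>
  define H where "H = Kh * (Kv * (1 / \<delta>) powr (?w * \<theta>))"
  define G where "G = Kl * (2 * A0) powr \<eta> * (2 * Kv)"
  define K where "K = 2 * Kh * Kv + 2 * H + G / (1 - q)"
  have H0: "0 \<le> H" and G0: "0 \<le> G" using Kh Kl Kv by (auto simp: H_def G_def)
  have KhKv: "1 \<le> Kh * Kv" using mult_mono[of 1 Kh 1 Kv] Kh Kv by auto
  have Gq: "0 \<le> G / (1 - q)" using G0 q by simp
  have K: "1 \<le> K" "2 * (Kh * Kv) \<le> K" "2 * H + G / (1 - q) \<le> K"
    using KhKv H0 Gq by (auto simp: K_def)
  have "lip_bound \<theta> (K * N) (\<lambda>x. \<Sum>j\<in>F. c j * cwv j x)"
    if N: "0 \<le> N" and c: "coef_bound \<theta> N c"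
      and F: "finite F" "F \<subseteq> J0" for N c F
  proof -
    let ?S = "\<lambda>x. \<Sum>j\<in>F. c j * cwv j x"
    have big: "cmod (?S x) \<le> Kh * Kv * N * vol z r powr \<theta>" if r: "1 < r" and x: "x \<in> qball d z r" for x z r
    proof -
      have "cmod (?S x) \<le> (\<Sum>j\<in>F. cmod (c j) * \<bar>wv j x\<bar>)"
        by (rule order_trans[OF norm_sum]) (simp add: norm_mult)
      also have "\<dots> \<le> Kh * N * vol x (scale 0) powr \<theta>"
        using level_nonneg F by (intro Kh N c) auto
      also have "\<dots> \<le> Kh * N * (Kv * vol z r powr \<theta>)"
      proof (intro mult_left_mono)
        have "vol x (scale 0) powr \<theta> \<le> vol x r powr \<theta>" using r \<theta> by (intro powr_mono2 vol_mono) auto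
        also have "\<dots> \<le> Kv * vol z r powr \<theta>" using Kv(2)[of r r x z] r x by simp
        finally show "vol x (scale 0) powr \<theta> \<le> Kv * vol z r powr \<theta>" .
      qed (use Kh N in auto)
      finally show ?thesis by (simp add: mult_ac)
    qed
    have osc: "cmod (?S x - ?S y) \<le> (2 * H + G / (1 - q)) * N * vol z r powr \<theta>"
      if r: "0 < r" "r \<le> 1" and xy: "x \<in> qball d z r" "y \<in> qball d z r" for x y z r
    proof -
      let ?V = "vol z r powr \<theta>"
      obtain k0 where k0: "0 \<le> k0" "r \<le> scale k0" "scale (k0 + 1) < r" using scale_bracket[OF r] .
      define Fh where "Fh = {j\<in>F. k0 \<le> level j}"
      define Fl where "Fl = {j\<in>F. level j < k0}"
      have fin: "finite Fh" "finite Fl" using F by (auto simp: Fh_def Fl_def)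
      have "?S x - ?S y = (\<Sum>j\<in>F. c j * complex_of_real (wv j x - wv j y))"
        by (simp add: sum_subtractf[symmetric] right_diff_distrib)
      then have "cmod (?S x - ?S y) \<le> (\<Sum>j\<in>F. cmod (c j) * \<bar>wv j x - wv j y\<bar>)"
        using norm_sum[of "\<lambda>j. c j * complex_of_real (wv j x - wv j y)" F]
        by (simp add: norm_mult del: of_real_diff)
      also have "\<dots> = (\<Sum>j\<in>Fh. cmod (c j) * \<bar>wv j x - wv j y\<bar>) + (\<Sum>j\<in>Fl. cmod (c j) * \<bar>wv j x - wv j y\<bar>)"
      proof -
        have "F = Fh \<union> Fl" "Fh \<inter> Fl = {}" by (auto simp: Fh_def Fl_def)
        then show ?thesis using fin by (simp add: sum.union_disjoint)
      qed
      also have "(\<Sum>j\<in>Fh. cmod (c j) * \<bar>wv j x - wv j y\<bar>) \<le> 2 * H * N * ?V"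
      proof -
        have hi: "(\<Sum>j\<in>Fh. cmod (c j) * \<bar>wv j u\<bar>) \<le> H * N * ?V" if u: "u \<in> qball d z r" for u
        proof -
          have rk: "(scale k0 / r) powr (?w * \<theta>) \<le> (1 / \<delta>) powr (?w * \<theta>)"
          proof (rule powr_mono2)
            have "\<delta> * scale k0 < r" using k0(3) by (simp add: scale_Suc)
            then show "scale k0 / r \<le> 1 / \<delta>" using r \<delta>_pos by (simp add: divide_simps mult.commute)
          qed (use w \<theta> r scale_pos[of k0] in auto)
          have "(\<Sum>j\<in>Fh. cmod (c j) * \<bar>wv j u\<bar>) \<le> Kh * N * vol u (scale k0) powr \<theta>"
            using F k0 by (intro Kh N c) (auto simp: Fh_def)
          also have "\<dots> \<le> Kh * N * (Kv * (scale k0 / r) powr (?w * \<theta>) * ?V)"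
            using Kh N by (intro mult_left_mono Kv(2)[OF r(1) k0(2) u]) auto
          also have "\<dots> \<le> Kh * N * (Kv * (1 / \<delta>) powr (?w * \<theta>) * ?V)"
            using Kh N Kv rk by (intro mult_left_mono mult_right_mono) auto
          finally show ?thesis by (simp add: H_def mult_ac)
        qed
        have "(\<Sum>j\<in>Fh. cmod (c j) * \<bar>wv j x - wv j y\<bar>)
            \<le> (\<Sum>j\<in>Fh. cmod (c j) * \<bar>wv j x\<bar> + cmod (c j) * \<bar>wv j y\<bar>)"
          by (intro sum_mono) (auto simp: distrib_left[symmetric] intro!: mult_left_mono)
        also have "\<dots> \<le> H * N * ?V + H * N * ?V"
          unfolding sum.distrib using hi xy by (intro add_mono)
        finally show ?thesis by simp
      qed
      also have "(\<Sum>j\<in>Fl. cmod (c j) * \<bar>wv j x - wv j y\<bar>) \<le> G / (1 - q) * N * ?V"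
      proof -
        have lev: "(\<Sum>j\<in>{j\<in>Fl. level j = l}. cmod (c j) * \<bar>wv j x - wv j y\<bar>) \<le> G * N * ?V * q ^ nat (k0 - l)"
          if l: "l \<in> level ` Fl" for l
        proof -
          let ?R = "scale l"
          have lk: "l \<le> k0" using l by (auto simp: Fl_def)
          have R: "0 < ?R" by (rule scale_pos)
          have rR: "r \<le> ?R" using k0(2) scale_antimono[OF lk] by simp
          have dxy: "d x y \<le> 2 * A0 * r"
          proof -
            have "d x y \<le> A0 * (d x z + d z y)" by (rule quasi_triangle)
            also have "\<dots> \<le> A0 * (r + r)"
              using xy A0_ge_1 by (intro mult_left_mono add_mono) (auto simp: qball_iff d_sym[of x])
            finally show ?thesis by simp
          qed
          have h1: "(d x y / ?R) powr \<eta> \<le> (2 * A0) powr \<eta> * (r / ?R) powr \<eta>"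
          proof -
            have "(d x y / ?R) powr \<eta> \<le> (2 * A0 * (r / ?R)) powr \<eta>"
              using dxy R \<eta>_pos d_nonneg by (intro powr_mono2) (auto simp: divide_right_mono)
            then show ?thesis by (simp only: powr_mult)
          qed
          have h2: "vol u ?R powr \<theta> \<le> Kv * (?R / r) powr (?w * \<theta>) * ?V" if "u \<in> qball d z r" for u
            by (rule Kv(2)[OF r(1) rR that])
          have rq: "(r / ?R) powr \<eta> * (?R / r) powr (?w * \<theta>) \<le> q ^ nat (k0 - l)"
          proof -
            have "(?R / r) powr (?w * \<theta>) = (r / ?R) powr (- (?w * \<theta>))"
              using r R by (simp add: powr_minus powr_divide inverse_eq_divide)
            then have "(r / ?R) powr \<eta> * (?R / r) powr (?w * \<theta>) = (r / ?R) powr \<epsilon>"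
              by (simp add: powr_add[symmetric] \<epsilon>_def)
            also have "\<dots> \<le> (\<delta> ^ nat (k0 - l)) powr \<epsilon>"
            proof (rule powr_mono2)
              have "scale k0 = ?R * \<delta> ^ nat (k0 - l)" using scale_add_nat[of l "nat (k0 - l)"] lk by simp
              then show "r / ?R \<le> \<delta> ^ nat (k0 - l)" using k0(2) R by (simp add: divide_simps mult.commute)
            qed (use \<epsilon> r R in auto)
            also have "\<dots> = q ^ nat (k0 - l)"
              using \<delta>_pos by (simp add: q_def powr_powr powr_realpow[symmetric] mult.commute)
            finally show ?thesis .
          qed
          have "(\<Sum>j\<in>{j\<in>Fl. level j = l}. cmod (c j) * \<bar>wv j x - wv j y\<bar>)
              \<le> Kl * N * (d x y / ?R) powr \<eta> * (vol x ?R powr \<theta> + vol y ?R powr \<theta>)"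
            using F by (intro Kl N c) (auto simp: Fl_def)
          also have "\<dots> \<le> Kl * N * ((2 * A0) powr \<eta> * (r / ?R) powr \<eta>) *
              (Kv * (?R / r) powr (?w * \<theta>) * ?V + Kv * (?R / r) powr (?w * \<theta>) * ?V)"
            using Kl N h1 h2 xy by (intro mult_mono mult_left_mono add_mono) auto
          also have "\<dots> = G * N * ?V * ((r / ?R) powr \<eta> * (?R / r) powr (?w * \<theta>))"
            by (simp add: G_def algebra_simps)
          also have "\<dots> \<le> G * N * ?V * q ^ nat (k0 - l)" using rq G0 N by (intro mult_left_mono) auto
          finally show ?thesis .
        qed
        have "(\<Sum>j\<in>Fl. cmod (c j) * \<bar>wv j x - wv j y\<bar>)
            = (\<Sum>l\<in>level ` Fl. \<Sum>j\<in>{j\<in>Fl. level j = l}. cmod (c j) * \<bar>wv j x - wv j y\<bar>)"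
          using fin(2) by (rule sum.image_gen)
        also have "\<dots> \<le> (\<Sum>l\<in>level ` Fl. G * N * ?V * q ^ nat (k0 - l))" using lev by (rule sum_mono)
        also have "\<dots> = G * N * ?V * (\<Sum>l\<in>level ` Fl. q ^ nat (k0 - l))" by (simp add: sum_distrib_left)
        also have "\<dots> \<le> G * N * ?V * (1 / (1 - q))"
          using fin(2) G0 N by (intro mult_left_mono sum_geometric_int_le q) (auto simp: Fl_def)
        finally show ?thesis by simp
      qed
      finally show ?thesis by (simp add: algebra_simps)
    qed
    have up: "a * N * v \<le> K * N * v" if "a \<le> K" "0 \<le> v" for a v
      using that N by (intro mult_right_mono) auto
    have "cmod (?S x - ?S y) \<le> K * N * vol z r powr \<theta>"
      if r: "0 < r" and xy: "x \<in> qball d z r" "y \<in> qball d z r" for x y z r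
    proof (cases "r \<le> 1")
      case True
      then show ?thesis using osc[OF r True xy] up[OF K(3), of "vol z r powr \<theta>"] by simp
    next
      case False
      then have "cmod (?S x) + cmod (?S y) \<le> 2 * (Kh * Kv) * N * vol z r powr \<theta>"
        using big[of r x z] big[of r y z] xy by (simp add: mult.assoc)
      then show ?thesis
        using norm_triangle_ineq4[of "?S x" "?S y"] up[OF K(2) powr_ge_zero[of "vol z r" \<theta>]] by linarith
    qed
    moreover have "cmod (?S x) \<le> K * N * vol z r powr \<theta>" if r: "1 < r" and x: "x \<in> qball d z r" for x z r
    proof -
      have "Kh * Kv \<le> K" using K(2) KhKv by linarith
      then show ?thesis using big[OF r x] up[of "Kh * Kv" "vol z r powr \<theta>"] by simp
    qed
    ultimately show ?thesis by (simp add: lip_bound_def)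
  qed
  then show ?thesis using K(1) by blast
qed

text \<open>The Lipschitz bound is uniform over finite sums and closed under pointwise limits. The
  sum converges absolutely at every point by \<open>synthesis_high\<close> at level 0.\<close>

lemma synthesis:
  assumes \<theta>: "0 < \<theta>" "\<theta> < \<eta> / upper_dim M d"
  shows "\<exists>K\<ge>1. \<forall>N c. 0 \<le> N \<longrightarrow> coef_bound \<theta> N c \<longrightarrow>
    (\<exists>g\<in>borel_measurable M. lip_bound \<theta> (K * N) g \<and>
      (\<forall>x. ((\<lambda>j. c j * cwv j x) has_sum g x) J0))"
proof -
  obtain K where K: "1 \<le> K" "\<And>N c F. 0 \<le> N \<Longrightarrow> coef_bound \<theta> N c \<Longrightarrow>
    finite F \<Longrightarrow> F \<subseteq> J0 \<Longrightarrow> lip_bound \<theta> (K * N) (\<lambda>x. \<Sum>j\<in>F. c j * cwv j x)"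
    using synthesis_lip_bound[OF \<theta>] by blast
  obtain Kh where Kh: "1 \<le> Kh" "\<And>N c F k x. 0 \<le> N \<Longrightarrow> finite F \<Longrightarrow> F \<subseteq> J0 \<Longrightarrow>
    coef_bound \<theta> N c \<Longrightarrow> 0 \<le> k \<Longrightarrow> \<forall>j\<in>F. k \<le> level j \<Longrightarrow>
    (\<Sum>j\<in>F. cmod (c j) * \<bar>wv j x\<bar>) \<le> Kh * N * vol x (scale k) powr \<theta>"
    using synthesis_high[OF \<theta>(1)] by blast
  \<comment> \<open>Serves the measurability of the sum, which is a limit along a net.\<close>
  obtain Fn where Fn: "filterlim Fn (finite_subsets_at_top J0) sequentially"
    "\<And>n. finite (Fn n)" "\<And>n. Fn n \<subseteq> J0"
    using countable_finite_exhaustion[OF countable_J0] by blast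
  have "\<exists>g\<in>borel_measurable M. lip_bound \<theta> (K * N) g \<and>
      (\<forall>x. ((\<lambda>j. c j * cwv j x) has_sum g x) J0)"
    if N: "0 \<le> N" and c: "coef_bound \<theta> N c" for N c
  proof -
    let ?t = "\<lambda>x j. c j * cwv j x"
    define g where "g x = infsum (?t x) J0" for x
    have abs: "(\<lambda>j. norm (?t x j)) summable_on J0" for x
      unfolding abs_summable_iff_bdd_above
    proof (rule bdd_aboveI2)
      fix F assume "F \<in> {F. F \<subseteq> J0 \<and> finite F}"
      then have "(\<Sum>j\<in>F. cmod (c j) * \<bar>wv j x\<bar>) \<le> Kh * N * vol x (scale 0) powr \<theta>"
        using level_nonneg by (intro Kh N c) auto
      then show "(\<Sum>j\<in>F. norm (?t x j)) \<le> Kh * N * vol x (scale 0) powr \<theta>"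
        by (simp add: norm_mult)
    qed
    have hs: "(?t x has_sum g x) J0" for x
      unfolding g_def by (rule has_sum_infsum[OF abs_summable_summable[OF abs]])
    then have lim: "((\<lambda>F. \<Sum>j\<in>F. ?t x j) \<longlongrightarrow> g x) (finite_subsets_at_top J0)" for x
      unfolding has_sum_def .
    have "lip_bound \<theta> (K * N) g"
      by (rule lip_bound_limit[OF eventually_finite_subsets_at_top_weakI lim]) (rule K(2)[OF N c], simp_all)
    moreover have "g \<in> borel_measurable M"
    proof (rule borel_measurable_LIMSEQ_metric)
      show "(\<lambda>x. \<Sum>j\<in>Fn n. ?t x j) \<in> borel_measurable M" for n
        using wv_measurable Fn(3)[of n]
        by (intro borel_measurable_sum borel_measurable_times borel_measurable_of_real) (auto simp: subset_iff)
      show "(\<lambda>n. \<Sum>j\<in>Fn n. ?t x j) \<longlonglongrightarrow> g x" for x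
        by (rule filterlim_compose[OF lim Fn(1)])
    qed
    ultimately show ?thesis using hs by blast
  qed
  then show ?thesis using K(1) by blast
qed

end

section \<open>The Carleson-type norm\<close>

lemma ennreal_summable: "(f :: 'b \<Rightarrow> ennreal) summable_on S"
  by (rule nonneg_summable_on_complete) simp

lemma ennreal_sqrt_le_iff: "0 \<le> N \<Longrightarrow> ennreal_sqrt x \<le> ennreal N \<longleftrightarrow> x \<le> ennreal (N\<^sup>2)"
proof (cases x)
  case (real r)
  assume N: "0 \<le> N"
  have "sqrt r \<le> N \<longleftrightarrow> r \<le> N\<^sup>2" using N real(2) by (simp add: real_le_lsqrt sqrt_le_D iff_conv_conj_imp)
  then show ?thesis using N real by (simp add: ennreal_sqrt_def)
qed (simp add: ennreal_sqrt_def top_unique)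

context wavelet_system
begin

lemma cube_j_fmeasurable: "j \<in> J0 \<Longrightarrow> cube Q j \<in> fmeasurable M"
  by (rule fmeasurable_subset_qball[OF cube_meas outer_ball_cube])

lemma jvol_le_cube: "\<exists>K\<ge>1. \<forall>j\<in>J0. jvol j \<le> K * measure M (cube Q j)"
proof -
  obtain K where K: "1 \<le> K" "\<And>x r. 0 < r \<Longrightarrow> vol x (1 / rin * r) \<le> K * vol x r"
    using vol_dilate[of "1 / rin"] rin_pos by auto
  have "jvol j \<le> K * measure M (cube Q j)" if j: "j \<in> J0" for j
  proof -
    have "vol (cen j) (1 / rin * (rin * jscale j)) \<le> K * vol (cen j) (rin * jscale j)"
      using rin_pos scale_pos by (intro K) simp
    then have "jvol j \<le> K * vol (cen j) (rin * jscale j)" using rin_pos by simp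
    also have "\<dots> \<le> K * measure M (cube Q j)"
      using K(1) by (intro mult_left_mono vol_le_measure inner_ball_cube cube_j_fmeasurable j) simp
    finally show ?thesis .
  qed
  then show ?thesis using K(1) by blast
qed

text \<open>The same set may be a cube of several levels. If l is the least one, a cube of a coarser
  nonnegative level inside P would by nestedness also contain P and so equal it, against minimality.
  The shift to \<open>l - 1\<close> comes from \<open>Inr (k, \<beta>)\<close>, whose cube has level
  k + 1.\<close>

lemma cubes0_minimal_level:
  assumes "P \<in> cubes0 A Q"
  obtains l \<alpha> where "0 \<le> l" "\<alpha> \<in> A l" "P = Q l \<alpha>"
    "\<And>j. j \<in> J0 \<Longrightarrow> cube Q j \<subseteq> P \<Longrightarrow> max 0 (l - 1) \<le> level j"
proof -
  have ex: "\<exists>n. P \<in> Q (int n) ` A (int n)"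
    using assms by (auto simp: cubes0_def) (metis image_eqI nonneg_int_cases)
  define n where "n = (LEAST n. P \<in> Q (int n) ` A (int n))"
  have "P \<in> Q (int n) ` A (int n)" unfolding n_def using ex by (rule LeastI_ex)
  then obtain \<alpha> where \<alpha>: "\<alpha> \<in> A (int n)" "P = Q (int n) \<alpha>" by auto
  have ge: "n \<le> m" if \<beta>: "\<beta> \<in> A (int m)" "Q (int m) \<beta> \<subseteq> P" for m \<beta>
  proof (rule ccontr)
    assume "\<not> n \<le> m"
    then have nm: "int m \<le> int n" "m < n" by auto
    have "0 < c0 / (3 * A0\<^sup>2) * \<delta> powi int m"
      using c0_pos A0_ge_1 scale_pos[of "int m"] by (simp add: scale_def)
    then have "pt (int m) \<beta> \<in> Q (int m) \<beta>" using inner_ball[OF \<beta>(1)] by (auto simp: qball_def)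
    then have "Q (int n) \<alpha> \<subseteq> Q (int m) \<beta>"
      using cubes_nested[OF nm(1) \<beta>(1) \<alpha>(1)] \<beta>(2) \<alpha>(2) by auto
    then have "P \<in> Q (int m) ` A (int m)" using \<beta> \<alpha>(2) by auto
    then have "n \<le> m" unfolding n_def by (rule Least_le)
    then show False using nm by simp
  qed
  have "max 0 (int n - 1) \<le> level j" if j: "j \<in> J0" "cube Q j \<subseteq> P" for j
    using j(1)
  proof (cases rule: J0_cases)
    case (Inl \<beta>)
    then show ?thesis using ge[of \<beta> 0] j(2) by simp
  next
    case (Inr k \<beta>)
    then show ?thesis using ge[of \<beta> "nat (k + 1)"] j(2) new_index_subset[OF Inr(3)] by auto
  qed
  then show thesis using \<alpha> by (intro that[of "int n" \<alpha>]) auto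
qed

lemma cube_fmeasurable: "\<alpha> \<in> A l \<Longrightarrow> Q l \<alpha> \<in> fmeasurable M"
  by (rule fmeasurable_subset_qball[OF cube_measurable outer_ball])

text \<open>The scale is one step coarser than that of the cube, to match
  \<open>cubes0_minimal_level\<close>; the ball about x still lies in a fixed dilate of the inner
  ball.\<close>

lemma vol_le_enclosing_cube:
  "\<exists>K\<ge>1. \<forall>l. \<forall>\<alpha>\<in>A l. \<forall>x\<in>Q l \<alpha>. vol x (scale (l - 1)) \<le> K * measure M (Q l \<alpha>)"
proof -
  define c where "c = c0 / (3 * A0\<^sup>2)"
  have c: "0 < c" using c0_pos A0_ge_1 by (simp add: c_def)
  define a where "a = max 1 (A0 * (rout + 1 / \<delta>) / c)"
  define K where "K = dconst * a powr upper_dim M d"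
  have "1 \<le> a powr upper_dim M d" using upper_dim_nonneg by (intro ge_one_powr_ge_zero) (auto simp: a_def)
  then have K: "1 \<le> K"
    unfolding K_def using mult_mono[of 1 dconst 1 "a powr upper_dim M d"] dconst_ge_1 by simp
  have "vol x (scale (l - 1)) \<le> K * measure M (Q l \<alpha>)" if \<alpha>: "\<alpha> \<in> A l" and x: "x \<in> Q l \<alpha>" for l \<alpha> x
  proof -
    let ?p = "pt l \<alpha>" and ?S = "scale l"
    have S: "0 < ?S" by (rule scale_pos)
    have s1: "scale (l - 1) = ?S / \<delta>" using scale_Suc[of "l - 1"] \<delta>_pos by simp
    have "d ?p x < rout * ?S" using outer_ball[OF \<alpha>] x by (auto simp: qball_def rout_def scale_def)
    then have "A0 * (d ?p x + scale (l - 1)) \<le> A0 * (rout * ?S + ?S / \<delta>)"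
      using A0_ge_1 by (intro mult_left_mono) (auto simp: s1)
    also have "\<dots> = A0 * (rout + 1 / \<delta>) / c * (c * ?S)" using c by (simp add: field_simps)
    also have "\<dots> \<le> a * (c * ?S)" using c S by (intro mult_right_mono) (auto simp: a_def)
    finally have "vol x (scale (l - 1)) \<le> K * vol ?p (c * ?S)"
      unfolding K_def using c S by (intro vol_compare_scale) (auto simp: a_def)
    also have "\<dots> \<le> K * measure M (Q l \<alpha>)"
      using K inner_ball[OF \<alpha>] by (intro mult_left_mono vol_le_measure cube_fmeasurable \<alpha>) (auto simp: c_def scale_def)
    finally show ?thesis .
  qed
  then show ?thesis using K by blast
qed

text \<open>A volume to the power \<open>1 + 2\<theta>\<close> is the integral over the cube of its power \<open>2\<theta>\<close>, so that
  the sum over all subcubes becomes a pointwise sum over the levels.\<close>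

lemma sum_jvol_in_cube:
  assumes \<theta>: "0 < \<theta>"
  shows "\<exists>K\<ge>1. \<forall>P\<in>cubes0 A Q. \<forall>F. finite F \<longrightarrow> F \<subseteq> {j\<in>J0. cube Q j \<subseteq> P} \<longrightarrow>
    (\<Sum>j\<in>F. jvol j powr (1 + 2 * \<theta>)) \<le> K * measure M P powr (1 + 2 * \<theta>)"
proof -
  obtain Kc where Kc: "1 \<le> Kc" "\<And>j. j \<in> J0 \<Longrightarrow> jvol j \<le> Kc * measure M (cube Q j)"
    using jvol_le_cube by blast
  obtain Kq where Kq: "1 \<le> Kq" "\<And>l \<alpha> x. \<alpha> \<in> A l \<Longrightarrow> x \<in> Q l \<alpha> \<Longrightarrow> vol x (scale (l - 1)) \<le> Kq * measure M (Q l \<alpha>)"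
    using vol_le_enclosing_cube by blast
  obtain Kh n where Kh: "1 \<le> Kh" "\<And>k x F. finite F \<Longrightarrow> F \<subseteq> J0 \<Longrightarrow> \<forall>j\<in>F. k \<le> level j \<Longrightarrow> 0 \<le> k \<Longrightarrow>
    (\<Sum>j\<in>F. jvol j powr (2 * \<theta>) / ldist (level j) x j ^ n) \<le> Kh * vol x (scale k) powr (2 * \<theta>)"
    using high_level_sum[of "2 * \<theta>"] \<theta> by auto
  define e where "e = (1 + rout) ^ n"
  have e: "1 \<le> e" unfolding e_def using rout_ge_1 by (intro one_le_power) simp
  define G where "G = e * Kh * Kq powr (2 * \<theta>)"
  have G0: "0 \<le> G" using e Kh by (simp add: G_def)
  have bound: "(\<Sum>j\<in>F. jvol j powr (1 + 2 * \<theta>)) \<le> (1 + Kc * G) * measure M P powr (1 + 2 * \<theta>)"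
    if P: "P \<in> cubes0 A Q" and F: "finite F" "F \<subseteq> {j\<in>J0. cube Q j \<subseteq> P}" for P F
  proof -
    obtain l \<alpha> where l: "0 \<le> l" "\<alpha> \<in> A l" "P = Q l \<alpha>"
      and lev: "\<And>j. j \<in> J0 \<Longrightarrow> cube Q j \<subseteq> P \<Longrightarrow> max 0 (l - 1) \<le> level j"
      using cubes0_minimal_level[OF P] by metis
    have Pf: "P \<in> fmeasurable M" using cube_fmeasurable l by simp
    let ?m = "measure M P"
    \<comment> \<open>A point of a cube has bounded \<open>rdist\<close> from its centre, so the
      indicator is at most e times the weight in \<open>high_level_sum\<close>. Outside P all
      indicators vanish.\<close>
    have pw: "(\<Sum>j\<in>F. indicator (cube Q j) x * jvol j powr (2 * \<theta>)) \<le> indicator P x * (G * ?m powr (2 * \<theta>))" for x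
    proof (cases "x \<in> P")
      case False
      then have "x \<notin> cube Q j" if "j \<in> F" for j using F(2) that by blast
      then show ?thesis using False by simp
    next
      case True
      have "(\<Sum>j\<in>F. indicator (cube Q j) x * jvol j powr (2 * \<theta>))
          \<le> (\<Sum>j\<in>F. e * (jvol j powr (2 * \<theta>) / ldist (level j) x j ^ n))"
      proof (rule sum_mono)
        fix j assume j: "j \<in> F"
        let ?r = "ldist (level j) x j"
        have r: "0 < ?r" by (rule rdist_pos[OF scale_pos])
        show "indicator (cube Q j) x * jvol j powr (2 * \<theta>) \<le> e * (jvol j powr (2 * \<theta>) / ?r ^ n)"
        proof (cases "x \<in> cube Q j")
          case True
          then have "d x (cen j) < rout * jscale j"
            using outer_ball_cube[of j] j F(2) by (auto simp: qball_def d_sym[of x])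
          then have "?r ^ n \<le> e"
            unfolding e_def using r by (intro power_mono rdist_le_of_less scale_pos) auto
          then have "1 * jvol j powr (2 * \<theta>) \<le> e / ?r ^ n * jvol j powr (2 * \<theta>)"
            using r by (intro mult_right_mono) (auto simp: le_divide_eq)
          then show ?thesis using True by simp
        next
          case False
          then show ?thesis using e r by simp
        qed
      qed
      also have "\<dots> = e * (\<Sum>j\<in>F. jvol j powr (2 * \<theta>) / ldist (level j) x j ^ n)"
        by (simp add: sum_distrib_left)
      also have "\<dots> \<le> e * (Kh * vol x (scale (max 0 (l - 1))) powr (2 * \<theta>))"
        using e lev F by (intro mult_left_mono Kh) auto
      also have "\<dots> \<le> e * (Kh * (Kq * ?m) powr (2 * \<theta>))"
      proof (intro mult_left_mono powr_mono2)
        have "vol x (scale (max 0 (l - 1))) \<le> vol x (scale (l - 1))" by (intro vol_mono scale_antimono) simp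
        also have "\<dots> \<le> Kq * ?m" using Kq(2)[OF l(2)] True l(3) by simp
        finally show "vol x (scale (max 0 (l - 1))) \<le> Kq * ?m" .
      qed (use e Kh \<theta> in auto)
      also have "\<dots> = G * ?m powr (2 * \<theta>)" using Kq(1) by (simp add: G_def powr_mult)
      finally show ?thesis using True by simp
    qed
    have intc: "integrable M (\<lambda>x. indicator (cube Q j) x * jvol j powr (2 * \<theta>))" if "j \<in> F" for j
    proof -
      have "cube Q j \<in> fmeasurable M"
        using that F(2) cube_j_fmeasurable by auto
      then show ?thesis by (auto simp: fmeasurable_def)
    qed
    have "(\<Sum>j\<in>F. jvol j powr (1 + 2 * \<theta>)) \<le> (\<Sum>j\<in>F. Kc * (LINT x|M. indicator (cube Q j) x * jvol j powr (2 * \<theta>)))"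
    proof (rule sum_mono)
      fix j assume j: "j \<in> F"
      have "jvol j powr (1 + 2 * \<theta>) = jvol j * jvol j powr (2 * \<theta>)"
        using vol_pos[OF scale_pos, of "cen j"] by (simp add: powr_add)
      also have "\<dots> \<le> Kc * measure M (cube Q j) * jvol j powr (2 * \<theta>)"
        using Kc(2)[of j] j F(2) by (intro mult_right_mono) auto
      also have "\<dots> = Kc * (LINT x|M. indicator (cube Q j) x * jvol j powr (2 * \<theta>))"
        by (simp add: space_M)
      finally show "jvol j powr (1 + 2 * \<theta>) \<le> Kc * (LINT x|M. indicator (cube Q j) x * jvol j powr (2 * \<theta>))" .
    qed
    also have "\<dots> = Kc * (LINT x|M. (\<Sum>j\<in>F. indicator (cube Q j) x * jvol j powr (2 * \<theta>)))"
      by (subst Bochner_Integration.integral_sum[OF intc]) (simp_all only: sum_distrib_left)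
    also have "\<dots> \<le> Kc * (LINT x|M. indicator P x * (G * ?m powr (2 * \<theta>)))"
    proof (intro mult_left_mono integral_mono pw)
      show "integrable M (\<lambda>x. indicator P x * (G * ?m powr (2 * \<theta>)) :: real)"
        using Pf by (auto simp: fmeasurable_def)
    qed (use Kc intc in auto)
    also have "\<dots> = Kc * G * (?m * ?m powr (2 * \<theta>))" by (simp add: space_M)
    also have "?m * ?m powr (2 * \<theta>) = ?m powr (1 + 2 * \<theta>)" by (simp add: powr_add)
    also have "Kc * G * ?m powr (1 + 2 * \<theta>) \<le> (1 + Kc * G) * ?m powr (1 + 2 * \<theta>)"
      by (intro mult_right_mono) auto
    finally show ?thesis .
  qed
  have "1 \<le> 1 + Kc * G" using Kc G0 by simp
  with bound show ?thesis by blast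
qed

text \<open>The bracket of \<open>star_norm\<close> with arbitrary summands, written as the same
  iterated sum, so that it can be compared with finite sums over the wavelet index.\<close>

definition star_sum :: "((int \<times> 'i + int \<times> 'i) \<Rightarrow> ennreal) \<Rightarrow> 'a set \<Rightarrow> ennreal" where
  "star_sum a P = (\<Sum>\<^sub>\<infinity>\<alpha>\<in>{\<alpha>\<in>A 0. Q 0 \<alpha> \<subseteq> P}. a (Inl (0, \<alpha>))) +
    (\<Sum>k::nat. \<Sum>\<^sub>\<infinity>\<beta>\<in>{\<beta>\<in>new_index A pt (int k). Q (int k + 1) \<beta> \<subseteq> P}. a (Inr (int k, \<beta>)))"

text \<open>Cutting the outer series after n terms leaves a sum over the disjoint union T n of index
  sets, which is the supremum of its finite subsums; the bound survives the limit in n.\<close>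

lemma star_sum_le:
  assumes "\<And>F. finite F \<Longrightarrow> F \<subseteq> {j\<in>J0. cube Q j \<subseteq> P} \<Longrightarrow> sum a F \<le> B"
  shows "star_sum a P \<le> B"
proof -
  define X where "X = {\<alpha>\<in>A 0. Q 0 \<alpha> \<subseteq> P}"
  define Y where "Y k = {\<beta>\<in>new_index A pt (int k). Q (int k + 1) \<beta> \<subseteq> P}" for k
  define T where "T n = (\<lambda>\<alpha>. Inl (0 :: int, \<alpha>)) ` X \<union> (\<Union>k<n. (\<lambda>\<beta>. Inr (int k, \<beta>)) ` Y k)" for n :: nat
  have eq: "(\<Sum>\<^sub>\<infinity>\<alpha>\<in>X. a (Inl (0, \<alpha>))) + (\<Sum>k<n. \<Sum>\<^sub>\<infinity>\<beta>\<in>Y k. a (Inr (int k, \<beta>))) = infsum a (T n)" for n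
  proof (induction n)
    case 0
    have "infsum a (T 0) = infsum (a \<circ> (\<lambda>\<alpha>. Inl (0, \<alpha>))) X"
      unfolding T_def by (simp, intro infsum_reindex inj_onI) simp
    then show ?case by (simp add: o_def)
  next
    case (Suc n)
    have un: "T (Suc n) = T n \<union> (\<lambda>\<beta>. Inr (int n, \<beta>)) ` Y n"
      unfolding T_def lessThan_Suc by blast
    have "infsum a (T (Suc n)) = infsum a (T n) + infsum a ((\<lambda>\<beta>. Inr (int n, \<beta>)) ` Y n)"
      unfolding un by (intro infsum_Un_disjoint ennreal_summable) (auto simp: T_def)
    also have "infsum a ((\<lambda>\<beta>. Inr (int n, \<beta>)) ` Y n) = infsum (a \<circ> (\<lambda>\<beta>. Inr (int n, \<beta>))) (Y n)"
      by (intro infsum_reindex inj_onI) simp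
    finally show ?case using Suc by (simp add: o_def add.assoc)
  qed
  have TJ: "T n \<subseteq> {j\<in>J0. cube Q j \<subseteq> P}" for n
    by (auto simp: T_def X_def Y_def wavelet_index_def)
  have le: "(\<Sum>\<^sub>\<infinity>\<alpha>\<in>X. a (Inl (0, \<alpha>))) + (\<Sum>k<n. \<Sum>\<^sub>\<infinity>\<beta>\<in>Y k. a (Inr (int k, \<beta>))) \<le> B" for n
    unfolding eq using TJ[of n] assms by (intro infsum_le_finite_sums ennreal_summable) blast
  have "(\<lambda>n. (\<Sum>\<^sub>\<infinity>\<alpha>\<in>X. a (Inl (0, \<alpha>))) + (\<Sum>k<n. \<Sum>\<^sub>\<infinity>\<beta>\<in>Y k. a (Inr (int k, \<beta>))))
      \<longlonglongrightarrow> (\<Sum>\<^sub>\<infinity>\<alpha>\<in>X. a (Inl (0, \<alpha>))) + (\<Sum>k. \<Sum>\<^sub>\<infinity>\<beta>\<in>Y k. a (Inr (int k, \<beta>)))"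
    by (intro tendsto_add tendsto_const summable_LIMSEQ) auto
  from LIMSEQ_le_const2[OF this] le show ?thesis
    unfolding star_sum_def X_def[symmetric] Y_def[symmetric] by blast
qed

lemma le_star_sum:
  assumes j: "j \<in> J0" "cube Q j \<subseteq> P"
  shows "a j \<le> star_sum a P"
proof -
  have elem: "f x \<le> infsum f S" if "x \<in> S" for f :: "'i \<Rightarrow> ennreal" and S x
  proof -
    have "infsum f {x} \<le> infsum f S"
      using that by (intro infsum_mono_neutral ennreal_summable) auto
    then show ?thesis by simp
  qed
  show ?thesis
    using j(1)
  proof (cases rule: J0_cases)
    case (Inl \<alpha>)
    then have "a j \<le> (\<Sum>\<^sub>\<infinity>\<alpha>\<in>{\<alpha>\<in>A 0. Q 0 \<alpha> \<subseteq> P}. a (Inl (0, \<alpha>)))"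
      using elem[of \<alpha> "{\<alpha>\<in>A 0. Q 0 \<alpha> \<subseteq> P}" "\<lambda>\<alpha>. a (Inl (0, \<alpha>))"] j(2) by simp
    then show ?thesis unfolding star_sum_def by (rule add_increasing2[rotated]) simp
  next
    case (Inr k \<beta>)
    let ?g = "\<lambda>k::nat. \<Sum>\<^sub>\<infinity>\<beta>\<in>{\<beta>\<in>new_index A pt (int k). Q (int k + 1) \<beta> \<subseteq> P}. a (Inr (int k, \<beta>))"
    have "a j \<le> ?g (nat k)"
      using elem[of \<beta> "{\<beta>\<in>new_index A pt k. Q (k + 1) \<beta> \<subseteq> P}" "\<lambda>\<beta>. a (Inr (k, \<beta>))"] Inr j(2) by simp
    also have "\<dots> \<le> (\<Sum>k. ?g k)"
      using sum_le_suminf[of ?g "{nat k}"] by simp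
    finally show ?thesis unfolding star_sum_def by (rule add_increasing[rotated]) simp
  qed
qed

lemma star_norm_eq:
  "star \<theta> f = (SUP P\<in>cubes0 A Q. ennreal_sqrt
    (star_sum (\<lambda>j. ennreal ((cmod (coef f j))\<^sup>2)) P / ennreal (measure M P powr (1 + 2 * \<theta>))))"
  by (simp add: star_norm_def star_sum_def)

lemma cube_measure_pos: "\<alpha> \<in> A l \<Longrightarrow> 0 < measure M (Q l \<alpha>)"
proof -
  assume \<alpha>: "\<alpha> \<in> A l"
  have "0 < vol (pt l \<alpha>) (c0 / (3 * A0\<^sup>2) * \<delta> powi l)"
    using c0_pos A0_ge_1 scale_pos[of l] by (intro vol_pos) (simp add: scale_def)
  also have "\<dots> \<le> measure M (Q l \<alpha>)" by (intro vol_le_measure inner_ball cube_fmeasurable \<alpha>)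
  finally show ?thesis .
qed

text \<open>Cubes have positive measure, so the division can be cleared cube by cube.\<close>

lemma star_norm_le_iff:
  assumes N: "0 \<le> N"
  shows "star \<theta> f \<le> ennreal N \<longleftrightarrow> (\<forall>P\<in>cubes0 A Q.
    star_sum (\<lambda>j. ennreal ((cmod (coef f j))\<^sup>2)) P \<le> ennreal (N\<^sup>2 * measure M P powr (1 + 2 * \<theta>)))"
proof -
  have "ennreal_sqrt (a / ennreal (measure M P powr (1 + 2 * \<theta>))) \<le> ennreal N \<longleftrightarrow>
      a \<le> ennreal (N\<^sup>2 * measure M P powr (1 + 2 * \<theta>))" if "P \<in> cubes0 A Q" for P a
  proof -
    have "0 < measure M P" using that cube_measure_pos by (auto simp: cubes0_def)
    then show ?thesis
      using N by (simp add: ennreal_sqrt_le_iff ennreal_divide_le_iff ennreal_mult)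
  qed
  then show ?thesis by (simp add: star_norm_eq SUP_le_iff)
qed

text \<open>Squaring the coefficient bound produces exactly the exponent 1 + 2\<theta> of
  \<open>sum_jvol_in_cube\<close>: for \<theta> > 0 the Carleson condition amounts to a bound on
  single coefficients.\<close>

lemma star_norm_bound:
  assumes \<theta>: "0 < \<theta>"
  shows "\<exists>K\<ge>1. \<forall>N f. 0 \<le> N \<longrightarrow>
    (\<forall>j\<in>J0. cmod (coef f j) \<le> N * jvol j powr (1/2 + \<theta>)) \<longrightarrow>
    star \<theta> f \<le> ennreal (K * N)"
proof -
  obtain K where K: "1 \<le> K" "\<forall>P\<in>cubes0 A Q. \<forall>F. finite F \<longrightarrow> F \<subseteq> {j\<in>J0. cube Q j \<subseteq> P} \<longrightarrow>
    (\<Sum>j\<in>F. jvol j powr (1 + 2 * \<theta>)) \<le> K * measure M P powr (1 + 2 * \<theta>)"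
    using sum_jvol_in_cube[OF \<theta>] by (elim exE conjE)
  have "star \<theta> f \<le> ennreal (K * N)"
    if N: "0 \<le> N" and c: "\<forall>j\<in>J0. cmod (coef f j) \<le> N * jvol j powr (1/2 + \<theta>)" for N f
  proof -
    have KN: "0 \<le> K * N" using K N by simp
    show ?thesis
      unfolding star_norm_le_iff[OF KN]
    proof (intro ballI star_sum_le)
      fix P F assume P: "P \<in> cubes0 A Q" and F: "finite F" "F \<subseteq> {j\<in>J0. cube Q j \<subseteq> P}"
      have "(\<Sum>j\<in>F. (cmod (coef f j))\<^sup>2) \<le> (\<Sum>j\<in>F. N\<^sup>2 * jvol j powr (1 + 2 * \<theta>))"
      proof (rule sum_mono)
        fix j assume j: "j \<in> F"
        then have "(cmod (coef f j))\<^sup>2 \<le> (N * jvol j powr (1/2 + \<theta>))\<^sup>2"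
          using c F(2) by (intro power_mono) auto
        also have "\<dots> = N\<^sup>2 * jvol j powr (1 + 2 * \<theta>)"
          by (simp add: power_mult_distrib power2_eq_square powr_add[symmetric])
        finally show "(cmod (coef f j))\<^sup>2 \<le> N\<^sup>2 * jvol j powr (1 + 2 * \<theta>)" .
      qed
      also have "\<dots> = N\<^sup>2 * (\<Sum>j\<in>F. jvol j powr (1 + 2 * \<theta>))" by (simp add: sum_distrib_left)
      also have "\<dots> \<le> N\<^sup>2 * (K * measure M P powr (1 + 2 * \<theta>))"
        using K(2)[rule_format, OF P F] by (intro mult_left_mono) auto
      also have "\<dots> \<le> (K * N)\<^sup>2 * measure M P powr (1 + 2 * \<theta>)"
      proof -
        \<comment> \<open>The natural constant is the square root of K; since
          \<open>1 \<le> K\<close>, the simpler K may replace it.\<close>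
        have "K \<le> K\<^sup>2" using K(1) by (simp add: power2_eq_square)
        then have "K * (N\<^sup>2 * measure M P powr (1 + 2 * \<theta>)) \<le> K\<^sup>2 * (N\<^sup>2 * measure M P powr (1 + 2 * \<theta>))"
          by (intro mult_right_mono) auto
        then show ?thesis by (simp add: power_mult_distrib mult_ac)
      qed
      finally show "(\<Sum>j\<in>F. ennreal ((cmod (coef f j))\<^sup>2)) \<le> ennreal ((K * N)\<^sup>2 * measure M P powr (1 + 2 * \<theta>))"
        by (simp add: ennreal_leI sum_ennreal)
    qed
  qed
  then show ?thesis using K(1) by blast
qed

text \<open>The cube tested is that of j itself: the squared coefficient is one of the summands, and
  the cube lies in a fixed dilate of the ball of volume \<open>jvol j\<close>.\<close>

lemma coefficients_le_star_norm:
  assumes \<theta>: "0 < \<theta>"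
  shows "\<exists>K\<ge>1. \<forall>N f. 0 \<le> N \<longrightarrow> star \<theta> f \<le> ennreal N \<longrightarrow>
    (\<forall>j\<in>J0. cmod (coef f j) \<le> K * N * jvol j powr (1/2 + \<theta>))"
proof -
  obtain Kr where Kr: "1 \<le> Kr" "\<And>x r. 0 < r \<Longrightarrow> vol x (rout * r) \<le> Kr * vol x r"
    using vol_dilate[of rout] rout_ge_1 by auto
  define K where "K = Kr powr (1/2 + \<theta>)"
  have K: "1 \<le> K" unfolding K_def using Kr \<theta> by (intro ge_one_powr_ge_zero) auto
  have "cmod (coef f j) \<le> K * N * jvol j powr (1/2 + \<theta>)"
    if N: "0 \<le> N" and st: "star \<theta> f \<le> ennreal N" and j: "j \<in> J0" for N f j
  proof -
    let ?P = "cube Q j" and ?c = "cmod (coef f j)"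
    have P: "?P \<in> cubes0 A Q"
      using j
    proof (cases rule: J0_cases)
      case (Inl \<alpha>)
      then show ?thesis by (auto simp: cubes0_def intro!: bexI[of _ 0])
    next
      case (Inr k \<beta>)
      then show ?thesis by (auto simp: cubes0_def dest!: new_index_subset intro!: bexI[of _ "k + 1"])
    qed
    have "ennreal (?c\<^sup>2) \<le> star_sum (\<lambda>j. ennreal ((cmod (coef f j))\<^sup>2)) ?P"
      by (rule le_star_sum[OF j order_refl])
    also have "\<dots> \<le> ennreal (N\<^sup>2 * measure M ?P powr (1 + 2 * \<theta>))"
      using st P by (simp add: star_norm_le_iff[OF N])
    finally have "?c\<^sup>2 \<le> N\<^sup>2 * measure M ?P powr (1 + 2 * \<theta>)" by (subst (asm) ennreal_le_iff) auto
    also have "\<dots> = (N * measure M ?P powr (1/2 + \<theta>))\<^sup>2"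
      by (simp add: power_mult_distrib power2_eq_square powr_add[symmetric])
    finally have "?c \<le> N * measure M ?P powr (1/2 + \<theta>)"
      using N by (simp add: abs_le_square_iff[symmetric])
    also have "\<dots> \<le> N * (Kr * jvol j) powr (1/2 + \<theta>)"
    proof (intro mult_left_mono powr_mono2)
      have "measure M ?P \<le> vol (cen j) (rout * jscale j)"
        by (intro measure_le_vol outer_ball_cube cube_meas j)
      then show "measure M ?P \<le> Kr * jvol j" using Kr(2)[OF scale_pos, of "cen j" "level j"] by linarith
    qed (use N \<theta> in auto)
    also have "\<dots> = K * N * jvol j powr (1/2 + \<theta>)" using Kr(1) by (simp add: K_def powr_mult mult_ac)
    finally show ?thesis .
  qed
  then show ?thesis using K by blast
qed

end

section \<open>Square integrable functions\<close>

lemma norm_add_square_le: "(norm (a + b :: 'b::real_normed_vector))\<^sup>2 \<le> 2 * (norm a)\<^sup>2 + 2 * (norm b)\<^sup>2"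
proof -
  have "(norm (a + b))\<^sup>2 \<le> (norm a + norm b)\<^sup>2" by (intro power_mono norm_triangle_ineq) simp
  also have "\<dots> \<le> 2 * (norm a)\<^sup>2 + 2 * (norm b)\<^sup>2"
    using sum_squares_bound[of "norm a" "norm b"] by (simp add: power2_sum)
  finally show ?thesis .
qed

lemma cmod_add_square: "(cmod (a + b))\<^sup>2 = (cmod a)\<^sup>2 + (cmod b)\<^sup>2 + 2 * Re (a * cnj b)"
  unfolding cmod_power2 by (simp add: power2_eq_square algebra_simps)

lemma L2_add:
  fixes f g :: "'a \<Rightarrow> complex"
  assumes "L2 M f" "L2 M g"
  shows "L2 M (\<lambda>x. f x + g x)"
proof -
  have [measurable]: "f \<in> borel_measurable M" "g \<in> borel_measurable M" using assms by (auto simp: L2_def)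
  have "integrable M (\<lambda>x. 2 * (norm (f x))\<^sup>2 + 2 * (norm (g x))\<^sup>2)"
    using assms by (auto simp: L2_def)
  then have "integrable M (\<lambda>x. (norm (f x + g x))\<^sup>2)"
    by (rule Bochner_Integration.integrable_bound) (auto simp: norm_add_square_le)
  then show ?thesis by (simp add: L2_def)
qed

lemma L2_cmult_real:
  assumes "L2 M (w :: 'a \<Rightarrow> real)"
  shows "L2 M (\<lambda>x. c * complex_of_real (w x))"
  using assms by (auto simp: L2_def norm_mult power_mult_distrib)

lemma L2_sum:
  fixes f :: "'j \<Rightarrow> 'a \<Rightarrow> complex"
  assumes "finite F" "\<And>j. j \<in> F \<Longrightarrow> L2 M (f j)"
  shows "L2 M (\<lambda>x. \<Sum>j\<in>F. f j x)"
  using assms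
proof (induction F)
  case empty
  show ?case by (simp add: L2_def)
next
  case (insert a F)
  then show ?case using L2_add[of M "f a" "\<lambda>x. \<Sum>j\<in>F. f j x"] by simp
qed

lemma L2_minus: "L2 M (f :: 'a \<Rightarrow> complex) \<Longrightarrow> L2 M (\<lambda>x. - f x)"
  by (simp add: L2_def)

lemma L2_diff:
  fixes f g :: "'a \<Rightarrow> complex"
  assumes "L2 M f" "L2 M g"
  shows "L2 M (\<lambda>x. f x - g x)"
  using L2_add[OF assms(1) L2_minus[OF assms(2)]] by simp

lemma integrable_L2_mult:
  assumes f: "L2 M (f :: 'a \<Rightarrow> complex)" and w: "L2 M (w :: 'a \<Rightarrow> real)"
  shows "integrable M (\<lambda>x. f x * complex_of_real (w x))"
proof (rule Bochner_Integration.integrable_bound)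
  show "integrable M (\<lambda>x. (norm (f x))\<^sup>2 + (norm (w x))\<^sup>2)" using f w by (auto simp: L2_def)
  show "(\<lambda>x. f x * complex_of_real (w x)) \<in> borel_measurable M"
    using f w unfolding L2_def by (intro borel_measurable_times borel_measurable_of_real) auto
  have "norm (f x * complex_of_real (w x)) \<le> (norm (f x))\<^sup>2 + (norm (w x))\<^sup>2" for x
  proof -
    have "2 * (norm (f x) * norm (w x)) \<le> (norm (f x))\<^sup>2 + (norm (w x))\<^sup>2"
      using sum_squares_bound[of "norm (f x)" "norm (w x)"] by simp
    moreover have "0 \<le> norm (f x) * norm (w x)" by simp
    ultimately show ?thesis unfolding norm_mult norm_of_real real_norm_def by linarith
  qed
  then show "AE x in M. norm (f x * complex_of_real (w x)) \<le> norm ((norm (f x))\<^sup>2 + (norm (w x))\<^sup>2)"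
    by (intro AE_I2) (simp add: order_trans[OF _ abs_ge_self])
qed

definition partial_sum :: "'a measure \<Rightarrow> ('j \<Rightarrow> 'a \<Rightarrow> real) \<Rightarrow> 'j set \<Rightarrow> ('a \<Rightarrow> complex) \<Rightarrow> 'a \<Rightarrow> complex" where
  "partial_sum M w F f x = (\<Sum>j\<in>F. pairing M f (w j) * complex_of_real (w j x))"

lemma L2_partial_sum:
  assumes "\<And>j. j \<in> F \<Longrightarrow> L2 M (w j)" "finite F"
  shows "L2 M (partial_sum M w F f)"
  unfolding partial_sum_def[abs_def] using assms by (intro L2_sum L2_cmult_real) auto

text \<open>The residual h of the projection is orthogonal to all \<open>w j\<close> with j in F.
  Any other choice of coefficients adds an element of their span to h, which by Pythagoras cannot
  shorten it.\<close>

lemma partial_sum_best_approximation: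
  fixes f :: "'a \<Rightarrow> complex"
  assumes f: "L2 M f" and F: "finite F" and w: "\<And>j. j \<in> F \<Longrightarrow> L2 M (w j)"
    and on: "\<And>i j. i \<in> F \<Longrightarrow> j \<in> F \<Longrightarrow> (LINT x|M. w i x * w j x) = (if i = j then 1 else 0)"
  shows "(LINT x|M. (norm (f x - partial_sum M w F f x))\<^sup>2)
    \<le> (LINT x|M. (norm (f x - (\<Sum>j\<in>F. c j * complex_of_real (w j x))))\<^sup>2)"
proof -
  define h where "h x = f x - partial_sum M w F f x" for x
  define e where "e j = pairing M f (w j) - c j" for j
  have h: "L2 M h" unfolding h_def[abs_def] by (intro L2_diff f L2_partial_sum w F)
  have wi: "integrable M (\<lambda>x. complex_of_real (w j x) * complex_of_real (w i x))" if "i \<in> F" "j \<in> F" for i j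
    using integrable_L2_mult[OF L2_cmult_real[OF w[OF that(2)], of 1] w[OF that(1)]] by simp
  have orth: "(LINT x|M. h x * complex_of_real (w i x)) = 0" if i: "i \<in> F" for i
  proof -
    have "(LINT x|M. h x * complex_of_real (w i x)) = (LINT x|M. f x * complex_of_real (w i x) -
        (\<Sum>j\<in>F. pairing M f (w j) * (complex_of_real (w j x) * complex_of_real (w i x))))"
      by (simp add: h_def partial_sum_def left_diff_distrib sum_distrib_right mult.assoc)
    also have "\<dots> = pairing M f (w i) -
        (\<Sum>j\<in>F. pairing M f (w j) * (LINT x|M. complex_of_real (w j x) * complex_of_real (w i x)))"
      using i wi by (subst Bochner_Integration.integral_diff)
        (auto intro!: integrable_L2_mult f w Bochner_Integration.integrable_sum integrable_mult_right
          simp: pairing_def Bochner_Integration.integral_sum)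
    also have "(\<Sum>j\<in>F. pairing M f (w j) * (LINT x|M. complex_of_real (w j x) * complex_of_real (w i x)))
        = (\<Sum>j\<in>F. pairing M f (w j) * (if j = i then 1 else 0))"
    proof (rule sum.cong[OF refl])
      fix j assume j: "j \<in> F"
      have "(LINT x|M. complex_of_real (w j x) * complex_of_real (w i x)) = complex_of_real (LINT x|M. w j x * w i x)"
        by (simp only: of_real_mult[symmetric] integral_complex_of_real)
      then show "pairing M f (w j) * (LINT x|M. complex_of_real (w j x) * complex_of_real (w i x))
          = pairing M f (w j) * (if j = i then 1 else 0)" using on[OF j i] by simp
    qed
    also have "\<dots> = pairing M f (w i)" using F i by (simp add: if_distrib cong: if_cong)
    finally show ?thesis by simp
  qed
  let ?k = "\<lambda>x. \<Sum>j\<in>F. e j * complex_of_real (w j x)"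
  have hw: "integrable M (\<lambda>x. h x * complex_of_real (w j x))" if "j \<in> F" for j
    by (rule integrable_L2_mult[OF h w[OF that]])
  have hk: "h x * cnj (?k x) = (\<Sum>j\<in>F. cnj (e j) * (h x * complex_of_real (w j x)))" for x
    by (simp add: sum_distrib_left mult_ac)
  have hki: "integrable M (\<lambda>x. h x * cnj (?k x))"
    unfolding hk using hw by (intro Bochner_Integration.integrable_sum integrable_mult_right) auto
  have "(LINT x|M. h x * cnj (?k x)) = (\<Sum>j\<in>F. cnj (e j) * (LINT x|M. h x * complex_of_real (w j x)))"
    unfolding hk using hw by (subst Bochner_Integration.integral_sum) auto
  then have hk0: "(LINT x|M. h x * cnj (?k x)) = 0" by (simp add: orth)
  have decomp: "f x - (\<Sum>j\<in>F. c j * complex_of_real (w j x)) = h x + ?k x" for x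
    by (simp add: h_def e_def partial_sum_def left_diff_distrib sum_subtractf)
  have "(LINT x|M. (norm (h x))\<^sup>2) = (LINT x|M. (norm (h x))\<^sup>2 + 2 * Re (h x * cnj (?k x)))"
  proof -
    have "(LINT x|M. Re (h x * cnj (?k x))) = 0" using hk0 hki by (subst integral_Re) auto
    moreover have "integrable M (\<lambda>x. Re (h x * cnj (?k x)))" by (rule integrable_Re[OF hki])
    ultimately show ?thesis
      using h by (subst Bochner_Integration.integral_add) (auto simp: L2_def simp del: times_complex.sel)
  qed
  also have "\<dots> \<le> (LINT x|M. (norm (h x + ?k x))\<^sup>2)"
  proof (rule integral_mono)
    show "integrable M (\<lambda>x. (norm (h x))\<^sup>2 + 2 * Re (h x * cnj (?k x)))"
      using h integrable_Re[OF hki] by (intro Bochner_Integration.integrable_add integrable_mult_right) (auto simp: L2_def)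
    have "L2 M (\<lambda>x. h x + ?k x)" by (intro L2_add h L2_sum L2_cmult_real w F)
    then show "integrable M (\<lambda>x. (norm (h x + ?k x))\<^sup>2)" by (simp add: L2_def)
    fix x
    \<comment> \<open>The square of \<open>?k x\<close> is dropped pointwise; the mixed term stays
      and integrates to zero.\<close>
    have "(norm (h x + ?k x))\<^sup>2 = (norm (h x))\<^sup>2 + (norm (?k x))\<^sup>2 + 2 * Re (h x * cnj (?k x))"
      by (rule cmod_add_square)
    then show "(norm (h x))\<^sup>2 + 2 * Re (h x * cnj (?k x)) \<le> (norm (h x + ?k x))\<^sup>2" by simp
  qed
  finally show ?thesis by (simp add: decomp h_def)
qed

text \<open>Upgrades density of the span to unconditional convergence: an approximation over one
  finite set F0 is beaten by the projection onto any larger finite set.\<close>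

lemma partial_sum_converges:
  assumes on: "orthonormal_basis_L2 M w J" and f: "L2 M f"
  shows "((\<lambda>F. LINT x|M. (norm (f x - partial_sum M w F f x))\<^sup>2) \<longlongrightarrow> 0) (finite_subsets_at_top J)"
proof (rule order_tendstoI)
  fix a :: real assume "a < 0"
  then show "\<forall>\<^sub>F F in finite_subsets_at_top J. a < (LINT x|M. (norm (f x - partial_sum M w F f x))\<^sup>2)"
    by (intro always_eventually allI) (rule less_le_trans[OF _ Bochner_Integration.integral_nonneg], simp_all)
next
  fix a :: real assume a: "0 < a"
  then have "0 < sqrt a" by simp
  then obtain F0 c where F0: "finite F0" "F0 \<subseteq> J"
    and c: "L2_norm_on M (space M) (\<lambda>x. f x - (\<Sum>j\<in>F0. c j * complex_of_real (w j x))) < sqrt a"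
    using on f unfolding orthonormal_basis_L2_def by blast
  \<comment> \<open>Extension by zero makes the approximation over F0 a competitor over every larger
    set.\<close>
  define c' where "c' j = (if j \<in> F0 then c j else 0)" for j
  have small: "(LINT x|M. (norm (f x - (\<Sum>j\<in>F0. c j * complex_of_real (w j x))))\<^sup>2) < a"
  proof -
    have "(LINT x:space M|M. (norm (f x - (\<Sum>j\<in>F0. c j * complex_of_real (w j x))))\<^sup>2)
        = (LINT x|M. (norm (f x - (\<Sum>j\<in>F0. c j * complex_of_real (w j x))))\<^sup>2)"
      unfolding set_lebesgue_integral_def by (intro Bochner_Integration.integral_cong) auto
    then show ?thesis using c by (simp add: L2_norm_on_def)
  qed
  have "(LINT x|M. (norm (f x - partial_sum M w F f x))\<^sup>2) < a" if F: "finite F" "F0 \<subseteq> F" "F \<subseteq> J" for F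
  proof -
    have eq: "(\<Sum>j\<in>F. c' j * complex_of_real (w j x)) = (\<Sum>j\<in>F0. c j * complex_of_real (w j x))" for x
      using F by (intro sum.mono_neutral_cong_right) (auto simp: c'_def)
    have "(LINT x|M. (norm (f x - partial_sum M w F f x))\<^sup>2)
        \<le> (LINT x|M. (norm (f x - (\<Sum>j\<in>F. c' j * complex_of_real (w j x))))\<^sup>2)"
      using on F by (intro partial_sum_best_approximation f) (auto simp: orthonormal_basis_L2_def subset_iff)
    then show ?thesis using small unfolding eq by linarith
  qed
  then show "\<forall>\<^sub>F F in finite_subsets_at_top J. (LINT x|M. (norm (f x - partial_sum M w F f x))\<^sup>2) < a"
    unfolding eventually_finite_subsets_at_top using F0 by blast
qed

section \<open>Local square integrability and identification of limits\<close>

context homogeneous_type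
begin

lemma L2_imp_L2B: "L2 M f \<Longrightarrow> L2B M d f"
  unfolding L2_def L2B_def set_integrable_def
  by (intro conjI allI impI integrable_mult_indicator qball_meas) auto

text \<open>Reduces closure properties of the local space to those of \<open>L2\<close> for
  truncated functions.\<close>

lemma L2B_iff_L2:
  fixes f :: "'a \<Rightarrow> complex"
  shows "L2B M d f \<longleftrightarrow> f \<in> borel_measurable M \<and>
    (\<forall>x. \<forall>r>0. L2 M (\<lambda>y. indicator (qball d x r) y *\<^sub>R f y))"
proof -
  have "(norm (indicator (qball d x r) y *\<^sub>R f y))\<^sup>2 = indicator (qball d x r) y *\<^sub>R (norm (f y))\<^sup>2" for x r y
    by (simp add: indicator_def)
  moreover have "(\<lambda>y. indicat_real (qball d x r) y *\<^sub>R f y) \<in> borel_measurable M" if "f \<in> borel_measurable M" for x r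
    using that by measurable
  ultimately show ?thesis by (auto simp: L2B_def L2_def set_integrable_def)
qed

lemma L2B_diff:
  fixes f g :: "'a \<Rightarrow> complex"
  shows "L2B M d f \<Longrightarrow> L2B M d g \<Longrightarrow> L2B M d (\<lambda>x. f x - g x)"
  unfolding L2B_iff_L2 by (auto simp: scaleR_right_diff_distrib intro!: L2_diff)

lemma L2B_sum:
  fixes f :: "'j \<Rightarrow> 'a \<Rightarrow> complex"
  assumes "finite F" "\<And>j. j \<in> F \<Longrightarrow> L2B M d (f j)"
  shows "L2B M d (\<lambda>x. \<Sum>j\<in>F. f j x)"
  unfolding L2B_iff_L2
proof (intro conjI allI impI)
  show "(\<lambda>x. \<Sum>j\<in>F. f j x) \<in> borel_measurable M"
    using assms by (intro borel_measurable_sum) (simp add: L2B_def)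
  fix x and r :: real assume "0 < r"
  then show "L2 M (\<lambda>y. indicat_real (qball d x r) y *\<^sub>R (\<Sum>j\<in>F. f j y))"
    unfolding scaleR_sum_right using assms by (intro L2_sum) (simp_all add: L2B_iff_L2)
qed

text \<open>Along an exhausting sequence, Fatou's lemma on a ball shows that the pointwise limit has
  distance 0 from the local limit; countably many balls cover the space.\<close>

lemma has_sum_L2B_pointwise_AE:
  fixes f g :: "'a \<Rightarrow> complex"
  assumes f: "has_sum_L2B M d t J f" and J: "countable J" and g: "g \<in> borel_measurable M"
    and pw: "\<And>x. ((\<lambda>j. t j x) has_sum g x) J"
  shows "AE x in M. f x = g x"
proof -
  obtain Fn where Fn: "filterlim Fn (finite_subsets_at_top J) sequentially"
    "\<And>n. finite (Fn n)" "\<And>n. Fn n \<subseteq> J"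
    using countable_finite_exhaustion[OF J] by blast
  define h where "h n x = (\<Sum>j\<in>Fn n. t j x) - f x" for n x
  have hB: "L2B M d (h n)" for n
    unfolding h_def[abs_def] using f Fn by (intro L2B_diff L2B_sum) (auto simp: has_sum_L2B_def subset_iff)
  have lim: "(\<lambda>n. h n x) \<longlonglongrightarrow> g x - f x" for x
    unfolding h_def by (intro tendsto_diff tendsto_const filterlim_compose[OF pw[unfolded has_sum_def] Fn(1)])
  have fm: "f \<in> borel_measurable M" and hm: "\<And>n. h n \<in> borel_measurable M"
    using f hB by (auto simp: has_sum_L2B_def L2B_def)
  note [measurable] = fm hm g
  have ball: "AE y in M. y \<in> qball d x r \<longrightarrow> f y = g y" if r: "0 < r" for x r
  proof -
    let ?B = "qball d x r"
    define u where "u n y = ennreal (indicator ?B y * (cmod (h n y))\<^sup>2)" for n y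
    have um: "u n \<in> borel_measurable M" for n unfolding u_def[abs_def] by measurable
    have int: "integral\<^sup>N M (u n) = ennreal ((L2_norm_on M ?B (h n))\<^sup>2)" for n
    proof -
      have i: "integrable M (\<lambda>y. indicator ?B y * (cmod (h n y))\<^sup>2)"
        using hB[of n] r by (auto simp: L2B_def set_integrable_def)
      have "0 \<le> (LINT y|M. indicator ?B y * (cmod (h n y))\<^sup>2)"
        by (intro Bochner_Integration.integral_nonneg) auto
      then have "(L2_norm_on M ?B (h n))\<^sup>2 = (LINT y|M. indicator ?B y * (cmod (h n y))\<^sup>2)"
        by (simp add: L2_norm_on_def set_lebesgue_integral_def)
      then show ?thesis unfolding u_def by (subst nn_integral_eq_integral[OF i]) auto
    qed
    have "((\<lambda>F. L2_norm_on M ?B (\<lambda>y. (\<Sum>j\<in>F. t j y) - f y)) \<longlongrightarrow> 0) (finite_subsets_at_top J)"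
      using f r by (auto simp: has_sum_L2B_def)
    then have "(\<lambda>n. L2_norm_on M ?B (h n)) \<longlonglongrightarrow> 0"
      unfolding h_def[abs_def] by (rule filterlim_compose[OF _ Fn(1)])
    then have "(\<lambda>n. ennreal ((L2_norm_on M ?B (h n))\<^sup>2)) \<longlonglongrightarrow> ennreal (0\<^sup>2)"
      by (intro tendsto_ennrealI tendsto_power)
    then have l0: "liminf (\<lambda>n. integral\<^sup>N M (u n)) = 0"
      unfolding int by (intro lim_imp_Liminf) auto
    have "liminf (\<lambda>n. u n y) = ennreal (indicator ?B y * (cmod (g y - f y))\<^sup>2)" for y
      unfolding u_def by (intro lim_imp_Liminf tendsto_ennrealI tendsto_mult tendsto_power tendsto_norm lim tendsto_const) simp
    then have "(\<integral>\<^sup>+y. ennreal (indicator ?B y * (cmod (g y - f y))\<^sup>2) \<partial>M) \<le> 0"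
      using nn_integral_liminf[of u M, OF um] l0 by simp
    then have "AE y in M. ennreal (indicator ?B y * (cmod (g y - f y))\<^sup>2) = 0"
      by (subst (asm) le_zero_eq, subst (asm) nn_integral_0_iff_AE) auto
    then show ?thesis by (rule AE_mp) (auto simp: indicator_def split: if_splits)
  qed
  \<comment> \<open>\<open>undefined\<close> merely names some base point; concentric balls of
    integer radii exhaust the space.\<close>
  have "AE y in M. \<forall>n::nat. y \<in> qball d undefined (Suc n) \<longrightarrow> f y = g y"
    using ball by (subst AE_all_countable) auto
  then show ?thesis
  proof (rule AE_mp, intro AE_I2 impI)
    fix y assume *: "\<forall>n::nat. y \<in> qball d undefined (Suc n) \<longrightarrow> f y = g y"
    obtain n :: nat where "d undefined y < real n" using reals_Archimedean2 by blast
    then have "y \<in> qball d undefined (Suc n)" by (simp add: qball_iff)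
    then show "f y = g y" using * by blast
  qed
qed

end

section \<open>The wavelet expansion of a Lipschitz function\<close>

context wavelet_system
begin

text \<open>Level k contributes about 1 / V_k(x) times a high power of 1 / (1 + d x y / \<delta>^k).
  The first factor grows at most polynomially in \<delta>^(-k), while for
  \<open>1 \<le> d x y\<close> the second is a high power of \<delta>^k / (1 + d x y), which wins
  and leaves a geometric series.\<close>

lemma kernel_decay:
  "\<exists>K\<ge>1. \<forall>x y F. finite F \<longrightarrow> F \<subseteq> J0 \<longrightarrow> 1 \<le> d x y \<longrightarrow>
    (\<Sum>j\<in>F. \<bar>wv j x\<bar> * \<bar>wv j y\<bar>) \<le> K / (vol x 1 * rdist 1 x y ^ m)"
proof -
  \<comment> \<open>\<open>hdim\<close> powers of the scale are spent on the small volumes, and one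
    of the others makes the sum over levels geometric. The decay in \<open>rdist 1 x y\<close> is
    only needed to order m.\<close>
  define p where "p = hdim + Suc m"
  obtain KL n where KL: "1 \<le> KL" "\<And>k x F. finite F \<Longrightarrow> F \<subseteq> J0 \<Longrightarrow> \<forall>j\<in>F. level j = k \<Longrightarrow>
    (\<Sum>j\<in>F. vol (cen j) (scale k) powr (-1) / ldist k x j ^ n) \<le> KL * vol x (scale k) powr (-1)"
    using level_sum[of "-1"] by blast
  obtain Kw where Kw: "1 \<le> Kw"
      "\<And>j x. j \<in> J0 \<Longrightarrow> \<bar>wv j x\<bar> \<le> Kw * jvol j powr (-1/2) / ldist (level j) x j ^ (n + p)"
    using wv_decay[of "n + p"] by blast
  define H where "H = Kw\<^sup>2 * A0 ^ p"
  have H: "0 \<le> H" using A0_ge_1 by (simp add: H_def)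
  define G where "G = H * KL * 2 ^ p * dconst"
  have G: "0 \<le> G" using H KL dconst_ge_1 by (simp add: G_def)
  define K where "K = 1 + G / (1 - \<delta>)"
  have K: "1 \<le> K" "G / (1 - \<delta>) \<le> K" using G \<delta>_less_1 by (auto simp: K_def)
  have term_le: "\<bar>wv j x\<bar> * \<bar>wv j y\<bar> \<le> H / rdist (jscale j) x y ^ p *
      (jvol j powr (-1) / ldist (level j) x j ^ n)" if j: "j \<in> J0" for j x y
  proof -
    let ?a = "ldist (level j) x j" and ?b = "ldist (level j) y j" and ?D = "rdist (jscale j) x y"
    have r: "1 \<le> ?a" "1 \<le> ?b" "1 \<le> ?D" using rdist_ge_1[OF scale_pos] by auto
    have "?D ^ p \<le> (A0 * ?a * ?b) ^ p"
      using rdist_triangle[OF scale_pos, of "level j" x y "cen j"] r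
      by (intro power_mono) (auto simp: rdist_sym[of _ "cen j"])
    also have "\<dots> = A0 ^ p * (?a ^ p * ?b ^ p)" by (simp add: power_mult_distrib)
    finally have "1 / (?a ^ p * ?b ^ p) \<le> A0 ^ p / ?D ^ p"
      using r by (simp add: divide_simps mult_ac)
    moreover have "1 / (?a ^ p * ?b ^ (n + p)) \<le> 1 / (?a ^ p * ?b ^ p)"
      using r by (intro divide_left_mono mult_left_mono power_increasing) auto
    ultimately have ab: "1 / (?a ^ p * ?b ^ (n + p)) \<le> A0 ^ p / ?D ^ p" by linarith
    have "\<bar>wv j x\<bar> * \<bar>wv j y\<bar> \<le> (Kw * jvol j powr (-1/2) / ?a ^ (n + p)) * (Kw * jvol j powr (-1/2) / ?b ^ (n + p))"
      using Kw r by (intro mult_mono Kw(2) j) auto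
    also have "\<dots> = Kw\<^sup>2 * ((jvol j powr (-1/2) * jvol j powr (-1/2)) / ?a ^ n) * (1 / (?a ^ p * ?b ^ (n + p)))"
      by (simp add: power_add power2_eq_square mult_ac)
    also have "jvol j powr (-1/2) * jvol j powr (-1/2) = jvol j powr (-1)"
      by (simp add: powr_add[symmetric])
    also have "Kw\<^sup>2 * (jvol j powr (-1) / ?a ^ n) * (1 / (?a ^ p * ?b ^ (n + p)))
        \<le> Kw\<^sup>2 * (jvol j powr (-1) / ?a ^ n) * (A0 ^ p / ?D ^ p)"
      using ab r by (intro mult_left_mono) auto
    finally show ?thesis by (simp add: H_def mult_ac)
  qed
  have lev: "(\<Sum>j\<in>F. \<bar>wv j x\<bar> * \<bar>wv j y\<bar>) \<le> G / (vol x 1 * rdist 1 x y ^ m) * \<delta> ^ nat k"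
    if F: "finite F" "F \<subseteq> J0" "\<forall>j\<in>F. level j = k" and k: "0 \<le> k" and xy: "1 \<le> d x y" for F k x y
  proof -
    let ?s = "scale k" and ?D = "rdist (scale k) x y" and ?r = "rdist 1 x y"
    have s: "0 < ?s" "?s \<le> 1" using scale_pos scale_le_1[OF k] by auto
    have v: "0 < vol x 1" "0 < vol x ?s" using vol_pos s by auto
    have r: "1 \<le> ?r" "1 \<le> ?D" using rdist_ge_1 s by auto
    have "(\<Sum>j\<in>F. \<bar>wv j x\<bar> * \<bar>wv j y\<bar>) \<le> (\<Sum>j\<in>F. H / ?D ^ p * (vol (cen j) ?s powr (-1) / rdist ?s x (cen j) ^ n))"
    proof (rule sum_mono)
      fix j assume j: "j \<in> F"
      then have "j \<in> J0" "level j = k" using F by auto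
      then show "\<bar>wv j x\<bar> * \<bar>wv j y\<bar> \<le> H / ?D ^ p * (vol (cen j) ?s powr (-1) / rdist ?s x (cen j) ^ n)"
        using term_le[of j x y] by simp
    qed
    also have "\<dots> = H / ?D ^ p * (\<Sum>j\<in>F. vol (cen j) ?s powr (-1) / rdist ?s x (cen j) ^ n)"
      by (rule sum_distrib_left[symmetric])
    also have "\<dots> \<le> H / ?D ^ p * (KL * vol x ?s powr (-1))"
      using H r by (intro mult_left_mono KL(2) F) auto
    also have "\<dots> = H * KL * ((1 / ?D ^ p) * (1 / vol x ?s))"
      using v by (simp add: powr_minus_divide)
    also have "\<dots> \<le> H * KL * (((2 * ?s) ^ p / ?r ^ p) * (dconst / (?s ^ hdim * vol x 1)))"
    proof (intro mult_left_mono mult_mono)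
      \<comment> \<open>Here \<open>1 \<le> d x y\<close> enters: 1 + d is at most 2d, so the
        distance at scale 1 is recovered from that at scale s with a gain of s.\<close>
      have "2 * ?s * ?D = 2 * ?s + 2 * d x y" using s by (simp add: rdist_def distrib_left)
      then have "?r \<le> 2 * ?s * ?D" using xy s by (simp add: rdist_def)
      then have "?r ^ p \<le> (2 * ?s * ?D) ^ p" using r by (intro power_mono) auto
      then show "1 / ?D ^ p \<le> (2 * ?s) ^ p / ?r ^ p"
        using r by (simp add: divide_simps power_mult_distrib)
      have "vol x (1 / ?s * ?s) \<le> dconst * (1 / ?s) powr upper_dim M d * vol x ?s"
        using s by (intro vol_scale) auto
      also have "\<dots> \<le> dconst * (1 / ?s) ^ hdim * vol x ?s"
        using s dconst_ge_1 upper_dim_le_hdim by (intro mult_right_mono mult_left_mono powr_le_power) auto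
      finally have "vol x 1 \<le> dconst / ?s ^ hdim * vol x ?s" using s by (simp add: power_one_over field_simps)
      then show "1 / vol x ?s \<le> dconst / (?s ^ hdim * vol x 1)"
        using v s by (simp add: divide_simps mult_ac)
    qed (use H KL s v r in auto)
    also have "\<dots> = G / vol x 1 * ?s ^ Suc m * (1 / ?r ^ p)"
      using s by (simp add: G_def p_def power_mult_distrib power_add mult_ac)
    also have "\<dots> \<le> G / vol x 1 * ?s * (1 / ?r ^ m)"
    proof (intro mult_mono)
      show "?s ^ Suc m \<le> ?s" using power_decreasing[of 1 "Suc m" ?s] s by simp
      show "1 / ?r ^ p \<le> 1 / ?r ^ m"
        using r by (intro divide_left_mono power_increasing) (auto simp: p_def)
    qed (use G v s r in auto)
    also have "?s = \<delta> ^ nat k" using scale_add_nat[of 0 "nat k"] k by simp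
    finally show ?thesis by (simp add: mult_ac)
  qed
  have "(\<Sum>j\<in>F. \<bar>wv j x\<bar> * \<bar>wv j y\<bar>) \<le> K / (vol x 1 * rdist 1 x y ^ m)"
    if F: "finite F" "F \<subseteq> J0" and xy: "1 \<le> d x y" for F x y
  proof -
    let ?V = "vol x 1 * rdist 1 x y ^ m"
    have V: "0 < ?V" using vol_pos[of 1 x] rdist_pos[of 1 x y] by simp
    have "(\<Sum>j\<in>F. \<bar>wv j x\<bar> * \<bar>wv j y\<bar>) = (\<Sum>k\<in>level ` F. \<Sum>j\<in>{j\<in>F. level j = k}. \<bar>wv j x\<bar> * \<bar>wv j y\<bar>)"
      using F(1) by (rule sum.image_gen)
    also have "\<dots> \<le> (\<Sum>k\<in>level ` F. G / ?V * \<delta> ^ nat k)"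
      using F level_nonneg xy by (intro sum_mono lev) auto
    also have "\<dots> = G / ?V * (\<Sum>k\<in>level ` F. \<delta> ^ nat k)" by (rule sum_distrib_left[symmetric])
    \<comment> \<open>Levels are reflected to nonpositive ones, the direction in which
      \<open>sum_geometric_int_le\<close> counts.\<close>
    also have "(\<Sum>k\<in>level ` F. \<delta> ^ nat k) = (\<Sum>k\<in>uminus ` level ` F. \<delta> ^ nat (0 - k))"
      by (subst sum.reindex) auto
    also have "G / ?V * (\<Sum>k\<in>uminus ` level ` F. \<delta> ^ nat (0 - k)) \<le> G / ?V * (1 / (1 - \<delta>))"
      using F level_nonneg G V by (intro mult_left_mono sum_geometric_int_le \<delta>_pos \<delta>_less_1) auto
    also have "\<dots> = G / (1 - \<delta>) / ?V" by simp
    also have "\<dots> \<le> K / ?V" using K V by (intro divide_right_mono) auto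
    finally show ?thesis .
  qed
  then show ?thesis using K(1) by blast
qed

lemma lip_pairing:
  assumes "0 < \<theta>" "0 \<le> N" "g \<in> borel_measurable M" "lip_bound \<theta> N g" "j \<in> J0"
  shows "integrable M (\<lambda>x. g x * cwv j x)"
  using lip_coefficients[OF assms(1)] assms unfolding pairing_converges_def by blast

text \<open>The far part of g need not be square integrable, so its partial sums are estimated as
  integrals of g against the kernel of \<open>kernel_decay\<close>. That bound holds for all finite
  F at once, and so does the smallness.\<close>

lemma far_part_small:
  assumes \<theta>: "0 < \<theta>" and N: "0 \<le> N" and g: "g \<in> borel_measurable M" and b: "lip_bound \<theta> N g"
    and r: "0 < r" and \<epsilon>: "0 < \<epsilon>"
  obtains R where "r \<le> R" "\<And>F y. finite F \<Longrightarrow> F \<subseteq> J0 \<Longrightarrow> y \<in> qball d x0 r \<Longrightarrow>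
    cmod (partial_sum M wv F (\<lambda>x. indicator (- qball d x0 R) x *\<^sub>R g x) y) \<le> \<epsilon>"
proof -
  obtain Kg n where Kg: "1 \<le> Kg" "\<And>N g p x R. 0 < R \<Longrightarrow> 0 \<le> N \<Longrightarrow> lip_bound \<theta> N g \<Longrightarrow>
    cmod (g x - g p) \<le> Kg * N * rdist R x p ^ n * vol p R powr \<theta> \<and>
    (1 \<le> R \<longrightarrow> cmod (g x) \<le> Kg * N * rdist R x p ^ n * vol p R powr \<theta>)"
    using lip_bound_growth[OF \<theta>] by blast
  define m where "m = Suc hdim"
  \<comment> \<open>In the exponent, n cancels the growth of g, m makes the integral converge, and
    the remaining power of the distance supplies the small factor 1 / T.\<close>
  obtain K where K: "1 \<le> K" "\<And>x y F. finite F \<Longrightarrow> F \<subseteq> J0 \<Longrightarrow> 1 \<le> d x y \<Longrightarrow>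
    (\<Sum>j\<in>F. \<bar>wv j x\<bar> * \<bar>wv j y\<bar>) \<le> K / (vol x 1 * rdist 1 x y ^ (n + Suc m))"
    using kernel_decay[of "n + Suc m"] by blast
  define G where "G = Kg * N * K * 2 ^ Suc m * vol x0 (A0 * (r + 1)) powr \<theta>"
  have G: "0 \<le> G" using Kg K N by (simp add: G_def)
  \<comment> \<open>T is the distance to be kept from the ball of radius r; \<open>1 \<le> T\<close>
    is what \<open>kernel_decay\<close> requires.\<close>
  define T where "T = max 1 (G / \<epsilon>)"
  have T: "1 \<le> T" "G / T \<le> \<epsilon>"
  proof -
    have "G / \<epsilon> \<le> T" "0 < T" by (auto simp: T_def)
    then show "G / T \<le> \<epsilon>" using \<epsilon> by (simp add: divide_simps mult.commute)
  qed (simp add: T_def)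
  \<comment> \<open>By the quasi-triangle inequality, points outside the ball of radius R have
    distance at least T from each point of the ball of radius r.\<close>
  define R where "R = A0 * (T + r)"
  have "1 * (T + r) \<le> R" unfolding R_def using A0_ge_1 T r by (intro mult_right_mono) auto
  then have rR: "r \<le> R" using T(1) by simp
  let ?g2 = "\<lambda>x. indicator (- qball d x0 R) x *\<^sub>R g x"
  have "cmod (partial_sum M wv F ?g2 y) \<le> \<epsilon>" if F: "finite F" "F \<subseteq> J0" and y: "y \<in> qball d x0 r" for F y
  proof -
    have V: "0 < vol y 1" by (rule vol_pos) simp
    define h where "h x = (\<Sum>j\<in>F. ?g2 x * cwv j x * cwv j y)" for x
    have gi: "integrable M (\<lambda>x. ?g2 x * cwv j x)" if "j \<in> F" for j
    proof -
      have "integrable M (\<lambda>x. indicator (- qball d x0 R) x *\<^sub>R (g x * cwv j x))"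
        using lip_pairing[OF \<theta> N g b, of j] that F
        by (intro integrable_mult_indicator) (auto simp: space_M Compl_eq_Diff_UNIV sets.compl_sets[of _ M, unfolded space_M])
      then show ?thesis by simp
    qed
    have hm: "h \<in> borel_measurable M"
      unfolding h_def[abs_def]
      by (intro borel_measurable_sum borel_measurable_times[OF borel_measurable_integrable[OF gi] borel_measurable_const])
    have "integral\<^sup>L M h = (\<Sum>j\<in>F. LINT x|M. ?g2 x * cwv j x * cwv j y)"
      unfolding h_def by (rule Bochner_Integration.integral_sum) (rule integrable_mult_left[OF gi])
    also have "\<dots> = partial_sum M wv F ?g2 y"
      unfolding partial_sum_def pairing_def by (intro sum.cong refl integral_mult_left_zero)
    finally have "partial_sum M wv F ?g2 y = integral\<^sup>L M h" by (rule sym)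
    moreover have "cmod (integral\<^sup>L M h) \<le> (Kg * N * K * vol y 1 powr (\<theta> - 1) / T) * (2 ^ Suc m * vol y 1)"
    proof (rule integrable_of_decay(2)[OF hm])
      fix x
      have rd: "1 \<le> rdist 1 x y" by (rule rdist_ge_1) simp
      show "cmod (h x) \<le> (Kg * N * K * vol y 1 powr (\<theta> - 1) / T) / rdist 1 x y ^ m"
      proof (cases "x \<in> qball d x0 R")
        case True
        then show ?thesis using Kg K N T rd by (simp add: h_def)
      next
        case False
        have "R \<le> d x0 x" using False by (simp add: qball_iff)
        also have "\<dots> \<le> A0 * (d x0 y + d y x)" by (rule quasi_triangle)
        finally have "T + r \<le> d x0 y + d y x" unfolding R_def using A0_ge_1 by simp
        then have far: "T \<le> d y x" using y by (simp add: qball_iff)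
        have "cmod (h x) \<le> (\<Sum>j\<in>F. cmod (g x) * (\<bar>wv j y\<bar> * \<bar>wv j x\<bar>))"
          unfolding h_def using False
          by (intro order_trans[OF norm_sum] sum_mono) (simp add: norm_mult mult_ac)
        also have "\<dots> = cmod (g x) * (\<Sum>j\<in>F. \<bar>wv j y\<bar> * \<bar>wv j x\<bar>)" by (rule sum_distrib_left[symmetric])
        also have "\<dots> \<le> (Kg * N * rdist 1 x y ^ n * vol y 1 powr \<theta>) * (K / (vol y 1 * rdist 1 y x ^ (n + Suc m)))"
        proof (intro mult_mono)
          show "cmod (g x) \<le> Kg * N * rdist 1 x y ^ n * vol y 1 powr \<theta>" using Kg(2)[OF _ N b, of 1 x y] by simp
          show "(\<Sum>j\<in>F. \<bar>wv j y\<bar> * \<bar>wv j x\<bar>) \<le> K / (vol y 1 * rdist 1 y x ^ (n + Suc m))"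
            using far T F by (intro K) auto
        qed (use Kg N rd in \<open>auto intro!: sum_nonneg\<close>)
        also have "\<dots> = Kg * N * K * (vol y 1 powr \<theta> / vol y 1) / rdist 1 x y * (1 / rdist 1 x y ^ m)"
          using rd by (simp add: power_add rdist_sym[of 1 y] mult_ac)
        also have "vol y 1 powr \<theta> / vol y 1 = vol y 1 powr (\<theta> - 1)"
          using V by (simp add: powr_diff)
        also have "Kg * N * K * vol y 1 powr (\<theta> - 1) / rdist 1 x y * (1 / rdist 1 x y ^ m)
            \<le> Kg * N * K * vol y 1 powr (\<theta> - 1) / T * (1 / rdist 1 x y ^ m)"
          using far T Kg K N rd by (intro mult_right_mono divide_left_mono) (auto simp: rdist_def d_sym[of x])
        finally show ?thesis by simp
      qed
    qed (auto simp: m_def)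
    moreover have "(Kg * N * K * vol y 1 powr (\<theta> - 1) / T) * (2 ^ Suc m * vol y 1) \<le> G / T"
    proof -
      have "vol y 1 powr (\<theta> - 1) * vol y 1 = vol y 1 powr \<theta>" using V by (simp add: powr_diff)
      also have "\<dots> \<le> vol x0 (A0 * (r + 1)) powr \<theta>"
      proof (intro powr_mono2 vol_subset subsetI)
        fix z assume "z \<in> qball d y 1"
        then have "A0 * (d x0 y + d y z) < A0 * (r + 1)"
          using y A0_ge_1 by (intro mult_strict_left_mono) (auto simp: qball_iff)
        then show "z \<in> qball d x0 (A0 * (r + 1))" using quasi_triangle[of x0 z y] by (simp add: qball_iff)
      qed (use \<theta> in auto)
      finally have "Kg * N * K * 2 ^ Suc m / T * (vol y 1 powr (\<theta> - 1) * vol y 1)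
          \<le> Kg * N * K * 2 ^ Suc m / T * vol x0 (A0 * (r + 1)) powr \<theta>"
        using Kg K N T by (intro mult_left_mono) auto
      then show ?thesis by (simp add: G_def mult_ac)
    qed
    ultimately show ?thesis using T(2) by simp
  qed
  with rR that show thesis by blast
qed

lemma pairing_AE_cong:
  assumes "f \<in> borel_measurable M" "g \<in> borel_measurable M" "AE x in M. f x = g x" "j \<in> J0"
  shows "coef f j = coef g j"
    and "pairing_converges M f (wv j) \<longleftrightarrow> pairing_converges M g (wv j)"
proof -
  note [measurable] = assms(1,2) wv_measurable[OF assms(4)]
  have ae: "AE x in M. f x * cwv j x = g x * cwv j x"
    using assms(3) by auto
  show "coef f j = coef g j"
    unfolding pairing_def by (rule integral_cong_AE[OF _ _ ae]) measurable
  show "pairing_converges M f (wv j) \<longleftrightarrow> pairing_converges M g (wv j)"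
    unfolding pairing_converges_def by (rule integrable_cong_AE[OF _ _ ae]) measurable
qed

text \<open>The radius R of the truncation is fixed before F: it makes the far part small for every
  F, and only then is F taken large enough for the truncated function.\<close>

lemma lip_wavelet_expansion:
  assumes \<theta>: "0 < \<theta>" and N: "0 \<le> N" and g: "g \<in> borel_measurable M" and b: "lip_bound \<theta> N g"
    and f: "L2B M d f" and fg: "AE x in M. f x = g x"
  shows "expands f"
proof -
  have fm: "f \<in> borel_measurable M" using f by (simp add: L2B_def)
  note pair = pairing_AE_cong[OF fm g fg]
  have conv: "pairing_converges M f (wv j)" if "j \<in> J0" for j
    using pair(2)[OF that] lip_pairing[OF \<theta> N g b that] by (simp add: pairing_converges_def)
  have tB: "L2B M d (\<lambda>x. coef f j * cwv j x)" if "j \<in> J0" for j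
    by (rule L2_imp_L2B[OF L2_cmult_real[OF L2_wv[OF that]]])
  have "((\<lambda>F. L2_norm_on M (qball d x0 r)
      (\<lambda>y. (\<Sum>j\<in>F. coef f j * cwv j y) - f y)) \<longlongrightarrow> 0) (finite_subsets_at_top J0)"
    if r: "0 < r" for x0 r
  proof (rule order_tendstoI)
    fix a :: real assume "a < 0"
    moreover have "0 \<le> L2_norm_on M (qball d x0 r) h" for h :: "'a \<Rightarrow> complex"
      unfolding L2_norm_on_def set_lebesgue_integral_def
      by (intro real_sqrt_ge_zero Bochner_Integration.integral_nonneg) auto
    ultimately show "\<forall>\<^sub>F F in finite_subsets_at_top J0. a < L2_norm_on M (qball d x0 r)
        (\<lambda>y. (\<Sum>j\<in>F. coef f j * cwv j y) - f y)"
      by (intro always_eventually allI) (rule less_le_trans)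
  next
    fix \<epsilon> :: real assume \<epsilon>: "0 < \<epsilon>"
    let ?B = "qball d x0 r"
    define v where "v = vol x0 r"
    have v: "0 \<le> v" by (simp add: v_def)
    \<comment> \<open>Bounded by \<epsilon>' on a ball of volume v, the far part contributes at most
      half of \<epsilon>^2, including the factor 2 of \<open>norm_add_square_le\<close>;
      \<open>v + 1\<close> keeps the denominator positive.\<close>
    define \<epsilon>' where "\<epsilon>' = \<epsilon> / (2 * sqrt (v + 1))"
    have \<epsilon>': "0 < \<epsilon>'" using \<epsilon> v by (simp add: \<epsilon>'_def)
    have "\<epsilon>'\<^sup>2 = \<epsilon>\<^sup>2 / (4 * (v + 1))" using v by (simp add: \<epsilon>'_def power_divide power_mult_distrib)
    then have "v * \<epsilon>'\<^sup>2 + \<epsilon>'\<^sup>2 = \<epsilon>\<^sup>2 / 4" using v by (simp add: field_simps)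
    then have "v * \<epsilon>'\<^sup>2 \<le> \<epsilon>\<^sup>2 / 4" using zero_le_power2[of \<epsilon>'] by linarith
    then have \<epsilon>'2: "2 * \<epsilon>'\<^sup>2 * v \<le> \<epsilon>\<^sup>2 / 2" by (simp add: mult_ac)
    obtain R where R: "r \<le> R" and far: "\<And>F y. finite F \<Longrightarrow> F \<subseteq> J0 \<Longrightarrow> y \<in> qball d x0 r \<Longrightarrow>
        cmod (partial_sum M wv F (\<lambda>x. indicator (- qball d x0 R) x *\<^sub>R g x) y) \<le> \<epsilon>'"
      using far_part_small[OF \<theta> N g b r \<epsilon>'] by metis
    define g1 where "g1 x = indicator (qball d x0 R) x *\<^sub>R g x" for x
    define g2 where "g2 x = indicator (- qball d x0 R) x *\<^sub>R g x" for x
    have "0 < R" using r R by simp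
    then have g1: "L2 M g1"
      using lip_bound_L2B[OF g b] unfolding L2B_iff_L2 g1_def[abs_def] by blast
    have sum: "(\<Sum>j\<in>F. coef f j * cwv j y) = partial_sum M wv F g1 y + partial_sum M wv F g2 y"
      if "F \<subseteq> J0" for F y
    proof -
      have "coef f j = pairing M g1 (wv j) + pairing M g2 (wv j)" if j: "j \<in> J0" for j
      proof -
        have i: "integrable M (\<lambda>x. g x * cwv j x)" by (rule lip_pairing[OF \<theta> N g b j])
        have i1: "integrable M (\<lambda>x. g1 x * cwv j x)"
          by (rule integrable_L2_mult[OF g1 L2_wv[OF j]])
        have eq: "g2 x * cwv j x = g x * cwv j x - g1 x * cwv j x" for x
          by (simp add: g1_def g2_def indicator_def)
        have "pairing M g2 (wv j) = coef g j - pairing M g1 (wv j)"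
          unfolding pairing_def eq using i i1 by (rule Bochner_Integration.integral_diff)
        then show ?thesis using pair(1)[OF j] by simp
      qed
      then show ?thesis
        using that by (simp add: partial_sum_def sum.distrib[symmetric] distrib_right[symmetric] subset_iff)
    qed
    \<comment> \<open>A quarter of \<epsilon>^2 becomes, through the same factor 2, the other
      half.\<close>
    have "\<forall>\<^sub>F F in finite_subsets_at_top J0. (LINT x|M. (norm (g1 x - partial_sum M wv F g1 x))\<^sup>2) < \<epsilon>\<^sup>2 / 4"
      using \<epsilon> by (intro order_tendstoD(2)[OF partial_sum_converges[OF orthonormal_basis g1]]) simp
    moreover have "\<forall>\<^sub>F F in finite_subsets_at_top J0. finite F \<and> F \<subseteq> J0"
      by (rule eventually_finite_subsets_at_top_weakI) simp
    ultimately show "\<forall>\<^sub>F F in finite_subsets_at_top J0. L2_norm_on M (qball d x0 r)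
        (\<lambda>y. (\<Sum>j\<in>F. coef f j * cwv j y) - f y) < \<epsilon>"
    proof eventually_elim
      case (elim F)
      then have F: "finite F" "F \<subseteq> J0" by auto
      let ?h = "\<lambda>y. (\<Sum>j\<in>F. coef f j * cwv j y) - f y"
      let ?u = "\<lambda>y. (norm (g1 y - partial_sum M wv F g1 y))\<^sup>2"
      have "L2 M (\<lambda>y. g1 y - partial_sum M wv F g1 y)"
        using F by (intro L2_diff g1 L2_partial_sum L2_wv) auto
      then have ui: "integrable M ?u" by (simp add: L2_def)
      have Bi: "integrable M (\<lambda>y. indicator ?B y * (2 * \<epsilon>'\<^sup>2) :: real)"
        using fmeasurable_qball[of x0 r] by (auto simp: fmeasurable_def)
      have "(LINT y:?B|M. (cmod (?h y))\<^sup>2) \<le> (LINT y|M. 2 * ?u y + indicator ?B y * (2 * \<epsilon>'\<^sup>2))"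
        unfolding set_lebesgue_integral_def
      proof (rule integral_mono_AE')
        show "integrable M (\<lambda>y. 2 * ?u y + indicator ?B y * (2 * \<epsilon>'\<^sup>2))"
          using ui Bi by (intro Bochner_Integration.integrable_add integrable_mult_right)
        show "AE y in M. indicat_real ?B y *\<^sub>R (cmod (?h y))\<^sup>2 \<le> 2 * ?u y + indicator ?B y * (2 * \<epsilon>'\<^sup>2)"
          using fg
        proof eventually_elim
          case (elim y)
          show ?case
          proof (cases "y \<in> ?B")
            case True
            then have "g1 y = g y" using R by (simp add: g1_def qball_iff)
            then have "?h y = partial_sum M wv F g2 y + - (g1 y - partial_sum M wv F g1 y)"
              using sum[OF F(2)] elim by simp
            then have "(cmod (?h y))\<^sup>2 \<le> 2 * (cmod (partial_sum M wv F g2 y))\<^sup>2 + 2 * ?u y"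
              using norm_add_square_le[of "partial_sum M wv F g2 y" "- (g1 y - partial_sum M wv F g1 y)"]
              by (simp add: norm_minus_commute)
            moreover have "(cmod (partial_sum M wv F g2 y))\<^sup>2 \<le> \<epsilon>'\<^sup>2"
              using far[OF F True] unfolding g2_def[abs_def] by (intro power_mono) auto
            ultimately show ?thesis using True by simp
          qed simp
        qed
        show "AE y in M. 0 \<le> 2 * ?u y + indicator ?B y * (2 * \<epsilon>'\<^sup>2)" by auto
      qed
      also have "\<dots> = 2 * (LINT y|M. ?u y) + 2 * \<epsilon>'\<^sup>2 * v"
        using ui Bi by (subst Bochner_Integration.integral_add) (auto simp: v_def vol_def space_M)
      also have "\<dots> < \<epsilon>\<^sup>2" using elim \<epsilon>'2 by linarith
      finally have "sqrt (LINT y:?B|M. (cmod (?h y))\<^sup>2) < sqrt (\<epsilon>\<^sup>2)" by (rule real_sqrt_less_mono)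
      then show "L2_norm_on M ?B ?h < \<epsilon>" using \<epsilon> by (simp add: L2_norm_on_def)
    qed
  qed
  then show ?thesis
    unfolding wavelet_expansion_def has_sum_L2B_def using conv tB f by blast
qed

section \<open>The two implications and the comparison of norms\<close>

lemma lip_imp_expansion:
  assumes \<theta>: "0 < \<theta>"
  shows "\<exists>K\<ge>1. \<forall>N f g. 0 \<le> N \<longrightarrow> g \<in> borel_measurable M \<longrightarrow> lip_bound \<theta> N g \<longrightarrow> L2B M d f \<longrightarrow>
    (AE x in M. f x = g x) \<longrightarrow>
    expands f \<and> star \<theta> f \<le> ennreal (K * N)"
proof -
  obtain Kc where Kc: "1 \<le> Kc" "\<forall>N g. 0 \<le> N \<longrightarrow> g \<in> borel_measurable M \<longrightarrow> lip_bound \<theta> N g \<longrightarrow> (\<forall>j\<in>J0.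
    pairing_converges M g (wv j) \<and> cmod (coef g j) \<le> Kc * N * jvol j powr (1/2 + \<theta>))"
    using lip_coefficients[OF \<theta>] by (elim exE conjE)
  obtain Ks where Ks: "1 \<le> Ks" "\<forall>N f. 0 \<le> N \<longrightarrow>
    (\<forall>j\<in>J0. cmod (coef f j) \<le> N * jvol j powr (1/2 + \<theta>)) \<longrightarrow>
    star \<theta> f \<le> ennreal (Ks * N)"
    using star_norm_bound[OF \<theta>] by (elim exE conjE)
  have "expands f \<and> star \<theta> f \<le> ennreal (Ks * Kc * N)"
    if N: "0 \<le> N" and g: "g \<in> borel_measurable M" and b: "lip_bound \<theta> N g" and f: "L2B M d f"
      and fg: "AE x in M. f x = g x" for N f g
  proof -
    have fm: "f \<in> borel_measurable M" using f by (simp add: L2B_def)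
    have "\<forall>j\<in>J0. cmod (coef f j) \<le> Kc * N * jvol j powr (1/2 + \<theta>)"
      using Kc(2)[rule_format, OF N g b] pairing_AE_cong(1)[OF fm g fg] by simp
    moreover have "0 \<le> Kc * N" using Kc N by simp
    ultimately have "star \<theta> f \<le> ennreal (Ks * (Kc * N))"
      using Ks(2) by blast
    then show ?thesis using lip_wavelet_expansion[OF \<theta> N g b f fg] by (simp add: mult.assoc)
  qed
  moreover have "1 \<le> Ks * Kc" using mult_mono[of 1 Ks 1 Kc] Ks Kc by auto
  ultimately show ?thesis by blast
qed

text \<open>Only the sizes of the coefficients enter the construction of g; the expansion in
  \<open>L2B\<close> is what identifies f with g almost everywhere.\<close>

lemma expansion_imp_lip:
  assumes \<theta>: "0 < \<theta>" "\<theta> < \<eta> / upper_dim M d"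
  shows "\<exists>K\<ge>1. \<forall>N f. 0 \<le> N \<longrightarrow> expands f \<longrightarrow>
    star \<theta> f \<le> ennreal N \<longrightarrow>
    (\<exists>g\<in>borel_measurable M. lip_bound \<theta> (K * N) g \<and> (AE x in M. f x = g x))"
proof -
  obtain Kt where Kt: "1 \<le> Kt" "\<forall>N f. 0 \<le> N \<longrightarrow> star \<theta> f \<le> ennreal N \<longrightarrow>
    (\<forall>j\<in>J0. cmod (coef f j) \<le> Kt * N * jvol j powr (1/2 + \<theta>))"
    using coefficients_le_star_norm[OF \<theta>(1)] by (elim exE conjE)
  obtain Kg where Kg: "1 \<le> Kg" "\<forall>N c. 0 \<le> N \<longrightarrow> coef_bound \<theta> N c \<longrightarrow>
    (\<exists>g\<in>borel_measurable M. lip_bound \<theta> (Kg * N) g \<and>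
      (\<forall>x. ((\<lambda>j. c j * cwv j x) has_sum g x) J0))"
    using synthesis[OF \<theta>] by (elim exE conjE)
  have "\<exists>g\<in>borel_measurable M. lip_bound \<theta> (Kg * Kt * N) g \<and> (AE x in M. f x = g x)"
    if N: "0 \<le> N" and ex: "expands f"
      and st: "star \<theta> f \<le> ennreal N" for N f
  proof -
    let ?c = "\<lambda>j. coef f j"
    have "0 \<le> Kt * N" using Kt N by simp
    moreover have "\<forall>j\<in>J0. cmod (?c j) \<le> Kt * N * jvol j powr (1/2 + \<theta>)" using Kt(2) N st by blast
    ultimately obtain g where g: "g \<in> borel_measurable M" "lip_bound \<theta> (Kg * (Kt * N)) g"
      "\<forall>x. ((\<lambda>j. ?c j * cwv j x) has_sum g x) J0"
      using Kg(2)[rule_format, of "Kt * N" ?c] by blast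
    have "AE x in M. f x = g x"
      using ex g(3) unfolding wavelet_expansion_def
      by (intro has_sum_L2B_pointwise_AE[OF _ countable_J0 g(1)]) auto
    then show ?thesis using g by (auto simp: mult.assoc)
  qed
  moreover have "1 \<le> Kg * Kt" using mult_mono[of 1 Kg 1 Kt] Kg Kt by auto
  ultimately show ?thesis by blast
qed

end

theorem theorem1p1:
  fixes M :: "'a measure" and d :: "'a \<Rightarrow> 'a \<Rightarrow> real" and A0 c0 C0 \<delta> :: real
    and A :: "int \<Rightarrow> 'i set" and pt :: "int \<Rightarrow> 'i \<Rightarrow> 'a" and Q :: "int \<Rightarrow> 'i \<Rightarrow> 'a set"
    and \<phi> \<psi> :: "int \<Rightarrow> 'i \<Rightarrow> 'a \<Rightarrow> real" and s \<eta> \<nu> Cw \<theta> :: real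
  assumes "wavelet_system M d A0 c0 C0 \<delta> A pt Q \<phi> \<psi> s \<eta> \<nu> Cw"
    and "0 < \<theta>" and "\<theta> < \<eta> / upper_dim M d"
  shows "(\<forall>f :: 'a \<Rightarrow> complex. L2B M d f \<longrightarrow>
            ((\<exists>g\<in>lip M d \<theta>. AE x in M. f x = g x) \<longleftrightarrow>
             (wavelet_expansion M d A pt \<phi> \<psi> f \<and> star_norm M A pt Q \<phi> \<psi> \<theta> f < \<infinity>)))
       \<and> (\<exists>C\<ge>1. \<forall>f :: 'a \<Rightarrow> complex. L2B M d f \<longrightarrow>
            (\<forall>g\<in>lip M d \<theta>. (AE x in M. f x = g x) \<longrightarrow>
               ennreal (1 / C) * star_norm M A pt Q \<phi> \<psi> \<theta> f \<le> lip_norm M d \<theta> g \<and>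
               lip_norm M d \<theta> g \<le> ennreal C * star_norm M A pt Q \<phi> \<psi> \<theta> f))"
proof -
  interpret wavelet_system M d A0 c0 C0 \<delta> A pt Q \<phi> \<psi> s \<eta> \<nu> Cw by (rule assms(1))
  let ?lip = "lip_norm M d \<theta>" and ?star = "star \<theta>"
  note \<theta> = assms(2,3)
  obtain K1 where K1: "1 \<le> K1" "\<And>N f g. 0 \<le> N \<Longrightarrow> g \<in> borel_measurable M \<Longrightarrow> lip_bound \<theta> N g \<Longrightarrow> L2B M d f \<Longrightarrow>
    AE x in M. f x = g x \<Longrightarrow> expands f \<and> ?star f \<le> ennreal (K1 * N)"
    using lip_imp_expansion[OF \<theta>(1)] by (elim exE conjE) simp
  obtain K2 where K2: "1 \<le> K2" "\<And>N f. 0 \<le> N \<Longrightarrow> expands f \<Longrightarrow> ?star f \<le> ennreal N \<Longrightarrow>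
    \<exists>g\<in>borel_measurable M. lip_bound \<theta> (K2 * N) g \<and> (AE x in M. f x = g x)"
    using expansion_imp_lip[OF \<theta>] by (elim exE conjE) simp
  have lip: "g \<in> borel_measurable M" "lip_bound \<theta> (4 * enn2real (?lip g)) g"
      "?lip g = ennreal (enn2real (?lip g))" if "g \<in> lip M d \<theta>" for g
  proof -
    show g: "g \<in> borel_measurable M" and eq: "?lip g = ennreal (enn2real (?lip g))"
      using that by (auto simp: lip_def L2B_def)
    show "lip_bound \<theta> (4 * enn2real (?lip g)) g"
      using eq by (intro lip_imp_lip_bound g \<theta>(1)) auto
  qed
  have forward: "expands f \<and> ?star f \<le> ennreal (4 * K1) * ?lip g"
    if f: "L2B M d f" and g: "g \<in> lip M d \<theta>" and fg: "AE x in M. f x = g x" for f g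
  proof -
    have "ennreal (K1 * (4 * enn2real (?lip g))) = ennreal (4 * K1) * ennreal (enn2real (?lip g))"
      using K1(1) by (simp add: ennreal_mult[symmetric] mult_ac)
    then show ?thesis
      using K1(2)[OF _ lip(1,2)[OF g] f fg] lip(3)[OF g] by simp
  qed
  have finite_star: "?star f < \<infinity>" if "L2B M d f" "g \<in> lip M d \<theta>" "AE x in M. f x = g x" for f g
  proof -
    have "ennreal (4 * K1) * ?lip g < \<infinity>" using that(2) by (auto simp: lip_def ennreal_mult_less_top)
    then show ?thesis using forward[OF that] by (auto intro: le_less_trans)
  qed
  \<comment> \<open>The bound \<open>lip_bound\<close> for h is exported along with its norm, since
    uniqueness of the representative is stated in terms of it.\<close>
  have backward: "\<exists>h\<in>lip M d \<theta>. (AE x in M. f x = h x) \<and> lip_bound \<theta> (K2 * enn2real (?star f)) h \<and>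
      ?lip h \<le> ennreal K2 * ?star f"
    if ex: "expands f" and fin: "?star f < \<infinity>" for f
  proof -
    have eq: "?star f = ennreal (enn2real (?star f))" using fin by simp
    then obtain h where h: "h \<in> borel_measurable M" "lip_bound \<theta> (K2 * enn2real (?star f)) h" "AE x in M. f x = h x"
      using K2(2)[OF _ ex, of "enn2real (?star f)"] by auto
    have N: "0 \<le> K2 * enn2real (?star f)" using K2(1) by simp
    have "?lip h \<le> ennreal (K2 * enn2real (?star f))" by (rule lip_norm_le[OF h(1,2) N])
    also have "\<dots> = ennreal K2 * ?star f" using K2(1) eq by (simp add: ennreal_mult)
    finally show ?thesis using lip_bound_in_lip[OF h(1,2) N] h by blast
  qed
  define K where "K = max (4 * K1) K2"
  have K: "1 \<le> K" "4 * K1 \<le> K" "K2 \<le> K" using K1(1) by (auto simp: K_def)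
  have norms: "ennreal (1 / K) * ?star f \<le> ?lip g \<and> ?lip g \<le> ennreal K * ?star f"
    if f: "L2B M d f" and g: "g \<in> lip M d \<theta>" and fg: "AE x in M. f x = g x" for f g
  proof
    have "?star f \<le> ennreal K * ?lip g"
      using forward[OF f g fg] K(2) by (meson ennreal_leI mult_right_mono order_trans zero_le)
    then have "ennreal (1 / K) * ?star f \<le> ennreal (1 / K) * (ennreal K * ?lip g)"
      by (intro mult_left_mono) auto
    also have "\<dots> = ?lip g"
      using K(1) by (simp add: mult.assoc[symmetric] ennreal_mult[symmetric])
    finally show "ennreal (1 / K) * ?star f \<le> ?lip g" .
    obtain h where h: "AE x in M. f x = h x" "lip_bound \<theta> (K2 * enn2real (?star f)) h"
        "?lip h \<le> ennreal K2 * ?star f"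
      using backward finite_star[OF f g fg] forward[OF f g fg] by blast
    have "AE x in M. g x = h x" using fg h(1) by auto
    \<comment> \<open>The synthesised h need not look like the given representative g, but both are
      Lipschitz and agree almost everywhere, so the norm bound for h is one for g.\<close>
    then have "g = h" by (rule lip_bound_AE_eq[OF lip(2)[OF g] h(2) _ \<theta>(1)])
    then show "?lip g \<le> ennreal K * ?star f"
      using h(3) K(3) by (meson ennreal_leI mult_right_mono order_trans zero_le)
  qed
  show ?thesis
  proof (intro conjI allI impI iffI exI[of _ K] K(1) ballI)
    fix f :: "'a \<Rightarrow> complex" assume f: "L2B M d f"
    {
      assume "\<exists>g\<in>lip M d \<theta>. AE x in M. f x = g x"
      then obtain g where g: "g \<in> lip M d \<theta>" "AE x in M. f x = g x" by blast
      show "expands f" "?star f < \<infinity>"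
        using forward[OF f g] finite_star[OF f g] by auto
    next
      assume "expands f \<and> ?star f < \<infinity>"
      then show "\<exists>g\<in>lip M d \<theta>. AE x in M. f x = g x" using backward by blast
    next
      fix g assume "g \<in> lip M d \<theta>" "AE x in M. f x = g x"
      from norms[OF f this] show "ennreal (1 / K) * ?star f \<le> ?lip g" "?lip g \<le> ennreal K * ?star f"
        by auto
    }
  qed
qed

end
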